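(* Let $\mathfrak g=\mathfrak k\oplus\mathfrak p$ be the complexification of a real $\mathbb Z_2$-graded quadratic Lie algebra $\mathfrak g_0=\mathfrak k_0\oplus\mathfrak p_0$. Let $(\pi,M)$ be an admissible $(\mathfrak g,K)$-module with a nondegenerate $*$-invariant hermitian form $\langle\,,\,\rangle_M$, and suppose that $M$ admits an infinitesimal character $\chi_M$. Let $\sigma$ be a simple finite-dimensional $\mathfrak k$-module and let $(M\otimes\mathcal P)(\sigma)$ denote the $\Delta(\mathfrak k)$-isotypic component of $\sigma$ in $M\otimes\mathcal P$. If $x\in(M\otimes\mathcal P)(\sigma)$, then $$\langle D^+x,D^+x\rangle_{M\otimes\mathcal P}-\langle D^-x,D^-x\rangle_{M\otimes\mathcal P}=\Big(-\chi_M(\Omega(\mathfrak g))-\tfrac12\sigma(\Omega(\mathfrak k))\Big)\langle x,x\rangle_{M\otimes\mathcal P}+\tfrac32\langle(\pi(\Omega(\mathfrak k))\otimes1)x,x\rangle_{M\otimes\mathcal P}+\tfrac12\langle x,(1\otimes\nu(\Omega(\mathfrak k)))x\rangle_{M\otimes\mathcal P}.$$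
   Context: $\mathfrak g_0=\mathfrak k_0\oplus\mathfrak p_0$ is a finite-dimensional real Lie algebra with a $\mathbb Z_2$-gradation ($[\mathfrak k_0,\mathfrak k_0]\subset\mathfrak k_0$, $[\mathfrak k_0,\mathfrak p_0]\subset\mathfrak p_0$, $[\mathfrak p_0,\mathfrak p_0]\subset\mathfrak k_0$) and a nondegenerate invariant symmetric bilinear form $B$ for which $\mathfrak k_0\perp\mathfrak p_0$ and $B|_{\mathfrak p_0}$ is positive definite; $B$ is extended complex-bilinearly to $\mathfrak g$. $K$ is the group with complexified Lie algebra $\mathfrak k$ of the usual notion of $(\mathfrak g,K)$-module. The bar denotes complex conjugation on $\mathfrak g$ with real points $\mathfrak g_0$ (and the induced conjugation on $S(\mathfrak p)$). $\Omega(\mathfrak g),\Omega(\mathfrak k)$ are the Casimir elements with respect to $B$ (sums $\sum_k w_kw^k$ over $B$-dual bases). $\mathcal W=\mathcal W(\mathfrak p\oplus\mathfrak p^*,\omega)$ is the Weyl algebra: the quotient of the tensor algebra by $vw-wv=\omega(v,w)$, where $\mathfrak p,\mathfrak p^*$ are isotropic and $\omega(\alpha,v)=\alpha(v)$ for $\alpha\in\mathfrak p^*,v\in\mathfrak p$. For a basis $\{z_i\}$ of $\mathfrak p$ with $B$-dual basis $\{z^i\}\subset\mathfrak p$ and dual basis $\{z_i^*\}\subset\mathfrak p^*$: $D^-=\sum_iz_i\otimes z_i^*$, $D^+=\sum_iz_i\otimes z^i$ in $U(\mathfrak g)\otimes\mathcal W$; $\nu:\mathfrak k\to\mathcal W$,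 $\nu(x)=\sum_i[x,z_i]z_i^*$; $\Delta(x)=x\otimes1+1\otimes\nu(x)$ for $x\in\mathfrak k$, with $\nu,\Delta$ extended to $U(\mathfrak k)$. $\mathcal P=S(\mathfrak p)$ is a $\mathcal W$-module: $v\in\mathfrak p$ acts by multiplication and $\alpha\in\mathfrak p^*$ by the derivation with $v\mapsto\alpha(v)$. $U(\mathfrak g)\otimes\mathcal W$ acts on $M\otimes\mathcal P$. The star operation on $\mathcal W$ is the conjugate-linear anti-involution that, for a $B$-orthonormal basis $\{z_i\}$ of $\mathfrak p_0$, exchanges $z_i$ and $z_i^*$. The hermitian pairing $\langle P_1,P_2\rangle_{\mathcal P}=\partial_{P_2}(\overline{P_1})$ (evaluated at $0$), where $\partial_{P}$ is the constant-coefficient differential operator defined by $P$ (via $z_i\mapsto z_i^*$ for an orthonormal basis of $\mathfrak p_0$), is invariant: $\langle aP_1,P_2\rangle_{\mathcal P}=\langle P_1,a^*P_2\rangle_{\mathcal P}$. The star operation on $U(\mathfrak g)$ is the conjugate-linear anti-involution with $x^*=-\overline x$ for $x\in\mathfrak g$, and $*$-invariance of $\langle\,,\,\rangle_M$ means $\langle\pi(u)m,m'\rangle_M=\langle m,\pi(u^* )m'\rangle_M$. Hermitian forms are conjugate-linear in the first and linear in the second variable, and $\langle\,,\,\rangle_{M\otimes\mathcal P}=\langle\,,\,\rangle_M\langle\,,\,\rangle_{\mathcal P}$. $\chi_M(\Omega(\mathfrak g))$ and $\sigma(\Omega(\mathfrak k))$ denote the scalars by which $\Omega(\mathfrak g)$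 acts on $M$ and $\Omega(\mathfrak k)$ acts on $\sigma$. *)

theory Defs
  imports "HOL-Analysis.Analysis" "HOL-Library.Poly_Mapping" "HOL-Algebra.Group"
begin

section \<open>Complex vector spaces and algebras\<close>

class complex_vector = ab_group_add +
  fixes scaleC :: "complex \<Rightarrow> 'a \<Rightarrow> 'a" (infixr \<open>*\<^sub>C\<close> 75)
  assumes scaleC_add_right: "a *\<^sub>C (x + y) = a *\<^sub>C x + a *\<^sub>C y"
    and scaleC_add_left: "(a + b) *\<^sub>C x = a *\<^sub>C x + b *\<^sub>C x"
    and scaleC_scaleC: "a *\<^sub>C (b *\<^sub>C x) = (a * b) *\<^sub>C x"
    and scaleC_one: "1 *\<^sub>C x = x"

class unital_complex_algebra = complex_vector + ring + monoid_mult +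
  assumes mult_scaleC_left: "(a *\<^sub>C x) * y = a *\<^sub>C (x * y)"
    and mult_scaleC_right: "x * (a *\<^sub>C y) = a *\<^sub>C (x * y)"

global_interpretation cvs: vector_space "scaleC :: complex \<Rightarrow> 'a \<Rightarrow> 'a::complex_vector"
  defines cspan = cvs.span
    and csubspace = cvs.subspace
    and cdependent = cvs.dependent
    and crepresentation = cvs.representation
  by unfold_locales (fact scaleC_add_right scaleC_add_left scaleC_scaleC scaleC_one)+

abbreviation clinear :: "('a::complex_vector \<Rightarrow> 'b::complex_vector) \<Rightarrow> bool"
  where "clinear \<equiv> Vector_Spaces.linear scaleC scaleC"

lemma clinearI:
  "(\<And>x y. f (x + y) = f x + f y) \<Longrightarrow> (\<And>c x. f (c *\<^sub>C x) = c *\<^sub>C f x) \<Longrightarrow> clinear f"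
  by unfold_locales auto

lemma clinearD:
  assumes "clinear f"
  shows "f (x + y) = f x + f y" "f (c *\<^sub>C x) = c *\<^sub>C f x" "f 0 = 0" "f (- x) = - f x"
    "f (x - y) = f x - f y"
proof -
  interpret Vector_Spaces.linear scaleC scaleC f by fact
  show "f (x + y) = f x + f y" "f (c *\<^sub>C x) = c *\<^sub>C f x" "f 0 = 0" "f (- x) = - f x"
    "f (x - y) = f x - f y" by (rule add scale zero neg diff)+
qed

definition cbilinear :: "('a::complex_vector \<Rightarrow> 'b::complex_vector \<Rightarrow> 'c::complex_vector) \<Rightarrow> bool"
  where "cbilinear f \<longleftrightarrow> (\<forall>x. clinear (f x)) \<and> (\<forall>y. clinear (\<lambda>x. f x y))"

lemma cbilinearD:
  assumes "cbilinear f"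
  shows "f (x + y) z = f x z + f y z" "f (c *\<^sub>C x) z = c *\<^sub>C f x z"
    "f x (u + v) = f x u + f x v" "f x (c *\<^sub>C u) = c *\<^sub>C f x u"
proof -
  have *: "clinear (\<lambda>x. f x z)" and **: "clinear (f x)" using assms by (auto simp: cbilinear_def)
  show "f (x + y) z = f x z + f y z" "f (c *\<^sub>C x) z = c *\<^sub>C f x z"
    using clinearD(1,2)[OF *] by auto
  show "f x (u + v) = f x u + f x v" "f x (c *\<^sub>C u) = c *\<^sub>C f x u"
    using clinearD(1,2)[OF **] by auto
qed

definition cfin_dim :: "'a::complex_vector set \<Rightarrow> bool"
  where "cfin_dim V \<longleftrightarrow> (\<exists>S. finite S \<and> V \<subseteq> cspan S)"

definition cbasis :: "'a::complex_vector set \<Rightarrow> bool"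
  where "cbasis b \<longleftrightarrow> finite b \<and> \<not> cdependent b \<and> cspan b = UNIV"

instantiation complex :: unital_complex_algebra
begin
definition scaleC_complex :: "complex \<Rightarrow> complex \<Rightarrow> complex" where "scaleC_complex = (*)"
instance by standard (simp_all add: scaleC_complex_def algebra_simps)
end

instantiation prod :: (complex_vector, complex_vector) complex_vector
begin
definition "scaleC c x = (c *\<^sub>C fst x, c *\<^sub>C snd x)"
instance by standard (simp_all add: scaleC_prod_def scaleC_add_right scaleC_add_left scaleC_scaleC scaleC_one)
end

typedef (overloaded) 'v dual = "{f :: 'v::complex_vector \<Rightarrow> complex. clinear f}"
  morphisms dual_app Abs_dual
  by (rule exI[of _ "\<lambda>_. 0"]) (simp add: clinearI)

setup_lifting type_definition_dual

instantiation dual :: (complex_vector) complex_vector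
begin
lift_definition zero_dual :: "'a dual" is "\<lambda>_. 0" by (rule clinearI) auto
lift_definition plus_dual :: "'a dual \<Rightarrow> 'a dual \<Rightarrow> 'a dual" is "\<lambda>f g x. f x + g x"
  by (rule clinearI) (simp_all add: clinearD scaleC_complex_def algebra_simps)
lift_definition minus_dual :: "'a dual \<Rightarrow> 'a dual \<Rightarrow> 'a dual" is "\<lambda>f g x. f x - g x"
  by (rule clinearI) (simp_all add: clinearD scaleC_complex_def algebra_simps)
lift_definition uminus_dual :: "'a dual \<Rightarrow> 'a dual" is "\<lambda>f x. - f x"
  by (rule clinearI) (simp_all add: clinearD scaleC_complex_def algebra_simps)
lift_definition scaleC_dual :: "complex \<Rightarrow> 'a dual \<Rightarrow> 'a dual" is "\<lambda>c f x. c * f x"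
  by (rule clinearI) (simp_all add: clinearD scaleC_complex_def algebra_simps)
instance by standard (transfer; simp add: algebra_simps fun_eq_iff)+
end

instantiation poly_mapping :: (type, complex_vector) complex_vector
begin
lift_definition scaleC_poly_mapping :: "complex \<Rightarrow> ('a \<Rightarrow>\<^sub>0 'b) \<Rightarrow> 'a \<Rightarrow>\<^sub>0 'b" is "\<lambda>c f k. c *\<^sub>C f k"
  by (rule finite_subset) auto
instance
  by standard (transfer; simp add: fun_eq_iff scaleC_add_right scaleC_add_left scaleC_scaleC scaleC_one)+
end

lemma scaleC_single:
  "c *\<^sub>C Poly_Mapping.single k (d :: complex) = Poly_Mapping.single k (c * d)"
  by transfer (auto simp: fun_eq_iff when_def scaleC_complex_def)

section \<open>Finitely supported extensions\<close>

definition pm_ext :: "('k \<Rightarrow> 'b::zero \<Rightarrow> 'c::comm_monoid_add) \<Rightarrow> ('k \<Rightarrow>\<^sub>0 'b) \<Rightarrow> 'c"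
  where "pm_ext F f = (\<Sum>k\<in>Poly_Mapping.keys f. F k (Poly_Mapping.lookup f k))"

lemma pm_ext_superset:
  assumes "finite S" "Poly_Mapping.keys f \<subseteq> S" "\<And>k. F k 0 = 0"
  shows "pm_ext F f = (\<Sum>k\<in>S. F k (Poly_Mapping.lookup f k))"
  unfolding pm_ext_def
  by (rule sum.mono_neutral_left) (use assms in \<open>auto simp: in_keys_iff\<close>)

lemma pm_ext_zero [simp]: "pm_ext F 0 = 0"
  by (simp add: pm_ext_def)

lemma pm_ext_single: "F k 0 = 0 \<Longrightarrow> pm_ext F (Poly_Mapping.single k c) = F k c"
  by (cases "c = 0") (simp_all add: pm_ext_def)

lemma pm_ext_add:
  assumes "\<And>k. F k 0 = 0" "\<And>k a b. F k (a + b) = F k a + F k b"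
  shows "pm_ext F (f + g) = pm_ext F f + pm_ext F g"
proof -
  let ?S = "Poly_Mapping.keys f \<union> Poly_Mapping.keys g"
  have *: "Poly_Mapping.keys (f + g) \<subseteq> ?S" by (rule Poly_Mapping.keys_add)
  show ?thesis
    using pm_ext_superset[of ?S "f + g" F] pm_ext_superset[of ?S f F] pm_ext_superset[of ?S g F]
      assms * by (simp add: lookup_add sum.distrib)
qed

lemma pm_ext_diff:
  fixes F :: "'k \<Rightarrow> 'b::ab_group_add \<Rightarrow> 'c::ab_group_add"
  assumes "\<And>k. F k 0 = 0" "\<And>k a b. F k (a + b) = F k a + F k b"
  shows "pm_ext F (f - g) = pm_ext F f - pm_ext F g"
  using pm_ext_add[where F = F and f = "f - g" and g = g] assms by simp

lemma pm_induct [case_names single add]: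
  fixes f :: "'k \<Rightarrow>\<^sub>0 'b::comm_monoid_add"
  assumes "\<And>k c. P (Poly_Mapping.single k c)" "\<And>f g. P f \<Longrightarrow> P g \<Longrightarrow> P (f + g)"
  shows "P f"
proof (induction f rule: update_induct)
  case const
  then show ?case using assms(1)[of _ 0] by simp
next
  case (update f k c)
  have "Poly_Mapping.update k c f = f + Poly_Mapping.single k c"
    using update(1) by (intro poly_mapping_eqI)
      (auto simp: lookup_update lookup_add lookup_single when_def in_keys_iff)
  then show ?case using assms update by metis
qed

section \<open>Algebras presented by generators and relations\<close>

datatype 'a fword = Word (letters: "'a list")

instantiation fword :: (type) monoid_add
begin
definition "0 = Word []"
definition "u + v = Word (letters u @ letters v)"
instance by standard (simp_all add: zero_fword_def plus_fword_def)
end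

lemma letters_simps [simp]: "letters 0 = []" "letters (u + v) = letters u @ letters v"
  by (simp_all add: zero_fword_def plus_fword_def)

text \<open>\<open>'a falg\<close> is the free associative unital complex algebra on the set of all elements
  of \<open>'a\<close>; the relations \<open>lin_rels\<close> turn it into the tensor algebra of the vector space \<open>'a\<close>.\<close>

type_synonym 'a falg = "'a fword \<Rightarrow>\<^sub>0 complex"

definition fgen :: "'a \<Rightarrow> 'a falg"
  where "fgen x = Poly_Mapping.single (Word [x]) 1"

lemma scaleC_falg: "c *\<^sub>C (f :: 'a falg) = Poly_Mapping.single 0 c * f"
  "c *\<^sub>C (f :: 'a falg) = f * Poly_Mapping.single 0 c"
proof -
  show "c *\<^sub>C (f :: 'a falg) = Poly_Mapping.single 0 c * f"
    by (induction f rule: pm_induct) (simp_all add: scaleC_single mult_single scaleC_add_right distrib_left)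
  show "c *\<^sub>C (f :: 'a falg) = f * Poly_Mapping.single 0 c"
    by (induction f rule: pm_induct)
      (simp_all add: scaleC_single mult_single scaleC_add_right distrib_right mult.commute)
qed

lemma mult_scaleC_falg:
  "(c *\<^sub>C (f :: 'a falg)) * g = c *\<^sub>C (f * g)" "f * (c *\<^sub>C g) = c *\<^sub>C ((f :: 'a falg) * g)"
  by (simp add: scaleC_falg(1) mult.assoc, simp add: scaleC_falg(2) mult.assoc)

inductive_set gen_ideal :: "'a::ring_1 set \<Rightarrow> 'a set" for R where
  gen_ideal_zero: "0 \<in> gen_ideal R"
| gen_ideal_gen: "r \<in> R \<Longrightarrow> a * r * b \<in> gen_ideal R"
| gen_ideal_add: "x \<in> gen_ideal R \<Longrightarrow> y \<in> gen_ideal R \<Longrightarrow> x + y \<in> gen_ideal R"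

lemma gen_ideal_mult:
  assumes "x \<in> gen_ideal R"
  shows "a * x * b \<in> gen_ideal R"
  using assms
proof induction
  case (gen_ideal_gen r c d)
  then show ?case using gen_ideal.gen_ideal_gen[of r R "a * c" "d * b"] by (simp add: mult.assoc)
qed (auto simp: distrib_left distrib_right intro: gen_ideal.intros)

lemma gen_ideal_mult_left: "x \<in> gen_ideal R \<Longrightarrow> a * x \<in> gen_ideal R"
  using gen_ideal_mult[of x R a 1] by simp

lemma gen_ideal_mult_right: "x \<in> gen_ideal R \<Longrightarrow> x * b \<in> gen_ideal R"
  using gen_ideal_mult[of x R 1 b] by simp

lemma gen_ideal_base: "x \<in> R \<Longrightarrow> x \<in> gen_ideal R"
  using gen_ideal_gen[of x R 1 1] by simp

lemma gen_ideal_uminus: "x \<in> gen_ideal R \<Longrightarrow> - x \<in> gen_ideal R"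
  using gen_ideal_mult_left[of x R "- 1"] by simp

lemma gen_ideal_diff: "x \<in> gen_ideal R \<Longrightarrow> y \<in> gen_ideal R \<Longrightarrow> x - y \<in> gen_ideal R"
  using gen_ideal_add[of x R "- y"] gen_ideal_uminus[of y R] by simp

definition ideal_rel :: "'a::ring_1 set \<Rightarrow> 'a \<Rightarrow> 'a \<Rightarrow> bool"
  where "ideal_rel R x y \<longleftrightarrow> x - y \<in> gen_ideal R"

lemma ideal_rel_equivp: "equivp (ideal_rel R)"
proof (rule equivpI)
  show "reflp (ideal_rel R)" by (simp add: reflp_def ideal_rel_def gen_ideal_zero)
  show "symp (ideal_rel R)"
    unfolding symp_def ideal_rel_def by (metis gen_ideal_uminus minus_diff_eq)
  show "transp (ideal_rel R)"
  proof (rule transpI)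
    fix x y z assume "ideal_rel R x y" "ideal_rel R y z"
    then show "ideal_rel R x z"
      unfolding ideal_rel_def using gen_ideal_add[of "x - y" R "y - z"] by simp
  qed
qed

lemma ideal_rel_refl: "ideal_rel R x x"
  by (simp add: ideal_rel_def gen_ideal_zero)

lemma ideal_rel_add: "ideal_rel R x y \<Longrightarrow> ideal_rel R z w \<Longrightarrow> ideal_rel R (x + z) (y + w)"
  unfolding ideal_rel_def using gen_ideal_add[of "x - y" R "z - w"] by (simp add: algebra_simps)

lemma ideal_rel_uminus: "ideal_rel R x y \<Longrightarrow> ideal_rel R (- x) (- y)"
  unfolding ideal_rel_def using gen_ideal_uminus[of "x - y" R] by (simp add: algebra_simps)

lemma ideal_rel_diff: "ideal_rel R x y \<Longrightarrow> ideal_rel R z w \<Longrightarrow> ideal_rel R (x - z) (y - w)"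
  unfolding ideal_rel_def using gen_ideal_diff[of "x - y" R "z - w"] by (simp add: algebra_simps)

lemma ideal_rel_mult:
  assumes "ideal_rel R x y" "ideal_rel R z w"
  shows "ideal_rel R (x * z) (y * w)"
proof -
  have "(x - y) * z + y * (z - w) \<in> gen_ideal R"
    using assms unfolding ideal_rel_def
    by (intro gen_ideal_add gen_ideal_mult_left gen_ideal_mult_right)
  then show ?thesis unfolding ideal_rel_def by (simp add: algebra_simps)
qed

lemma ideal_rel_scaleC: "ideal_rel R x y \<Longrightarrow> ideal_rel R (c *\<^sub>C x) (c *\<^sub>C (y :: 'a falg))"
  unfolding scaleC_falg(1) by (intro ideal_rel_mult ideal_rel_refl)

definition lin_rels :: "'v::complex_vector falg set" where
  "lin_rels = {fgen (x + y) - fgen x - fgen y | x y. True} \<union> {fgen (c *\<^sub>C x) - c *\<^sub>C fgen x | c x. True}"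

text \<open>Linear extension of a function on words, and the operator by which an element of the
  free algebra acts when the generator \<open>x\<close> acts by \<open>\<rho> x\<close>.\<close>

definition free_lin :: "('v list \<Rightarrow> 'c::complex_vector) \<Rightarrow> 'v falg \<Rightarrow> 'c"
  where "free_lin F = pm_ext (\<lambda>w c. c *\<^sub>C F (letters w))"

definition free_act :: "('v \<Rightarrow> 'm \<Rightarrow> 'm) \<Rightarrow> 'v falg \<Rightarrow> 'm \<Rightarrow> 'm::complex_vector"
  where "free_act \<rho> f m = free_lin (\<lambda>w. foldr \<rho> w m) f"

lemma scaleC_zero_left [simp]: "0 *\<^sub>C x = (0 :: 'a::complex_vector)"
  and scaleC_zero_right [simp]: "c *\<^sub>C 0 = (0 :: 'a::complex_vector)"
  and scaleC_minus_right [simp]: "c *\<^sub>C (- x) = - (c *\<^sub>C (x :: 'a))"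
  and scaleC_diff_right: "c *\<^sub>C (x - y) = c *\<^sub>C x - c *\<^sub>C (y :: 'a)"
  by (rule cvs.scale_zero_left cvs.scale_zero_right cvs.scale_minus_right cvs.scale_right_diff_distrib)+

lemma free_lin_simps:
  "free_lin F 0 = 0"
  "free_lin F (f + g) = free_lin F f + free_lin F g"
  "free_lin F (f - g) = free_lin F f - free_lin F g"
  "free_lin F (Poly_Mapping.single w c) = c *\<^sub>C F (letters w)"
  "free_lin F (fgen x) = F [x]"
  "free_lin F 1 = F []"
proof -
  show "free_lin F (Poly_Mapping.single w c) = c *\<^sub>C F (letters w)" for w c
    by (simp add: free_lin_def pm_ext_single)
  from this show "free_lin F (fgen x) = F [x]" "free_lin F 1 = F []"
    by (simp_all add: fgen_def scaleC_one flip: single_one)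
qed (simp_all add: free_lin_def pm_ext_add pm_ext_diff scaleC_add_left)

lemma free_lin_scaleC: "free_lin F (c *\<^sub>C f) = c *\<^sub>C free_lin F f"
  by (induction f rule: pm_induct)
    (simp_all add: scaleC_falg(1) mult_single free_lin_simps scaleC_add_right scaleC_scaleC distrib_left)

lemma free_act_simps:
  "free_act \<rho> 0 m = 0"
  "free_act \<rho> (f + g) m = free_act \<rho> f m + free_act \<rho> g m"
  "free_act \<rho> (f - g) m = free_act \<rho> f m - free_act \<rho> g m"
  "free_act \<rho> (c *\<^sub>C f) m = c *\<^sub>C free_act \<rho> f m"
  "free_act \<rho> (Poly_Mapping.single w c) m = c *\<^sub>C foldr \<rho> (letters w) m"
  "free_act \<rho> (fgen x) m = \<rho> x m"
  "free_act \<rho> 1 m = m"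
  by (simp_all add: free_act_def free_lin_simps free_lin_scaleC)

lemma foldr_clinear: "(\<And>x. clinear (\<rho> x)) \<Longrightarrow> clinear (\<lambda>m. foldr \<rho> w m)"
proof (induction w)
  case Nil then show ?case by (simp add: clinearI)
next
  case (Cons a w)
  then show ?case by (auto intro!: clinearI simp: clinearD)
qed

lemma free_act_clinear:
  assumes "\<And>x. clinear (\<rho> x)"
  shows "clinear (free_act \<rho> f)"
proof (induction f rule: pm_induct)
  case (single k c)
  then show ?case using foldr_clinear[of \<rho> "letters k", OF assms]
    by (auto intro!: clinearI simp: free_act_simps clinearD scaleC_add_right scaleC_scaleC mult.commute)
next
  case (add f g)
  then show ?case by (auto intro!: clinearI simp: free_act_simps clinearD scaleC_add_right algebra_simps)
qed

lemma free_act_mult: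
  assumes "\<And>x. clinear (\<rho> x)"
  shows "free_act \<rho> (f * g) m = free_act \<rho> f (free_act \<rho> g m)"
proof (induction g rule: pm_induct)
  case (single k c)
  show ?case
    by (induction f rule: pm_induct)
      (simp_all add: free_act_simps mult_single distrib_right scaleC_scaleC
        clinearD[OF foldr_clinear[of \<rho>, OF assms]])
next
  case (add f g)
  then show ?case using free_act_clinear[of \<rho>, OF assms]
    by (simp add: distrib_left free_act_simps clinearD)
qed

lemma free_act_gen_ideal:
  assumes "f \<in> gen_ideal R" "\<And>x. clinear (\<rho> x)" "\<And>r m. r \<in> R \<Longrightarrow> free_act \<rho> r m = 0"
  shows "free_act \<rho> f m = 0"
  using assms(1) by induction
    (simp_all add: assms free_act_simps free_act_mult clinearD(3)[OF free_act_clinear[of \<rho>]])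

lemma free_act_lin_rels:
  assumes "r \<in> lin_rels" "cbilinear \<rho>"
  shows "free_act \<rho> r m = 0"
  using assms by (auto simp: lin_rels_def free_act_simps cbilinearD[of \<rho>])


section \<open>Tensor products\<close>

definition tensor_rels :: "('a::complex_vector \<times> 'b::complex_vector \<Rightarrow>\<^sub>0 complex) set" where
  "tensor_rels =
     {Poly_Mapping.single (x + y, z) 1 - Poly_Mapping.single (x, z) 1 - Poly_Mapping.single (y, z) 1 | x y z. True}
   \<union> {Poly_Mapping.single (x, y + z) 1 - Poly_Mapping.single (x, y) 1 - Poly_Mapping.single (x, z) 1 | x y z. True}
   \<union> {Poly_Mapping.single (c *\<^sub>C x, z) 1 - c *\<^sub>C Poly_Mapping.single (x, z) 1 | c x z. True}
   \<union> {Poly_Mapping.single (x, c *\<^sub>C z) 1 - c *\<^sub>C Poly_Mapping.single (x, z) 1 | c x z. True}"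

definition tensor_eq :: "('a::complex_vector \<times> 'b::complex_vector \<Rightarrow>\<^sub>0 complex) \<Rightarrow> ('a \<times> 'b \<Rightarrow>\<^sub>0 complex) \<Rightarrow> bool"
  where "tensor_eq f g \<longleftrightarrow> f - g \<in> cspan tensor_rels"

lemma tensor_eq_equivp: "equivp (tensor_eq :: ('a::complex_vector \<times> 'b::complex_vector \<Rightarrow>\<^sub>0 complex) \<Rightarrow> _)"
proof (rule equivpI)
  let ?R = "tensor_eq :: ('a \<times> 'b \<Rightarrow>\<^sub>0 complex) \<Rightarrow> _"
  show "reflp ?R" by (simp add: reflp_def tensor_eq_def cvs.span_zero)
  show "symp ?R" unfolding symp_def tensor_eq_def by (metis cvs.span_neg minus_diff_eq)
  show "transp ?R"
  proof (rule transpI)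
    fix x y z :: "'a \<times> 'b \<Rightarrow>\<^sub>0 complex"
    assume "tensor_eq x y" "tensor_eq y z"
    then show "tensor_eq x z"
      unfolding tensor_eq_def using cvs.span_add[of "x - y" tensor_rels "y - z"] by simp
  qed
qed

quotient_type (overloaded) ('a, 'b) tensor =
  "'a::complex_vector \<times> 'b::complex_vector \<Rightarrow>\<^sub>0 complex" / tensor_eq
  morphisms rep_tensor abs_tensor
  by (rule tensor_eq_equivp)

instantiation tensor :: (complex_vector, complex_vector) complex_vector
begin
lift_definition zero_tensor :: "('a, 'b) tensor" is 0 .
lift_definition plus_tensor :: "('a, 'b) tensor \<Rightarrow> ('a, 'b) tensor \<Rightarrow> ('a, 'b) tensor" is "(+)"
proof -
  fix f1 f2 f3 f4 :: "'a \<times> 'b \<Rightarrow>\<^sub>0 complex"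
  assume "tensor_eq f1 f2" "tensor_eq f3 f4"
  then show "tensor_eq (f1 + f3) (f2 + f4)"
    unfolding tensor_eq_def using cvs.span_add[of "f1 - f2" tensor_rels "f3 - f4"]
    by (simp add: algebra_simps)
qed
lift_definition uminus_tensor :: "('a, 'b) tensor \<Rightarrow> ('a, 'b) tensor" is uminus
proof -
  fix f g :: "'a \<times> 'b \<Rightarrow>\<^sub>0 complex"
  assume "tensor_eq f g"
  then show "tensor_eq (- f) (- g)"
    unfolding tensor_eq_def using cvs.span_neg[of "f - g" tensor_rels] by simp
qed
lift_definition minus_tensor :: "('a, 'b) tensor \<Rightarrow> ('a, 'b) tensor \<Rightarrow> ('a, 'b) tensor" is "(-)"
proof -
  fix f1 f2 f3 f4 :: "'a \<times> 'b \<Rightarrow>\<^sub>0 complex"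
  assume "tensor_eq f1 f2" "tensor_eq f3 f4"
  then show "tensor_eq (f1 - f3) (f2 - f4)"
    unfolding tensor_eq_def using cvs.span_diff[of "f1 - f2" tensor_rels "f3 - f4"]
    by (simp add: algebra_simps)
qed
lift_definition scaleC_tensor :: "complex \<Rightarrow> ('a, 'b) tensor \<Rightarrow> ('a, 'b) tensor" is scaleC
  unfolding tensor_eq_def by (metis cvs.span_scale scaleC_diff_right)
instance
proof
  fix x y z :: "('a, 'b) tensor" and a b
  note [simp] = tensor_eq_def cvs.span_zero
  show "x + y + z = x + (y + z)" by transfer (simp add: algebra_simps)
  show "x + y = y + x" by transfer (simp add: algebra_simps)
  show "0 + x = x" by transfer simp
  show "- x + x = 0" by transfer simp
  show "x - y = x + - y" by transfer simp
  show "a *\<^sub>C (x + y) = a *\<^sub>C x + a *\<^sub>C y" by transfer (simp add: scaleC_add_right)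
  show "(a + b) *\<^sub>C x = a *\<^sub>C x + b *\<^sub>C x" by transfer (simp add: scaleC_add_left)
  show "a *\<^sub>C b *\<^sub>C x = (a * b) *\<^sub>C x" by transfer (simp add: scaleC_scaleC)
  show "1 *\<^sub>C x = x" by transfer (simp add: scaleC_one)
qed
end

lift_definition tens :: "'a::complex_vector \<Rightarrow> 'b::complex_vector \<Rightarrow> ('a, 'b) tensor" (infixl \<open>\<otimes>\<^sub>C\<close> 72)
  is "\<lambda>a b. Poly_Mapping.single (a, b) 1" .

definition tensor_lift ::
  "('a::complex_vector \<Rightarrow> 'b::complex_vector \<Rightarrow> 'c::complex_vector) \<Rightarrow> ('a, 'b) tensor \<Rightarrow> 'c"
  where "tensor_lift \<beta> t = pm_ext (\<lambda>(a, b) c. c *\<^sub>C \<beta> a b) (rep_tensor t)"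

lemma tensor_lift_abs:
  assumes "cbilinear \<beta>"
  shows "tensor_lift \<beta> (abs_tensor f) = pm_ext (\<lambda>(a, b) c. c *\<^sub>C \<beta> a b) f"
proof -
  let ?E = "pm_ext (\<lambda>(a, b) c. c *\<^sub>C \<beta> a b)"
  have add: "?E (f + g) = ?E f + ?E g" for f g
    by (rule pm_ext_add) (auto simp: scaleC_add_left)
  have diff: "?E (f - g) = ?E f - ?E g" for f g
    by (rule pm_ext_diff) (auto simp: scaleC_add_left)
  have single: "?E (Poly_Mapping.single (a, b) c) = c *\<^sub>C \<beta> a b" for a b c
    by (subst pm_ext_single) auto
  have scale: "?E (c *\<^sub>C f) = c *\<^sub>C ?E f" for c f
  proof (induction f rule: pm_induct)
    case (single k d) then show ?case
      by (cases k) (simp add: scaleC_single pm_ext_single scaleC_scaleC)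
  qed (simp add: add scaleC_add_right)
  have lin: "clinear ?E" by (rule clinearI) (simp_all add: add scale)
  have rel: "?E r = 0" if "r \<in> tensor_rels" for r
    using that assms unfolding tensor_rels_def
    by (auto simp: diff scale single cbilinearD[of \<beta>] scaleC_one)
  have van: "?E r = 0" if "r \<in> cspan tensor_rels" for r
    by (rule cvs.span_induct_alt[OF that]) (simp_all add: add scale rel)
  have "tensor_eq (rep_tensor (abs_tensor f)) f"
    using Quotient3_abs_rep[OF Quotient3_tensor] by (simp flip: tensor.abs_eq_iff)
  then have "?E (rep_tensor (abs_tensor f) - f) = 0" unfolding tensor_eq_def by (rule van)
  then show ?thesis by (simp add: tensor_lift_def diff)
qed

lemma tensor_lift_tens: "cbilinear \<beta> \<Longrightarrow> tensor_lift \<beta> (a \<otimes>\<^sub>C b) = \<beta> a b"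
  unfolding tens.abs_eq by (subst tensor_lift_abs) (auto simp: pm_ext_single scaleC_one)

section \<open>The symmetric algebra\<close>

definition sym_rels :: "'v::complex_vector falg set" where
  "sym_rels = lin_rels \<union> {fgen x * fgen y - fgen y * fgen x | x y. True}"

quotient_type (overloaded) 'v sym = "'v::complex_vector falg" / "ideal_rel sym_rels"
  morphisms rep_sym abs_sym
  by (rule ideal_rel_equivp)

instantiation sym :: (complex_vector) unital_complex_algebra
begin
lift_definition zero_sym :: "'a sym" is 0 .
lift_definition one_sym :: "'a sym" is 1 .
lift_definition plus_sym :: "'a sym \<Rightarrow> 'a sym \<Rightarrow> 'a sym" is "(+)" by (rule ideal_rel_add)
lift_definition minus_sym :: "'a sym \<Rightarrow> 'a sym \<Rightarrow> 'a sym" is "(-)" by (rule ideal_rel_diff)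
lift_definition uminus_sym :: "'a sym \<Rightarrow> 'a sym" is uminus by (rule ideal_rel_uminus)
lift_definition times_sym :: "'a sym \<Rightarrow> 'a sym \<Rightarrow> 'a sym" is "(*)" by (rule ideal_rel_mult)
lift_definition scaleC_sym :: "complex \<Rightarrow> 'a sym \<Rightarrow> 'a sym" is scaleC by (rule ideal_rel_scaleC)
instance
proof
  fix x y z :: "'a sym" and a b
  show "x + y + z = x + (y + z)" by transfer (simp add: add.assoc ideal_rel_refl)
  show "x + y = y + x" by transfer (simp add: add.commute ideal_rel_refl)
  show "0 + x = x" by transfer (simp add: ideal_rel_refl)
  show "- x + x = 0" by transfer (simp add: ideal_rel_refl)
  show "x - y = x + - y" by transfer (simp add: ideal_rel_refl)
  show "a *\<^sub>C (x + y) = a *\<^sub>C x + a *\<^sub>C y" by transfer (simp add: scaleC_add_right ideal_rel_refl)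
  show "(a + b) *\<^sub>C x = a *\<^sub>C x + b *\<^sub>C x" by transfer (simp add: scaleC_add_left ideal_rel_refl)
  show "a *\<^sub>C b *\<^sub>C x = (a * b) *\<^sub>C x" by transfer (simp add: scaleC_scaleC ideal_rel_refl)
  show "1 *\<^sub>C x = x" by transfer (simp add: scaleC_one ideal_rel_refl)
  show "x * y * z = x * (y * z)" by transfer (simp add: mult.assoc ideal_rel_refl)
  show "1 * x = x" by transfer (simp add: ideal_rel_refl)
  show "x * 1 = x" by transfer (simp add: ideal_rel_refl)
  show "(x + y) * z = x * z + y * z" by transfer (simp add: distrib_right ideal_rel_refl)
  show "x * (y + z) = x * y + x * z" by transfer (simp add: distrib_left ideal_rel_refl)
  show "(a *\<^sub>C x) * y = a *\<^sub>C (x * y)" by transfer (simp add: mult_scaleC_falg ideal_rel_refl)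
  show "x * (a *\<^sub>C y) = a *\<^sub>C (x * y)" by transfer (simp add: mult_scaleC_falg ideal_rel_refl)
qed
end

lift_definition sym_in :: "'v::complex_vector \<Rightarrow> 'v sym" is fgen .

lemma abs_sym_hom:
  "abs_sym (f + g) = abs_sym f + abs_sym g" "abs_sym (f - g) = abs_sym f - abs_sym g"
  "abs_sym (f * g) = abs_sym f * abs_sym g" "abs_sym (c *\<^sub>C f) = c *\<^sub>C abs_sym f"
  "abs_sym 1 = 1" "abs_sym 0 = 0" "abs_sym (fgen x) = sym_in x"
  by (simp_all add: plus_sym.abs_eq minus_sym.abs_eq times_sym.abs_eq scaleC_sym.abs_eq one_sym.abs_eq
      zero_sym.abs_eq sym_in.abs_eq)

lemma single_fword: "Poly_Mapping.single w c = c *\<^sub>C prod_list (map fgen (letters w))"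
proof -
  have "prod_list (map fgen l) = (Poly_Mapping.single (Word l) 1 :: 'a falg)" for l :: "'a list"
    by (induction l) (simp_all add: fgen_def mult_single plus_fword_def flip: single_one zero_fword_def)
  from this[of "letters w"] show ?thesis by (simp add: scaleC_single)
qed

lemma abs_sym_single: "abs_sym (Poly_Mapping.single w c) = c *\<^sub>C prod_list (map sym_in (letters w))"
proof -
  have "abs_sym (prod_list (map fgen l)) = prod_list (map sym_in l)" for l :: "'a list"
    by (induction l) (simp_all add: abs_sym_hom)
  then show ?thesis by (simp add: single_fword abs_sym_hom)
qed

text \<open>\<open>sym_deriv \<alpha>\<close> is the derivation of the symmetric algebra with \<open>v \<mapsto> \<alpha>(v)\<close>.\<close>

primrec word_deriv :: "'v::complex_vector dual \<Rightarrow> 'v list \<Rightarrow> 'v sym" where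
  "word_deriv \<alpha> [] = 0"
| "word_deriv \<alpha> (v # w) = dual_app \<alpha> v *\<^sub>C prod_list (map sym_in w) + sym_in v * word_deriv \<alpha> w"

lemma word_deriv_append:
  "word_deriv \<alpha> (u @ w) =
     word_deriv \<alpha> u * prod_list (map sym_in w) + prod_list (map sym_in u) * word_deriv \<alpha> w"
  by (induction u) (simp_all add: distrib_left distrib_right mult.assoc mult_scaleC_left)

lemma free_deriv_mult:
  "free_lin (word_deriv \<alpha>) (f * g) =
     free_lin (word_deriv \<alpha>) f * abs_sym g + abs_sym f * free_lin (word_deriv \<alpha>) g"
proof (induction f rule: pm_induct)
  case (single k c)
  show ?case
    by (induction g rule: pm_induct)
      (simp_all add: mult_single free_lin_simps abs_sym_single abs_sym_hom word_deriv_append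
        scaleC_add_right mult_scaleC_left mult_scaleC_right scaleC_scaleC distrib_left algebra_simps)
qed (simp_all add: distrib_right free_lin_simps abs_sym_hom algebra_simps)

lemma abs_sym_ideal: "r \<in> gen_ideal sym_rels \<Longrightarrow> abs_sym r = 0"
  unfolding zero_sym_def by (simp add: sym.abs_eq_iff ideal_rel_def)

lemma dual_app_linear: "clinear (dual_app \<alpha>)"
  using dual_app by blast

lemma free_deriv_ideal: "r \<in> gen_ideal sym_rels \<Longrightarrow> free_lin (word_deriv \<alpha>) r = 0"
proof (induction rule: gen_ideal.induct)
  case (gen_ideal_gen r a b)
  have "free_lin (word_deriv \<alpha>) r = 0"
    using gen_ideal_gen unfolding sym_rels_def lin_rels_def
    by (auto simp: free_lin_simps free_lin_scaleC free_deriv_mult abs_sym_hom clinearD[OF dual_app_linear]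
        scaleC_add_left scaleC_complex_def mult_scaleC_left mult_scaleC_right scaleC_scaleC)
  then show ?case by (simp add: free_deriv_mult abs_sym_hom abs_sym_ideal gen_ideal_base gen_ideal_gen)
qed (simp_all add: free_lin_simps)

lift_definition sym_deriv :: "'v::complex_vector dual \<Rightarrow> 'v sym \<Rightarrow> 'v sym"
  is "\<lambda>\<alpha>. free_lin (word_deriv \<alpha>)"
proof -
  fix \<alpha> :: "'v dual" and f g :: "'v falg"
  assume "ideal_rel sym_rels f g"
  then have "free_lin (word_deriv \<alpha>) (f - g) = 0"
    unfolding ideal_rel_def by (rule free_deriv_ideal)
  then show "free_lin (word_deriv \<alpha>) f = free_lin (word_deriv \<alpha>) g" by (simp add: free_lin_simps)
qed

lemma sym_deriv_in: "sym_deriv \<alpha> (sym_in v) = dual_app \<alpha> v *\<^sub>C 1"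
  by transfer (simp add: free_lin_simps)

lemma sym_deriv_mult: "sym_deriv \<alpha> (f * g) = sym_deriv \<alpha> f * g + f * sym_deriv \<alpha> g"
proof -
  obtain f' g' where "f = abs_sym f'" "g = abs_sym g'" using Quotient3_abs_rep[OF Quotient3_sym] by metis
  then show ?thesis by (simp add: sym_deriv.abs_eq free_deriv_mult flip: abs_sym_hom)
qed

lemma sym_deriv_linear: "clinear (sym_deriv \<alpha>)"
  by (rule clinearI; transfer; simp add: free_lin_simps free_lin_scaleC)

lift_definition sym_eval0 :: "'v::complex_vector sym \<Rightarrow> complex"
  is "free_lin (\<lambda>w. if w = [] then 1 else 0)"
proof -
  let ?E = "free_lin (\<lambda>w. if w = [] then 1 else 0) :: 'v falg \<Rightarrow> complex"
  have mult: "?E (f * g) = ?E f * ?E g" for f g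
  proof (induction f rule: pm_induct)
    case (single k c)
    show ?case by (induction g rule: pm_induct)
      (simp_all add: mult_single free_lin_simps distrib_left scaleC_complex_def)
  qed (simp add: distrib_right free_lin_simps)
  have "?E r = 0" if "r \<in> gen_ideal sym_rels" for r
    using that
  proof induction
    case (gen_ideal_gen r a b)
    then show ?case unfolding sym_rels_def lin_rels_def
      by (auto simp: mult free_lin_simps free_lin_scaleC)
  qed (simp_all add: free_lin_simps)
  then have "?E (f - g) = 0" if "ideal_rel sym_rels f g" for f g
    using that unfolding ideal_rel_def by blast
  then show "?E f = ?E g" if "ideal_rel sym_rels f g" for f g
    using that by (simp add: free_lin_simps)
qed

section \<open>The Weyl algebra of \<open>V \<oplus> V\<^sup>*\<close>\<close>

fun symplectic :: "'v::complex_vector \<times> 'v dual \<Rightarrow> 'v \<times> 'v dual \<Rightarrow> complex" where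
  "symplectic (v, \<alpha>) (w, \<beta>) = dual_app \<alpha> w - dual_app \<beta> v"

definition weyl_rels :: "('v::complex_vector \<times> 'v dual) falg set" where
  "weyl_rels = lin_rels \<union> {fgen a * fgen b - fgen b * fgen a - symplectic a b *\<^sub>C 1 | a b. True}"

quotient_type (overloaded) 'v weyl = "('v::complex_vector \<times> 'v dual) falg" / "ideal_rel weyl_rels"
  morphisms rep_weyl abs_weyl
  by (rule ideal_rel_equivp)

instantiation weyl :: (complex_vector) unital_complex_algebra
begin
lift_definition zero_weyl :: "'a weyl" is 0 .
lift_definition one_weyl :: "'a weyl" is 1 .
lift_definition plus_weyl :: "'a weyl \<Rightarrow> 'a weyl \<Rightarrow> 'a weyl" is "(+)" by (rule ideal_rel_add)
lift_definition minus_weyl :: "'a weyl \<Rightarrow> 'a weyl \<Rightarrow> 'a weyl" is "(-)" by (rule ideal_rel_diff)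
lift_definition uminus_weyl :: "'a weyl \<Rightarrow> 'a weyl" is uminus by (rule ideal_rel_uminus)
lift_definition times_weyl :: "'a weyl \<Rightarrow> 'a weyl \<Rightarrow> 'a weyl" is "(*)" by (rule ideal_rel_mult)
lift_definition scaleC_weyl :: "complex \<Rightarrow> 'a weyl \<Rightarrow> 'a weyl" is scaleC by (rule ideal_rel_scaleC)
instance
proof
  fix x y z :: "'a weyl" and a b
  show "x + y + z = x + (y + z)" by transfer (simp add: add.assoc ideal_rel_refl)
  show "x + y = y + x" by transfer (simp add: add.commute ideal_rel_refl)
  show "0 + x = x" by transfer (simp add: ideal_rel_refl)
  show "- x + x = 0" by transfer (simp add: ideal_rel_refl)
  show "x - y = x + - y" by transfer (simp add: ideal_rel_refl)
  show "a *\<^sub>C (x + y) = a *\<^sub>C x + a *\<^sub>C y" by transfer (simp add: scaleC_add_right ideal_rel_refl)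
  show "(a + b) *\<^sub>C x = a *\<^sub>C x + b *\<^sub>C x" by transfer (simp add: scaleC_add_left ideal_rel_refl)
  show "a *\<^sub>C b *\<^sub>C x = (a * b) *\<^sub>C x" by transfer (simp add: scaleC_scaleC ideal_rel_refl)
  show "1 *\<^sub>C x = x" by transfer (simp add: scaleC_one ideal_rel_refl)
  show "x * y * z = x * (y * z)" by transfer (simp add: mult.assoc ideal_rel_refl)
  show "1 * x = x" by transfer (simp add: ideal_rel_refl)
  show "x * 1 = x" by transfer (simp add: ideal_rel_refl)
  show "(x + y) * z = x * z + y * z" by transfer (simp add: distrib_right ideal_rel_refl)
  show "x * (y + z) = x * y + x * z" by transfer (simp add: distrib_left ideal_rel_refl)
  show "(a *\<^sub>C x) * y = a *\<^sub>C (x * y)" by transfer (simp add: mult_scaleC_falg ideal_rel_refl)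
  show "x * (a *\<^sub>C y) = a *\<^sub>C (x * y)" by transfer (simp add: mult_scaleC_falg ideal_rel_refl)
qed
end

definition weyl_in :: "'v::complex_vector \<times> 'v dual \<Rightarrow> 'v weyl" where "weyl_in x = abs_weyl (fgen x)"

lemma abs_weyl_hom:
  "abs_weyl (f + g) = abs_weyl f + abs_weyl g" "abs_weyl (f - g) = abs_weyl f - abs_weyl g"
  "abs_weyl (f * g) = abs_weyl f * abs_weyl g" "abs_weyl (c *\<^sub>C f) = c *\<^sub>C abs_weyl f"
  "abs_weyl 1 = 1" "abs_weyl 0 = 0" "abs_weyl (fgen x) = weyl_in x"
  by (simp_all add: plus_weyl.abs_eq minus_weyl.abs_eq times_weyl.abs_eq scaleC_weyl.abs_eq one_weyl.abs_eq
      zero_weyl.abs_eq weyl_in_def)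

abbreviation weyl_vec :: "'v::complex_vector \<Rightarrow> 'v weyl" where "weyl_vec v \<equiv> weyl_in (v, 0)"
abbreviation weyl_dual :: "'v::complex_vector dual \<Rightarrow> 'v weyl" where "weyl_dual \<alpha> \<equiv> weyl_in (0, \<alpha>)"

definition weyl_gen_act :: "'v::complex_vector \<times> 'v dual \<Rightarrow> 'v sym \<Rightarrow> 'v sym"
  where "weyl_gen_act = (\<lambda>(v, \<alpha>) P. sym_in v * P + sym_deriv \<alpha> P)"

definition weyl_act :: "'v::complex_vector weyl \<Rightarrow> 'v sym \<Rightarrow> 'v sym"
  where "weyl_act w = free_act weyl_gen_act (rep_weyl w)"

lemma sym_commute: "sym_in x * p = p * sym_in x"
proof -
  have gen: "sym_in x * sym_in y = sym_in y * sym_in x" for y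
  proof -
    have "abs_sym (fgen x * fgen y - fgen y * fgen x) = 0"
      by (intro abs_sym_ideal gen_ideal_base) (auto simp: sym_rels_def)
    then show ?thesis by (simp add: abs_sym_hom)
  qed
  have word: "sym_in x * prod_list (map sym_in w) = prod_list (map sym_in w) * sym_in x" for w
  proof (induction w)
    case (Cons a w)
    have "sym_in x * (sym_in a * q) = sym_in a * (sym_in x * q)" for q
      using gen[of a] by (simp flip: mult.assoc)
    then show ?case using Cons by (simp add: mult.assoc)
  qed simp
  obtain f where "p = abs_sym f" using Quotient3_abs_rep[OF Quotient3_sym] by metis
  moreover have "sym_in x * abs_sym f = abs_sym f * sym_in x"
    by (induction f rule: pm_induct)
      (simp_all add: abs_sym_single word mult_scaleC_left mult_scaleC_right abs_sym_hom distrib_left distrib_right)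
  ultimately show ?thesis by simp
qed

lemma sym_deriv_commute: "sym_deriv \<alpha> (sym_deriv \<beta> p) = sym_deriv \<beta> (sym_deriv \<alpha> p)"
proof -
  have one: "sym_deriv \<gamma> 1 = 0" for \<gamma> :: "'a dual"
    using sym_deriv_mult[of \<gamma> 1 1] by simp
  have word: "sym_deriv \<alpha> (sym_deriv \<beta> (prod_list (map sym_in w))) =
      sym_deriv \<beta> (sym_deriv \<alpha> (prod_list (map sym_in w)))" for w
    by (induction w)
      (simp_all add: one clinearD[OF sym_deriv_linear] sym_deriv_mult sym_deriv_in mult_scaleC_left)
  obtain f where "p = abs_sym f" using Quotient3_abs_rep[OF Quotient3_sym] by metis
  moreover have "sym_deriv \<alpha> (sym_deriv \<beta> (abs_sym f)) = sym_deriv \<beta> (sym_deriv \<alpha> (abs_sym f))"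
    by (induction f rule: pm_induct)
      (simp_all add: abs_sym_single word abs_sym_hom clinearD[OF sym_deriv_linear])
  ultimately show ?thesis by simp
qed

lemma rep_weyl_abs: "ideal_rel weyl_rels (rep_weyl (abs_weyl f)) f"
  using Quotient3_abs_rep[OF Quotient3_weyl] by (simp flip: weyl.abs_eq_iff)

lemma sym_in_linear: "clinear sym_in"
proof (rule clinearI)
  fix x y :: 'a and c
  have "abs_sym (fgen (x + y) - fgen x - fgen y) = 0" "abs_sym (fgen (c *\<^sub>C x) - c *\<^sub>C fgen x) = 0"
    by (intro abs_sym_ideal gen_ideal_base; force simp: sym_rels_def lin_rels_def)+
  then show "sym_in (x + y) = sym_in x + sym_in y" "sym_in (c *\<^sub>C x) = c *\<^sub>C sym_in x"
    by (simp_all add: abs_sym_hom algebra_simps)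
qed

lemma sym_deriv_linear_dual: "clinear (\<lambda>\<alpha>. sym_deriv \<alpha> p)"
proof (rule clinearI)
  fix \<alpha> \<beta> :: "'a dual" and c
  have 1: "word_deriv (\<alpha> + \<beta>) w = word_deriv \<alpha> w + word_deriv \<beta> w" for w
    by (induction w) (simp_all add: plus_dual.rep_eq scaleC_add_left distrib_left)
  have 2: "word_deriv (c *\<^sub>C \<alpha>) w = c *\<^sub>C word_deriv \<alpha> w" for w
    by (induction w) (simp_all add: scaleC_dual.rep_eq scaleC_add_right scaleC_scaleC mult_scaleC_right)
  have 3: "free_lin (word_deriv (\<alpha> + \<beta>)) f = free_lin (word_deriv \<alpha>) f + free_lin (word_deriv \<beta>) f" for f
    by (induction f rule: pm_induct) (simp_all add: free_lin_simps 1 scaleC_add_right)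
  have 4: "free_lin (word_deriv (c *\<^sub>C \<alpha>)) f = c *\<^sub>C free_lin (word_deriv \<alpha>) f" for f
    by (induction f rule: pm_induct)
      (simp_all add: free_lin_simps 2 scaleC_add_right scaleC_scaleC mult.commute)
  obtain f where "p = abs_sym f" using Quotient3_abs_rep[OF Quotient3_sym] by metis
  then show "sym_deriv (\<alpha> + \<beta>) p = sym_deriv \<alpha> p + sym_deriv \<beta> p" "sym_deriv (c *\<^sub>C \<alpha>) p = c *\<^sub>C sym_deriv \<alpha> p"
    by (simp_all add: sym_deriv.abs_eq 3 4)
qed

lemma weyl_gen_act_apply: "weyl_gen_act (v, \<alpha>) P = sym_in v * P + sym_deriv \<alpha> P"
  by (simp add: weyl_gen_act_def)

lemma weyl_gen_act_bilinear: "cbilinear weyl_gen_act"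
  unfolding cbilinear_def
proof (intro conjI allI clinearI)
  note * = clinearD(1,2)[OF sym_deriv_linear] clinearD(1,2)[OF sym_deriv_linear_dual]
    clinearD(1,2)[OF sym_in_linear]
  fix x y :: "'a \<times> 'a dual" and p q :: "'a sym" and c
  show "weyl_gen_act x (p + q) = weyl_gen_act x p + weyl_gen_act x q"
    by (cases x) (simp add: weyl_gen_act_apply * distrib_left)
  show "weyl_gen_act x (c *\<^sub>C p) = c *\<^sub>C weyl_gen_act x p"
    by (cases x) (simp add: weyl_gen_act_apply * scaleC_add_right mult_scaleC_right)
  show "weyl_gen_act (x + y) p = weyl_gen_act x p + weyl_gen_act y p"
    by (cases x; cases y) (simp add: weyl_gen_act_apply * distrib_right)
  show "weyl_gen_act (c *\<^sub>C x) p = c *\<^sub>C weyl_gen_act x p"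
    by (cases x) (simp add: weyl_gen_act_apply * scaleC_prod_def scaleC_add_right mult_scaleC_left)
qed

lemma weyl_act_abs: "weyl_act (abs_weyl f) p = free_act weyl_gen_act f p"
proof -
  have lin: "clinear (weyl_gen_act x)" for x :: "'a \<times> 'a dual"
    using weyl_gen_act_bilinear unfolding cbilinear_def by blast
  have rel: "free_act weyl_gen_act r p = 0" if "r \<in> weyl_rels" for r :: "('a \<times> 'a dual) falg" and p
  proof -
    have "free_act weyl_gen_act (fgen a * fgen b - fgen b * fgen a - symplectic a b *\<^sub>C 1) p = 0"
      for a b :: "'a \<times> 'a dual"
    proof -
      obtain v \<alpha> where a: "a = (v, \<alpha>)" by force
      obtain w \<beta> where b: "b = (w, \<beta>)" by force
      have c: "sym_in v * (sym_in w * p) = sym_in w * (sym_in v * p)"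
        using sym_commute[of v "sym_in w"] by (simp flip: mult.assoc)
      show ?thesis
        using c sym_deriv_commute[of \<alpha> \<beta> p]
        by (simp add: a b free_act_simps free_act_mult lin weyl_gen_act_apply distrib_left
            clinearD(1,2)[OF sym_deriv_linear] sym_deriv_mult sym_deriv_in mult_scaleC_left
            cvs.scale_left_diff_distrib)
    qed
    then show ?thesis
      using that free_act_lin_rels[OF _ weyl_gen_act_bilinear] by (auto simp: weyl_rels_def)
  qed
  have "free_act weyl_gen_act (rep_weyl (abs_weyl f) - f) p = 0"
    by (rule free_act_gen_ideal[OF rep_weyl_abs[unfolded ideal_rel_def] lin rel])
  then show ?thesis by (simp add: weyl_act_def free_act_simps)
qed

section \<open>Lie algebras, complexification, universal enveloping algebra\<close>

class lie_bracket =
  fixes lie :: "'a \<Rightarrow> 'a \<Rightarrow> 'a"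

class real_lie_algebra = real_vector + lie_bracket +
  assumes lie_add_left: "lie (x + y) z = lie x z + lie y z"
    and lie_add_right: "lie x (y + z) = lie x y + lie x z"
    and lie_scaleR_left: "lie (r *\<^sub>R x) y = r *\<^sub>R lie x y"
    and lie_scaleR_right: "lie x (r *\<^sub>R y) = r *\<^sub>R lie x y"
    and lie_self: "lie x x = 0"
    and lie_jacobi: "lie x (lie y z) + lie y (lie z x) + lie z (lie x y) = 0"

class complex_lie_algebra = complex_vector + lie_bracket +
  assumes clie_add_left: "lie (x + y) z = lie x z + lie y z"
    and clie_add_right: "lie x (y + z) = lie x y + lie x z"
    and clie_scaleC_left: "lie (c *\<^sub>C x) y = c *\<^sub>C lie x y"
    and clie_scaleC_right: "lie x (c *\<^sub>C y) = c *\<^sub>C lie x y"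
    and clie_self: "lie x x = 0"
    and clie_jacobi: "lie x (lie y z) + lie y (lie z x) + lie z (lie x y) = 0"

text \<open>\<open>'v cx\<close> is the complexification of \<open>'v\<close>; \<open>Cx x y\<close> is \<open>x + \<i>y\<close>. The library function
  \<open>map_cx f\<close> is the complex-linear extension of a real-linear \<open>f\<close>.\<close>

datatype 'v cx = Cx (re_part: 'v) (im_part: 'v)

definition cx_bilin :: "('a \<Rightarrow> 'b \<Rightarrow> 'c::real_vector) \<Rightarrow> 'a cx \<Rightarrow> 'b cx \<Rightarrow> 'c cx" where
  "cx_bilin \<beta> z w =
     Cx (\<beta> (re_part z) (re_part w) - \<beta> (im_part z) (im_part w))
        (\<beta> (re_part z) (im_part w) + \<beta> (im_part z) (re_part w))"

definition cx_form :: "('a \<Rightarrow> 'b \<Rightarrow> real) \<Rightarrow> 'a cx \<Rightarrow> 'b cx \<Rightarrow> complex" where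
  "cx_form \<beta> z w =
     Complex (\<beta> (re_part z) (re_part w) - \<beta> (im_part z) (im_part w))
             (\<beta> (re_part z) (im_part w) + \<beta> (im_part z) (re_part w))"

definition cx_conj :: "'v::real_vector cx \<Rightarrow> 'v cx"
  where "cx_conj z = Cx (re_part z) (- im_part z)"

definition cx_of :: "'v::real_vector \<Rightarrow> 'v cx"
  where "cx_of x = Cx x 0"

instantiation cx :: (real_vector) complex_vector
begin
definition "0 = Cx 0 0"
definition "z + w = Cx (re_part z + re_part w) (im_part z + im_part w)"
definition "z - w = Cx (re_part z - re_part w) (im_part z - im_part w)"
definition "- z = Cx (- re_part z) (- im_part z)"
definition "c *\<^sub>C z = Cx (Re c *\<^sub>R re_part z - Im c *\<^sub>R im_part z) (Re c *\<^sub>R im_part z + Im c *\<^sub>R re_part z)"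
instance
  by standard (simp_all add: zero_cx_def plus_cx_def minus_cx_def uminus_cx_def scaleC_cx_def
      algebra_simps)
end

lemmas cx_defs = zero_cx_def plus_cx_def minus_cx_def uminus_cx_def scaleC_cx_def

lemma lie_minus_right: "lie x (- y) = - lie x (y :: 'a::real_lie_algebra)"
  and lie_minus_left: "lie (- x) y = - lie x (y :: 'a)"
  using lie_scaleR_right[of x "- 1" y] lie_scaleR_left[of "- 1" x y] by simp_all

lemma lie_diff_right: "lie x (y - z) = lie x y - lie x (z :: 'a::real_lie_algebra)"
  and lie_diff_left: "lie (x - y) z = lie x z - lie y (z :: 'a)"
  using lie_add_right[of x y "- z"] lie_add_left[of x "- y" z] by (simp_all add: lie_minus_right lie_minus_left)

lemma lie_anticommute: "lie x y = - lie y (x :: 'a::real_lie_algebra)"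
proof -
  have "0 = lie (x + y) (x + y)" by (simp add: lie_self)
  also have "\<dots> = lie x y + lie y x"
    by (simp only: lie_add_left lie_add_right lie_self[of x] lie_self[of y]) simp
  finally show ?thesis by (simp add: eq_neg_iff_add_eq_0)
qed

instantiation cx :: (real_lie_algebra) complex_lie_algebra
begin
definition "lie = (cx_bilin lie :: 'a cx \<Rightarrow> _)"
instance
proof
  note [simp] = lie_cx_def cx_bilin_def cx_defs lie_add_left lie_add_right lie_scaleR_left
    lie_scaleR_right lie_diff_left lie_diff_right
  fix x y z :: "'a cx" and c
  show "lie (x + y) z = lie x z + lie y z" "lie x (y + z) = lie x y + lie x z"
    "lie (c *\<^sub>C x) y = c *\<^sub>C lie x y" "lie x (c *\<^sub>C y) = c *\<^sub>C lie x y"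
    by (simp_all add: algebra_simps)
  show "lie x x = 0"
    using lie_anticommute[of "re_part x" "im_part x"] by (simp add: lie_self)
  obtain a a' b b' d d' where *: "x = Cx a a'" "y = Cx b b'" "z = Cx d d'" by (meson cx.exhaust)
  define J where "J u v w = lie u (lie v w) + lie v (lie w u) + lie w (lie u v)" for u v w :: 'a
  have J: "J u v w = 0" for u v w unfolding J_def by (rule lie_jacobi)
  have "lie x (lie y z) + lie y (lie z x) + lie z (lie x y) =
    Cx (J a b d - J a b' d' - J a' b d' - J a' b' d) (J a b d' + J a b' d + J a' b d - J a' b' d')"
    by (simp add: * J_def algebra_simps)
  then show "lie x (lie y z) + lie y (lie z x) + lie z (lie x y) = 0" by (simp add: J)
qed
end

lemma cx_conj_lie: "cx_conj (lie x y) = lie (cx_conj x) (cx_conj (y :: 'a::real_lie_algebra cx))"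
  by (simp add: lie_cx_def cx_bilin_def cx_conj_def lie_minus_left lie_minus_right)

definition uea_rels :: "'v::complex_lie_algebra falg set" where
  "uea_rels = lin_rels \<union> {fgen x * fgen y - fgen y * fgen x - fgen (lie x y) | x y. True}"

quotient_type (overloaded) 'v uea = "'v::complex_lie_algebra falg" / "ideal_rel uea_rels"
  morphisms rep_uea abs_uea
  by (rule ideal_rel_equivp)

instantiation uea :: (complex_lie_algebra) unital_complex_algebra
begin
lift_definition zero_uea :: "'a uea" is 0 .
lift_definition one_uea :: "'a uea" is 1 .
lift_definition plus_uea :: "'a uea \<Rightarrow> 'a uea \<Rightarrow> 'a uea" is "(+)" by (rule ideal_rel_add)
lift_definition minus_uea :: "'a uea \<Rightarrow> 'a uea \<Rightarrow> 'a uea" is "(-)" by (rule ideal_rel_diff)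
lift_definition uminus_uea :: "'a uea \<Rightarrow> 'a uea" is uminus by (rule ideal_rel_uminus)
lift_definition times_uea :: "'a uea \<Rightarrow> 'a uea \<Rightarrow> 'a uea" is "(*)" by (rule ideal_rel_mult)
lift_definition scaleC_uea :: "complex \<Rightarrow> 'a uea \<Rightarrow> 'a uea" is scaleC by (rule ideal_rel_scaleC)
instance
proof
  fix x y z :: "'a uea" and a b
  show "x + y + z = x + (y + z)" by transfer (simp add: add.assoc ideal_rel_refl)
  show "x + y = y + x" by transfer (simp add: add.commute ideal_rel_refl)
  show "0 + x = x" by transfer (simp add: ideal_rel_refl)
  show "- x + x = 0" by transfer (simp add: ideal_rel_refl)
  show "x - y = x + - y" by transfer (simp add: ideal_rel_refl)
  show "a *\<^sub>C (x + y) = a *\<^sub>C x + a *\<^sub>C y" by transfer (simp add: scaleC_add_right ideal_rel_refl)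
  show "(a + b) *\<^sub>C x = a *\<^sub>C x + b *\<^sub>C x" by transfer (simp add: scaleC_add_left ideal_rel_refl)
  show "a *\<^sub>C b *\<^sub>C x = (a * b) *\<^sub>C x" by transfer (simp add: scaleC_scaleC ideal_rel_refl)
  show "1 *\<^sub>C x = x" by transfer (simp add: scaleC_one ideal_rel_refl)
  show "x * y * z = x * (y * z)" by transfer (simp add: mult.assoc ideal_rel_refl)
  show "1 * x = x" by transfer (simp add: ideal_rel_refl)
  show "x * 1 = x" by transfer (simp add: ideal_rel_refl)
  show "(x + y) * z = x * z + y * z" by transfer (simp add: distrib_right ideal_rel_refl)
  show "x * (y + z) = x * y + x * z" by transfer (simp add: distrib_left ideal_rel_refl)
  show "(a *\<^sub>C x) * y = a *\<^sub>C (x * y)" by transfer (simp add: mult_scaleC_falg ideal_rel_refl)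
  show "x * (a *\<^sub>C y) = a *\<^sub>C (x * y)" by transfer (simp add: mult_scaleC_falg ideal_rel_refl)
qed
end

lift_definition uea_in :: "'v::complex_lie_algebra \<Rightarrow> 'v uea" is fgen .

lemma abs_uea_hom:
  "abs_uea (f + g) = abs_uea f + abs_uea g" "abs_uea (f - g) = abs_uea f - abs_uea g"
  "abs_uea (f * g) = abs_uea f * abs_uea g" "abs_uea (c *\<^sub>C f) = c *\<^sub>C abs_uea f"
  "abs_uea 1 = 1" "abs_uea 0 = 0" "abs_uea (fgen x) = uea_in x"
  by (simp_all add: plus_uea.abs_eq minus_uea.abs_eq times_uea.abs_eq scaleC_uea.abs_eq one_uea.abs_eq
      zero_uea.abs_eq uea_in.abs_eq)

definition lie_rep :: "('v::complex_lie_algebra \<Rightarrow> 'm \<Rightarrow> 'm::complex_vector) \<Rightarrow> bool" where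
  "lie_rep \<rho> \<longleftrightarrow> cbilinear \<rho> \<and> (\<forall>x y m. \<rho> (lie x y) m = \<rho> x (\<rho> y m) - \<rho> y (\<rho> x m))"

text \<open>The extension of a representation, respectively of a Lie algebra homomorphism into an
  associative algebra, to the universal enveloping algebra. Evaluating on a chosen
  representative is legitimate by \<open>uea_act_abs\<close> and \<open>uea_hom_abs\<close>.\<close>

definition uea_act :: "('v::complex_lie_algebra \<Rightarrow> 'm \<Rightarrow> 'm) \<Rightarrow> 'v uea \<Rightarrow> 'm \<Rightarrow> 'm::complex_vector"
  where "uea_act \<rho> u = free_act \<rho> (rep_uea u)"

definition uea_hom :: "('v::complex_lie_algebra \<Rightarrow> 'a) \<Rightarrow> 'v uea \<Rightarrow> 'a::unital_complex_algebra"
  where "uea_hom \<phi> u = uea_act (\<lambda>x a. \<phi> x * a) u 1"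

lemma rep_uea_abs: "ideal_rel uea_rels (rep_uea (abs_uea f)) f"
  using Quotient3_abs_rep[OF Quotient3_uea] by (simp flip: uea.abs_eq_iff)

lemma uea_act_abs:
  assumes "lie_rep \<rho>"
  shows "uea_act \<rho> (abs_uea f) m = free_act \<rho> f m"
proof -
  have bil: "cbilinear \<rho>" and br: "\<rho> (lie x y) m = \<rho> x (\<rho> y m) - \<rho> y (\<rho> x m)" for x y m
    using assms by (auto simp: lie_rep_def)
  have lin: "clinear (\<rho> x)" for x using bil unfolding cbilinear_def by blast
  have rel: "free_act \<rho> r m = 0" if "r \<in> uea_rels" for r m
    using that free_act_lin_rels[OF _ bil]
    by (auto simp: uea_rels_def free_act_simps free_act_mult[of \<rho>, OF lin] br)
  have "free_act \<rho> (rep_uea (abs_uea f) - f) m = 0"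
    by (rule free_act_gen_ideal[OF rep_uea_abs[unfolded ideal_rel_def] lin rel])
  then show ?thesis by (simp add: uea_act_def free_act_simps)
qed

lemma uea_hom_abs:
  assumes "clinear \<phi>" "\<And>x y. \<phi> (lie x y) = \<phi> x * \<phi> y - \<phi> y * \<phi> x"
  shows "uea_hom \<phi> (abs_uea f) = free_lin (\<lambda>w. prod_list (map \<phi> w)) f"
proof -
  have "lie_rep (\<lambda>x a. \<phi> x * a)"
    unfolding lie_rep_def cbilinear_def
    by (auto intro!: clinearI simp: assms clinearD[OF assms(1)] distrib_left distrib_right
        left_diff_distrib mult.assoc mult_scaleC_left mult_scaleC_right)
  moreover have "foldr (\<lambda>x a. \<phi> x * a) w 1 = prod_list (map \<phi> w)" for w
    by (induction w) simp_all
  ultimately show ?thesis by (simp add: uea_hom_def uea_act_abs free_act_def)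
qed

section \<open>Conjugate-linear extensions: the star operation and complex conjugation\<close>

definition free_conj :: "('v \<Rightarrow> 'v) \<Rightarrow> 'v falg \<Rightarrow> 'v falg"
  where "free_conj \<phi> = pm_ext (\<lambda>w c. Poly_Mapping.single (Word (map \<phi> (letters w))) (cnj c))"

definition free_star :: "('v \<Rightarrow> 'v) \<Rightarrow> 'v falg \<Rightarrow> 'v falg"
  where "free_star \<phi> = pm_ext (\<lambda>w c. Poly_Mapping.single (Word (rev (map \<phi> (letters w)))) (cnj c))"

lemma free_conj_simps:
  "free_conj \<phi> 0 = 0"
  "free_conj \<phi> (f + g) = free_conj \<phi> f + free_conj \<phi> g"
  "free_conj \<phi> (f - g) = free_conj \<phi> f - free_conj \<phi> g"
  "free_conj \<phi> (Poly_Mapping.single w c) = Poly_Mapping.single (Word (map \<phi> (letters w))) (cnj c)"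
  "free_conj \<phi> (fgen x) = fgen (\<phi> x)"
  by (simp_all add: free_conj_def pm_ext_add pm_ext_diff pm_ext_single single_add fgen_def)

lemma free_star_simps:
  "free_star \<phi> 0 = 0"
  "free_star \<phi> (f + g) = free_star \<phi> f + free_star \<phi> g"
  "free_star \<phi> (f - g) = free_star \<phi> f - free_star \<phi> g"
  "free_star \<phi> (Poly_Mapping.single w c) = Poly_Mapping.single (Word (rev (map \<phi> (letters w)))) (cnj c)"
  "free_star \<phi> (fgen x) = fgen (\<phi> x)"
  by (simp_all add: free_star_def pm_ext_add pm_ext_diff pm_ext_single single_add fgen_def)

lemma free_conj_mult: "free_conj \<phi> (f * g) = free_conj \<phi> f * free_conj \<phi> g"
proof (induction f rule: pm_induct)
  case (single k c)
  show ?case by (induction g rule: pm_induct)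
    (simp_all add: mult_single free_conj_simps distrib_left plus_fword_def)
qed (simp add: distrib_right free_conj_simps)

lemma free_star_mult: "free_star \<phi> (f * g) = free_star \<phi> g * free_star \<phi> f"
proof (induction f rule: pm_induct)
  case (single k c)
  show ?case by (induction g rule: pm_induct)
    (simp_all add: mult_single free_star_simps distrib_left distrib_right plus_fword_def mult.commute)
qed (simp add: distrib_left distrib_right free_star_simps)

lemma free_conj_scaleC: "free_conj \<phi> (c *\<^sub>C f) = cnj c *\<^sub>C free_conj \<phi> f"
  by (induction f rule: pm_induct) (simp_all add: scaleC_add_right free_conj_simps scaleC_single)

lemma free_star_scaleC: "free_star \<phi> (c *\<^sub>C f) = cnj c *\<^sub>C free_star \<phi> f"
  by (induction f rule: pm_induct) (simp_all add: scaleC_add_right free_star_simps scaleC_single)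

lemma cx_conj_simps:
  "cx_conj (x + y) = cx_conj x + cx_conj y" "cx_conj (c *\<^sub>C x) = cnj c *\<^sub>C cx_conj x"
  by (simp_all add: cx_conj_def cx_defs)

lift_definition uea_star :: "'v::real_lie_algebra cx uea \<Rightarrow> 'v cx uea"
  is "free_star (\<lambda>x. - cx_conj x)"
proof -
  let ?S = "free_star (\<lambda>x. - cx_conj x) :: 'v cx falg \<Rightarrow> _"
  have base: "?S r \<in> gen_ideal uea_rels" if "r \<in> uea_rels" for r
  proof -
    consider x y where "r = fgen (x + y) - fgen x - fgen y" | c x where "r = fgen (c *\<^sub>C x) - c *\<^sub>C fgen x"
      | x y where "r = fgen x * fgen y - fgen y * fgen x - fgen (lie x y)"
      using \<open>r \<in> uea_rels\<close> by (auto simp: uea_rels_def lin_rels_def)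
    then have "?S r \<in> uea_rels"
    proof cases
      case (1 x y)
      then have "?S r = fgen (- cx_conj x + - cx_conj y) - fgen (- cx_conj x) - fgen (- cx_conj y)"
        by (simp add: free_star_simps cx_conj_simps)
      then show ?thesis unfolding uea_rels_def lin_rels_def by blast
    next
      case (2 c x)
      then have "?S r = fgen (cnj c *\<^sub>C (- cx_conj x)) - cnj c *\<^sub>C fgen (- cx_conj x)"
        by (simp add: free_star_simps free_star_scaleC cx_conj_simps)
      then show ?thesis unfolding uea_rels_def lin_rels_def by blast
    next
      case (3 x y)
      have "- cx_conj (lie x y) = lie (- cx_conj y) (- cx_conj x)"
        by (simp add: lie_cx_def cx_bilin_def cx_conj_def cx_defs lie_minus_left lie_minus_right
            lie_anticommute[of "re_part x"] lie_anticommute[of "im_part x"])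
      then have "?S r = fgen (- cx_conj y) * fgen (- cx_conj x) - fgen (- cx_conj x) * fgen (- cx_conj y)
          - fgen (lie (- cx_conj y) (- cx_conj x))"
        using 3 by (simp add: free_star_simps free_star_mult)
      then show ?thesis unfolding uea_rels_def by blast
    qed
    then show ?thesis by (rule gen_ideal_base)
  qed
  have ideal: "?S r \<in> gen_ideal uea_rels" if "r \<in> gen_ideal uea_rels" for r
    using that
  proof induction
    case (gen_ideal_gen r a b)
    then show ?case using gen_ideal_mult[OF base[of r], of "?S b" "?S a"]
      by (simp add: free_star_mult mult.assoc)
  qed (simp_all add: free_star_simps gen_ideal_zero gen_ideal_add)
  show "ideal_rel uea_rels (?S f) (?S g)" if "ideal_rel uea_rels f g" for f g
    using ideal[of "f - g"] that by (simp add: ideal_rel_def free_star_simps)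
qed

lift_definition sym_conj :: "'v::real_vector cx sym \<Rightarrow> 'v cx sym"
  is "free_conj cx_conj"
proof -
  let ?S = "free_conj cx_conj :: 'v cx falg \<Rightarrow> _"
  have base: "?S r \<in> gen_ideal sym_rels" if "r \<in> sym_rels" for r
  proof -
    consider x y where "r = fgen (x + y) - fgen x - fgen y" | c x where "r = fgen (c *\<^sub>C x) - c *\<^sub>C fgen x"
      | x y where "r = fgen x * fgen y - fgen y * fgen x"
      using \<open>r \<in> sym_rels\<close> by (auto simp: sym_rels_def lin_rels_def)
    then have "?S r \<in> sym_rels"
      by cases (simp_all add: free_conj_simps free_conj_scaleC free_conj_mult cx_conj_simps
          sym_rels_def lin_rels_def, blast+)
    then show ?thesis by (rule gen_ideal_base)
  qed
  have ideal: "?S r \<in> gen_ideal sym_rels" if "r \<in> gen_ideal sym_rels" for r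
    using that
  proof induction
    case (gen_ideal_gen r a b)
    then show ?case using gen_ideal_mult[OF base[of r], of "?S a" "?S b"]
      by (simp add: free_conj_mult mult.assoc)
  qed (simp_all add: free_conj_simps gen_ideal_zero gen_ideal_add)
  show "ideal_rel sym_rels (?S f) (?S g)" if "ideal_rel sym_rels f g" for f g
    using ideal[of "f - g"] that by (simp add: ideal_rel_def free_conj_simps)
qed

section \<open>Z2-graded quadratic Lie algebras\<close>

class z2_quadratic_lie_algebra = real_lie_algebra +
  fixes k0 :: "'a set" and p0 :: "'a set" and qform :: "'a \<Rightarrow> 'a \<Rightarrow> real"
  assumes finite_dim: "\<exists>S. finite S \<and> (\<forall>x. \<exists>c. x = (\<Sum>s\<in>S. c s *\<^sub>R s))"
    and zero_k0: "0 \<in> k0" and add_k0: "x \<in> k0 \<Longrightarrow> y \<in> k0 \<Longrightarrow> x + y \<in> k0"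
    and scaleR_k0: "x \<in> k0 \<Longrightarrow> r *\<^sub>R x \<in> k0"
    and zero_p0: "0 \<in> p0" and add_p0: "x \<in> p0 \<Longrightarrow> y \<in> p0 \<Longrightarrow> x + y \<in> p0"
    and scaleR_p0: "x \<in> p0 \<Longrightarrow> r *\<^sub>R x \<in> p0"
    and k0_inter_p0: "k0 \<inter> p0 = {0}"
    and k0_plus_p0: "\<exists>y\<in>k0. \<exists>z\<in>p0. x = y + z"
    and lie_k0_k0: "x \<in> k0 \<Longrightarrow> y \<in> k0 \<Longrightarrow> lie x y \<in> k0"
    and lie_k0_p0: "x \<in> k0 \<Longrightarrow> y \<in> p0 \<Longrightarrow> lie x y \<in> p0"
    and lie_p0_p0: "x \<in> p0 \<Longrightarrow> y \<in> p0 \<Longrightarrow> lie x y \<in> k0"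
    and qform_add_left: "qform (x + y) z = qform x z + qform y z"
    and qform_scaleR_left: "qform (r *\<^sub>R x) y = r * qform x y"
    and qform_sym: "qform x y = qform y x"
    and qform_invariant: "qform (lie x y) z = qform x (lie y z)"
    and qform_nondegenerate: "(\<And>y. qform x y = 0) \<Longrightarrow> x = 0"
    and qform_k0_p0: "x \<in> k0 \<Longrightarrow> y \<in> p0 \<Longrightarrow> qform x y = 0"
    and qform_p0_pos: "x \<in> p0 \<Longrightarrow> x \<noteq> 0 \<Longrightarrow> qform x x > 0"

lemma subspace_k0: "subspace (k0 :: 'a::z2_quadratic_lie_algebra set)"
  and subspace_p0: "subspace (p0 :: 'a set)"
  by (simp_all add: subspace_def zero_k0 add_k0 scaleR_k0 zero_p0 add_p0 scaleR_p0)

typedef (overloaded) 'g kpart = "k0 :: 'g::z2_quadratic_lie_algebra set"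
  morphisms kpart_val Abs_kpart
  using subspace_0[OF subspace_k0] by blast

typedef (overloaded) 'g ppart = "p0 :: 'g::z2_quadratic_lie_algebra set"
  morphisms ppart_val Abs_ppart
  using subspace_0[OF subspace_p0] by blast

setup_lifting type_definition_kpart
setup_lifting type_definition_ppart

lemmas sub_k0 = subspace_add[OF subspace_k0] subspace_diff[OF subspace_k0] subspace_neg[OF subspace_k0]
  subspace_scale[OF subspace_k0] subspace_0[OF subspace_k0]
lemmas sub_p0 = subspace_add[OF subspace_p0] subspace_diff[OF subspace_p0] subspace_neg[OF subspace_p0]
  subspace_scale[OF subspace_p0] subspace_0[OF subspace_p0]

instantiation kpart :: (z2_quadratic_lie_algebra) real_lie_algebra
begin
lift_definition zero_kpart :: "'a kpart" is 0 by (rule sub_k0)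
lift_definition plus_kpart :: "'a kpart \<Rightarrow> 'a kpart \<Rightarrow> 'a kpart" is "(+)" by (rule sub_k0)
lift_definition minus_kpart :: "'a kpart \<Rightarrow> 'a kpart \<Rightarrow> 'a kpart" is "(-)" by (rule sub_k0)
lift_definition uminus_kpart :: "'a kpart \<Rightarrow> 'a kpart" is uminus by (rule sub_k0)
lift_definition scaleR_kpart :: "real \<Rightarrow> 'a kpart \<Rightarrow> 'a kpart" is scaleR by (rule sub_k0)
lift_definition lie_kpart :: "'a kpart \<Rightarrow> 'a kpart \<Rightarrow> 'a kpart" is lie by (rule lie_k0_k0)
instance
  by standard (transfer; simp add: algebra_simps lie_add_left lie_add_right lie_scaleR_left
      lie_scaleR_right lie_self lie_jacobi[unfolded add.assoc])+
end

instantiation ppart :: (z2_quadratic_lie_algebra) real_vector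
begin
lift_definition zero_ppart :: "'a ppart" is 0 by (rule sub_p0)
lift_definition plus_ppart :: "'a ppart \<Rightarrow> 'a ppart \<Rightarrow> 'a ppart" is "(+)" by (rule sub_p0)
lift_definition minus_ppart :: "'a ppart \<Rightarrow> 'a ppart \<Rightarrow> 'a ppart" is "(-)" by (rule sub_p0)
lift_definition uminus_ppart :: "'a ppart \<Rightarrow> 'a ppart" is uminus by (rule sub_p0)
lift_definition scaleR_ppart :: "real \<Rightarrow> 'a ppart \<Rightarrow> 'a ppart" is scaleR by (rule sub_p0)
instance by standard (transfer; simp add: algebra_simps)+
end

lift_definition kp_lie :: "'g::z2_quadratic_lie_algebra kpart \<Rightarrow> 'g ppart \<Rightarrow> 'g ppart" is lie
  by (rule lie_k0_p0)

lift_definition qform_k :: "'g::z2_quadratic_lie_algebra kpart \<Rightarrow> 'g kpart \<Rightarrow> real" is qform .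
lift_definition qform_p :: "'g::z2_quadratic_lie_algebra ppart \<Rightarrow> 'g ppart \<Rightarrow> real" is qform .

text \<open>\<open>'g cx\<close>, \<open>'g kpart cx\<close>, \<open>'g ppart cx\<close> are the complexifications of \<open>g\<^sub>0\<close>, \<open>k\<^sub>0\<close>, \<open>p\<^sub>0\<close>.\<close>

abbreviation k_incl :: "'g::z2_quadratic_lie_algebra kpart cx \<Rightarrow> 'g cx" where "k_incl \<equiv> map_cx kpart_val"
abbreviation p_incl :: "'g::z2_quadratic_lie_algebra ppart cx \<Rightarrow> 'g cx" where "p_incl \<equiv> map_cx ppart_val"

abbreviation uea_k_incl :: "'g::z2_quadratic_lie_algebra kpart cx uea \<Rightarrow> 'g cx uea"
  where "uea_k_incl \<equiv> uea_hom (\<lambda>x. uea_in (k_incl x))"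

definition dual_elt :: "('v \<Rightarrow> 'v \<Rightarrow> complex) \<Rightarrow> 'v set \<Rightarrow> 'v \<Rightarrow> 'v"
  where "dual_elt B b w = (THE v. \<forall>u\<in>b. B u v = (if u = w then 1 else 0))"

definition casimir :: "('v \<Rightarrow> 'v \<Rightarrow> complex) \<Rightarrow> 'v set \<Rightarrow> 'v::complex_lie_algebra uea"
  where "casimir B b = (\<Sum>w\<in>b. uea_in w * uea_in (dual_elt B b w))"

abbreviation casimir_g :: "'g::z2_quadratic_lie_algebra cx set \<Rightarrow> 'g cx uea"
  where "casimir_g \<equiv> casimir (cx_form qform)"
abbreviation casimir_k :: "'g::z2_quadratic_lie_algebra kpart cx set \<Rightarrow> 'g kpart cx uea"
  where "casimir_k \<equiv> casimir (cx_form qform_k)"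

text \<open>The element \<open>z\<^sup>*\<close> of the basis of the dual space dual to the basis \<open>b\<close>.\<close>

definition dual_basis_elt :: "'v::complex_vector set \<Rightarrow> 'v \<Rightarrow> 'v dual"
  where "dual_basis_elt b z = Abs_dual (\<lambda>v. crepresentation b v z)"

lemma dual_basis_elt_app:
  assumes "cbasis b"
  shows "dual_app (dual_basis_elt b z) v = crepresentation b v z"
proof -
  have "clinear (\<lambda>v. crepresentation b v z)"
    using assms unfolding cbasis_def
    by (intro clinearI) (simp_all add: cvs.representation_add cvs.representation_scale scaleC_complex_def)
  then show ?thesis by (simp add: dual_basis_elt_def Abs_dual_inverse)
qed

definition Dminus :: "'g::z2_quadratic_lie_algebra ppart cx set \<Rightarrow> ('g cx uea, 'g ppart cx weyl) tensor"
  where "Dminus b = (\<Sum>z\<in>b. uea_in (p_incl z) \<otimes>\<^sub>C weyl_dual (dual_basis_elt b z))"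

definition Dplus :: "'g::z2_quadratic_lie_algebra ppart cx set \<Rightarrow> ('g cx uea, 'g ppart cx weyl) tensor"
  where "Dplus b = (\<Sum>z\<in>b. uea_in (p_incl z) \<otimes>\<^sub>C weyl_vec (dual_elt (cx_form qform_p) b z))"

definition nu :: "'g::z2_quadratic_lie_algebra ppart cx set \<Rightarrow> 'g kpart cx \<Rightarrow> 'g ppart cx weyl"
  where "nu b x = (\<Sum>z\<in>b. weyl_vec (cx_bilin kp_lie x z) * weyl_dual (dual_basis_elt b z))"

definition Delta ::
  "'g::z2_quadratic_lie_algebra ppart cx set \<Rightarrow> 'g kpart cx \<Rightarrow> ('g cx uea, 'g ppart cx weyl) tensor"
  where "Delta b x = uea_in (k_incl x) \<otimes>\<^sub>C 1 + 1 \<otimes>\<^sub>C nu b x"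

definition tensor_act ::
  "('g::z2_quadratic_lie_algebra cx \<Rightarrow> 'm \<Rightarrow> 'm) \<Rightarrow> ('g cx uea, 'g ppart cx weyl) tensor
     \<Rightarrow> ('m::complex_vector, 'g ppart cx sym) tensor \<Rightarrow> ('m, 'g ppart cx sym) tensor"
  where "tensor_act \<pi> t x =
     tensor_lift (\<lambda>u w. tensor_lift (\<lambda>m P. uea_act \<pi> u m \<otimes>\<^sub>C weyl_act w P) x) t"

section \<open>Hermitian forms\<close>

definition hermitian_form :: "('m::complex_vector \<Rightarrow> 'm \<Rightarrow> complex) \<Rightarrow> bool"
  where "hermitian_form h \<longleftrightarrow> (\<forall>m. clinear (h m)) \<and> (\<forall>m m'. h m m' = cnj (h m' m))"

definition nondegenerate_form :: "('m::complex_vector \<Rightarrow> 'm \<Rightarrow> complex) \<Rightarrow> bool"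
  where "nondegenerate_form h \<longleftrightarrow> (\<forall>m. (\<forall>m'. h m m' = 0) \<longrightarrow> m = 0)"

definition star_invariant ::
  "('g::real_lie_algebra cx \<Rightarrow> 'm \<Rightarrow> 'm) \<Rightarrow> ('m::complex_vector \<Rightarrow> 'm \<Rightarrow> complex) \<Rightarrow> bool"
  where "star_invariant \<pi> h \<longleftrightarrow>
    (\<forall>u m m'. h (uea_act \<pi> u m) m' = h m (uea_act \<pi> (uea_star u) m'))"

text \<open>The form on a tensor product with \<open>\<langle>m \<otimes> p, m' \<otimes> p'\<rangle> = \<langle>m, m'\<rangle> \<langle>p, p'\<rangle>\<close>.\<close>

definition tensor_form ::
  "('m::complex_vector \<Rightarrow> 'm \<Rightarrow> complex) \<Rightarrow> ('p::complex_vector \<Rightarrow> 'p \<Rightarrow> complex)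
     \<Rightarrow> ('m, 'p) tensor \<Rightarrow> ('m, 'p) tensor \<Rightarrow> complex"
  where "tensor_form h g x y =
     cnj (tensor_lift (\<lambda>m p. cnj (tensor_lift (\<lambda>m' p'. h m m' * g p p') y)) x)"

text \<open>\<open>p_flat\<close> sends each member of an orthonormal basis of \<open>p\<^sub>0\<close> to the corresponding member of the
  dual basis.\<close>

lemma cx_form_qform_p_simps:
  "cx_form qform_p u (v + w) = cx_form qform_p u v + cx_form qform_p u (w :: 'g::z2_quadratic_lie_algebra ppart cx)"
  "cx_form qform_p u (c *\<^sub>C v) = c * cx_form qform_p u v"
  "cx_form qform_p u v = cx_form qform_p v u"
proof -
  have sc: "qform x (r *\<^sub>R y) = r * qform x y" and ad: "qform x (y + z) = qform x y + qform x z"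
    for x y z :: 'g and r
    by (metis qform_scaleR_left qform_sym, metis qform_add_left qform_sym)
  have df: "qform x (y - z) = qform x y - qform x z" for x y z :: 'g
    using sc[of x "- 1" z] ad[of x y "- z"] by simp
  have p: "qform_p x (r *\<^sub>R y) = r * qform_p x y" "qform_p x (y + z) = qform_p x y + qform_p x z"
    "qform_p x (y - z) = qform_p x y - qform_p x z" for x y z :: "'g ppart" and r
    by (transfer; simp add: sc ad df)+
  show "cx_form qform_p u (v + w) = cx_form qform_p u v + cx_form qform_p u w"
    "cx_form qform_p u (c *\<^sub>C v) = c * cx_form qform_p u v"
    by (simp_all add: cx_form_def cx_defs p complex_eq_iff algebra_simps)
  have sy: "qform_p x y = qform_p y x" for x y :: "'g ppart"
    by transfer (rule qform_sym)
  show "cx_form qform_p u v = cx_form qform_p v u"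
    by (simp add: cx_form_def sy[of "re_part u"] sy[of "im_part u"])
qed

lift_definition p_flat :: "'g::z2_quadratic_lie_algebra ppart cx \<Rightarrow> 'g ppart cx dual"
  is "cx_form qform_p"
  by (rule clinearI) (simp_all add: cx_form_qform_p_simps(1,2) scaleC_complex_def)

definition const_diff_op ::
  "'g::z2_quadratic_lie_algebra ppart cx sym \<Rightarrow> 'g ppart cx sym \<Rightarrow> 'g ppart cx sym"
  where "const_diff_op P = free_act (\<lambda>v. sym_deriv (p_flat v)) (rep_sym P)"

lemma const_diff_op_abs: "const_diff_op (abs_sym f) P = free_act (\<lambda>v. sym_deriv (p_flat v)) f P"
proof -
  let ?\<rho> = "\<lambda>v :: 'a ppart cx. sym_deriv (p_flat v)"
  have flat: "p_flat (x + y) = p_flat x + p_flat y" "p_flat (c *\<^sub>C x) = c *\<^sub>C p_flat x"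
    for x y :: "'a ppart cx" and c
    by (transfer; simp add: fun_eq_iff cx_form_qform_p_simps cx_form_qform_p_simps(3)[of "_ + _"]
        cx_form_qform_p_simps(3)[of "_ *\<^sub>C _"];
      metis cx_form_qform_p_simps)+
  have bil: "cbilinear ?\<rho>"
    unfolding cbilinear_def
    by (auto intro!: sym_deriv_linear clinearI simp: flat clinearD(1,2)[OF sym_deriv_linear_dual])
  have rel: "free_act ?\<rho> r Q = 0" if "r \<in> sym_rels" for r Q
    using that free_act_lin_rels[OF _ bil]
    by (auto simp: sym_rels_def free_act_simps free_act_mult[of ?\<rho>, OF sym_deriv_linear]
        sym_deriv_commute)
  have "ideal_rel sym_rels (rep_sym (abs_sym f)) f"
    using Quotient3_abs_rep[OF Quotient3_sym] by (simp flip: sym.abs_eq_iff)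
  then have "free_act ?\<rho> (rep_sym (abs_sym f) - f) P = 0"
    unfolding ideal_rel_def by (rule free_act_gen_ideal[OF _ sym_deriv_linear rel])
  then show ?thesis by (simp add: const_diff_op_def free_act_simps)
qed

definition poly_form :: "'g::z2_quadratic_lie_algebra ppart cx sym \<Rightarrow> 'g ppart cx sym \<Rightarrow> complex"
  where "poly_form P Q = sym_eval0 (const_diff_op Q (sym_conj P))"

section \<open>Modules\<close>

definition submodule :: "('m \<Rightarrow> 'm) set \<Rightarrow> 'm::complex_vector set \<Rightarrow> bool"
  where "submodule T N \<longleftrightarrow> csubspace N \<and> (\<forall>t\<in>T. t ` N \<subseteq> N)"

definition simple_submodule :: "('m \<Rightarrow> 'm) set \<Rightarrow> 'm::complex_vector set \<Rightarrow> bool"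
  where "simple_submodule T N \<longleftrightarrow> submodule T N \<and> N \<noteq> {0} \<and>
    (\<forall>N'. submodule T N' \<and> N' \<subseteq> N \<longrightarrow> N' = {0} \<or> N' = N)"

text \<open>The sum of all submodules isomorphic to \<open>\<sigma>\<close>, which are the images of the injective intertwiners.\<close>

definition isotypic_component ::
  "('x \<Rightarrow> 's \<Rightarrow> 's::complex_vector) \<Rightarrow> ('x \<Rightarrow> 'n \<Rightarrow> 'n::complex_vector) \<Rightarrow> 'n set"
  where "isotypic_component \<sigma> \<tau> =
    cspan (\<Union>{range f | f. clinear f \<and> inj f \<and> (\<forall>x s. f (\<sigma> x s) = \<tau> x (f s))})"

definition acting_scalar :: "('s::complex_vector \<Rightarrow> 's) \<Rightarrow> complex"
  where "acting_scalar t = (THE c. \<forall>s. t s = c *\<^sub>C s)"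

definition center :: "'a::ring set"
  where "center = {z. \<forall>u. z * u = u * z}"

definition infinitesimal_character ::
  "('v::complex_lie_algebra \<Rightarrow> 'm \<Rightarrow> 'm::complex_vector) \<Rightarrow> ('v uea \<Rightarrow> complex) \<Rightarrow> bool" where
  "infinitesimal_character \<pi> chi \<longleftrightarrow>
     chi 1 = 1 \<and>
     (\<forall>y\<in>center. \<forall>z\<in>center. chi (y + z) = chi y + chi z \<and> chi (y * z) = chi y * chi z) \<and>
     (\<forall>c. \<forall>z\<in>center. chi (c *\<^sub>C z) = c * chi z) \<and>
     (\<forall>z\<in>center. \<forall>m. uea_act \<pi> z m = chi z *\<^sub>C m)"

section \<open>Lie groups and \<open>(g, K)\<close>-modules\<close>

primrec Ck_on :: "nat \<Rightarrow> 'a::real_normed_vector set \<Rightarrow> ('a \<Rightarrow> 'b::real_normed_vector) \<Rightarrow> bool" where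
  "Ck_on 0 S f \<longleftrightarrow> continuous_on S f"
| "Ck_on (Suc n) S f \<longleftrightarrow> (\<forall>x\<in>S. f differentiable (at x)) \<and>
     (\<forall>v. Ck_on n S (\<lambda>x. frechet_derivative f (at x) v))"

definition smooth_on :: "'a::real_normed_vector set \<Rightarrow> ('a \<Rightarrow> 'b::real_normed_vector) \<Rightarrow> bool"
  where "smooth_on S f \<longleftrightarrow> (\<forall>n. Ck_on n S f)"

definition is_chart :: "'k topology \<Rightarrow> 'k set \<times> ('k \<Rightarrow> 'e::real_normed_vector) \<Rightarrow> bool" where
  "is_chart T = (\<lambda>(U, \<phi>). openin T U \<and> open (\<phi> ` U) \<and>
     homeomorphic_map (subtopology T U) (top_of_set (\<phi> ` U)) \<phi>)"

definition compatible_charts ::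
  "'k set \<times> ('k \<Rightarrow> 'e::real_normed_vector) \<Rightarrow> 'k set \<times> ('k \<Rightarrow> 'e) \<Rightarrow> bool" where
  "compatible_charts = (\<lambda>(U, \<phi>) (V, \<psi>).
     smooth_on (\<phi> ` (U \<inter> V)) (\<psi> \<circ> inv_into U \<phi>) \<and> smooth_on (\<psi> ` (U \<inter> V)) (\<phi> \<circ> inv_into V \<psi>))"

text \<open>A Lie group modelled on the finite-dimensional space \<open>'e\<close>, with topology \<open>T\<close> and smooth atlas \<open>A\<close>.\<close>

locale lie_group = group G for G :: "'k monoid" (structure) +
  fixes T :: "'k topology" and A :: "('k set \<times> ('k \<Rightarrow> 'e::real_normed_vector)) set"
  assumes model_finite_dim: "\<exists>S :: 'e set. finite S \<and> span S = UNIV"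
    and topspace_eq: "topspace T = carrier G"
    and Hausdorff: "Hausdorff_space T"
    and second_countable: "second_countable T"
    and charts: "c \<in> A \<Longrightarrow> is_chart T c"
    and charts_cover: "(\<Union>(U, \<phi>)\<in>A. U) = carrier G"
    and charts_compatible: "c \<in> A \<Longrightarrow> c' \<in> A \<Longrightarrow> compatible_charts c c'"
    and continuous_mult: "continuous_map (prod_topology T T) T (\<lambda>(x, y). x \<otimes> y)"
    and continuous_inv: "continuous_map T T (\<lambda>x. inv x)"
    and smooth_mult: "(U, \<phi>) \<in> A \<Longrightarrow> (V, \<psi>) \<in> A \<Longrightarrow> (W, \<xi>) \<in> A \<Longrightarrow>
      smooth_on {(\<phi> x, \<psi> y) | x y. x \<in> U \<and> y \<in> V \<and> x \<otimes> y \<in> W}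
        (\<lambda>(a, b). \<xi> (inv_into U \<phi> a \<otimes> inv_into V \<psi> b))"
    and smooth_inv: "(U, \<phi>) \<in> A \<Longrightarrow> (V, \<psi>) \<in> A \<Longrightarrow>
      smooth_on {\<phi> x | x. x \<in> U \<and> inv x \<in> V} (\<lambda>a. \<psi> (inv (inv_into U \<phi> a)))"

text \<open>A pair \<open>(g, K)\<close>: the Lie algebra of \<open>K\<close> is \<open>k\<^sub>0\<close> through the exponential map \<open>expK\<close> (smooth
  one-parameter subgroups, local diffeomorphism at \<open>0\<close>), and \<open>K\<close> acts on \<open>g\<close> by automorphisms
  \<open>Ad\<close> which extend the adjoint action of \<open>K\<close> and have differential \<open>ad\<close>. As \<open>Ad\<close> restricts to
  the adjoint action, the latter condition identifies the bracket of \<open>k\<^sub>0\<close> with that of \<open>K\<close>.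
  Continuity and derivatives in finite-dimensional spaces without a chosen norm are expressed
  through linear functionals.\<close>

locale gK_pair = lie_group G T A
  for G :: "'k monoid" (structure) and T
    and A :: "('k set \<times> ('k \<Rightarrow> 'e::real_normed_vector)) set" +
  fixes expK :: "'g::z2_quadratic_lie_algebra kpart \<Rightarrow> 'k" and Ad :: "'k \<Rightarrow> 'g cx \<Rightarrow> 'g cx"
  assumes expK_closed: "expK X \<in> carrier G"
    and expK_add: "expK ((s + t) *\<^sub>R X) = expK (s *\<^sub>R X) \<otimes> expK (t *\<^sub>R X)"
    and expK_chart: "\<exists>L :: 'e \<Rightarrow> 'g kpart. \<exists>W. Real_Vector_Spaces.linear L \<and> bij L \<and> open W \<and> 0 \<in> W \<and>
      inj_on (expK \<circ> L) W \<and> is_chart T (expK ` L ` W, inv_into W (expK \<circ> L)) \<and>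
      (\<forall>c\<in>A. compatible_charts (expK ` L ` W, inv_into W (expK \<circ> L)) c)"
    and Ad_linear: "k \<in> carrier G \<Longrightarrow> clinear (Ad k)"
    and Ad_bij: "k \<in> carrier G \<Longrightarrow> bij (Ad k)"
    and Ad_lie: "k \<in> carrier G \<Longrightarrow> Ad k (lie x y) = lie (Ad k x) (Ad k y)"
    and Ad_mult: "k \<in> carrier G \<Longrightarrow> l \<in> carrier G \<Longrightarrow> Ad (k \<otimes> l) x = Ad k (Ad l x)"
    and Ad_continuous: "clinear f \<Longrightarrow> continuous_map T euclidean (\<lambda>k. f (Ad k x) :: complex)"
    and Ad_adjoint: "k \<in> carrier G \<Longrightarrow>
      \<exists>Y. Ad k (cx_of (kpart_val X)) = cx_of (kpart_val Y) \<and> k \<otimes> expK X \<otimes> inv k = expK Y"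
    and Ad_differential: "clinear f \<Longrightarrow>
      ((\<lambda>t. f (Ad (expK (t *\<^sub>R X)) x) :: complex)
        has_vector_derivative f (lie (cx_of (kpart_val X)) x)) (at 0)"

locale gK_module = gK_pair G T A expK Ad
  for G :: "'k monoid" (structure) and T and A :: "('k set \<times> ('k \<Rightarrow> 'e::real_normed_vector)) set"
    and expK :: "'g::z2_quadratic_lie_algebra kpart \<Rightarrow> 'k" and Ad :: "'k \<Rightarrow> 'g cx \<Rightarrow> 'g cx" +
  fixes \<pi> :: "'g cx \<Rightarrow> 'm \<Rightarrow> 'm::complex_vector" and \<rho> :: "'k \<Rightarrow> 'm \<Rightarrow> 'm"
  assumes lie_rep: "lie_rep \<pi>"
    and rho_linear: "k \<in> carrier G \<Longrightarrow> clinear (\<rho> k)"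
    and rho_one: "\<rho> \<one> m = m"
    and rho_mult: "k \<in> carrier G \<Longrightarrow> l \<in> carrier G \<Longrightarrow> \<rho> (k \<otimes> l) m = \<rho> k (\<rho> l m)"
    and locally_finite: "cfin_dim ((\<lambda>k. \<rho> k m) ` carrier G)"
    and rho_continuous: "clinear f \<Longrightarrow> continuous_map T euclidean (\<lambda>k. f (\<rho> k m) :: complex)"
    and rho_differential: "clinear f \<Longrightarrow>
      ((\<lambda>t. f (\<rho> (expK (t *\<^sub>R X)) m) :: complex)
        has_vector_derivative f (\<pi> (cx_of (kpart_val X)) m)) (at 0)"
    and rho_pi: "k \<in> carrier G \<Longrightarrow> \<rho> k (\<pi> x m) = \<pi> (Ad k x) (\<rho> k m)"

text \<open>Every isotypic component of \<open>M\<close> under \<open>K\<close> has finite dimension. The submodules of \<open>M\<close>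
  isomorphic to a submodule \<open>N\<close> are the images \<open>f ` N\<close> below, because a linear map on \<open>N\<close> extends to \<open>M\<close>.\<close>

definition admissible :: "'k monoid \<Rightarrow> ('k \<Rightarrow> 'm \<Rightarrow> 'm::complex_vector) \<Rightarrow> bool" where
  "admissible G \<rho> \<longleftrightarrow>
     (\<forall>N. simple_submodule (\<rho> ` carrier G) N \<and> cfin_dim N \<longrightarrow>
        cfin_dim (cspan (\<Union>{f ` N | f. clinear f \<and> inj_on f N \<and>
          (\<forall>k\<in>carrier G. \<forall>n\<in>N. f (\<rho> k n) = \<rho> k (f n))})))"

end

theory Submission
  imports Defs "HOL-Computational_Algebra.Fundamental_Theorem_Algebra"
begin

text \<open>
  Since \<open>x* = - conj x\<close> on \<open>g\<close> and multiplication by \<open>v\<close> is adjoint to differentiation along \<open>conj v\<close>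
  on polynomials, the adjoint of \<open>D\<^sup>+\<close> is \<open>- D\<^sup>-\<close>. The left-hand side is therefore \<open>\<langle>x, [D\<^sup>+, D\<^sup>-] x\<rangle>\<close>.
  On a pure tensor, \<open>[D\<^sup>+, D\<^sup>-]\<close> contributes minus the \<open>p\<close>-part of the Casimir element of \<open>g\<close>, which is
  \<open>\<Omega>(k) - \<Omega>(g)\<close>, and a term built from the brackets \<open>[z, u] \<in> k\<close>. Expanding these brackets in a basis of
  \<open>k\<close> gives \<open>- \<Sum> w \<otimes> \<nu>(w')\<close> over dual bases of \<open>k\<close>, which is the cross term of
  \<open>\<Delta>(\<Omega>(k)) = \<Omega>(k) \<otimes> 1 + 1 \<otimes> \<nu>(\<Omega>(k)) + 2 \<Sum> w \<otimes> \<nu>(w')\<close> up to the factor \<open>- 1/2\<close>. By Schur's lemma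
  \<open>\<Delta>(\<Omega>(k))\<close> acts on the isotypic component by \<open>\<sigma>(\<Omega>(k))\<close>. Independence of the canonical tensor
  \<open>\<Sum> w \<otimes> w'\<close> of the chosen basis makes all of this work for arbitrary bases.\<close>

section \<open>Complex linear and bilinear maps applied to finite sums\<close>

section \<open>Linear and bilinear maps\<close>

lemma clinear_sum:
  assumes "clinear f"
  shows "f (\<Sum>i\<in>I. g i) = (\<Sum>i\<in>I. f (g i))"
proof -
  interpret Vector_Spaces.linear scaleC scaleC f by fact
  show ?thesis by (rule sum)
qed

lemma scaleC_minus_left [simp]: "(- c) *\<^sub>C x = - (c *\<^sub>C (x :: 'a::complex_vector))"
  by (rule cvs.scale_minus_left)

lemma scaleC_sum_right: "c *\<^sub>C (\<Sum>i\<in>I. f i) = (\<Sum>i\<in>I. c *\<^sub>C (f i :: 'a::complex_vector))"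
  by (rule cvs.scale_sum_right)

lemma cbilinearI:
  assumes "\<And>x y z. f (x + y) z = f x z + f y z" "\<And>c x z. f (c *\<^sub>C x) z = c *\<^sub>C f x z"
    "\<And>x u v. f x (u + v) = f x u + f x v" "\<And>c x u. f x (c *\<^sub>C u) = c *\<^sub>C f x u"
  shows "cbilinear f"
  using assms by (auto simp: cbilinear_def intro!: clinearI)

lemma cbilinear_linear:
  assumes "cbilinear f"
  shows "clinear (f x)" "clinear (\<lambda>x. f x y)"
  using assms by (auto simp: cbilinear_def)

lemma cbilinear_sum:
  assumes "cbilinear f"
  shows "f (\<Sum>i\<in>I. g i) y = (\<Sum>i\<in>I. f (g i) y)" "f x (\<Sum>i\<in>I. h i) = (\<Sum>i\<in>I. f x (h i))"
  using clinear_sum[OF cbilinear_linear(2)[OF assms]] clinear_sum[OF cbilinear_linear(1)[OF assms]]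
  by auto

lemma cbilinear_minus:
  assumes "cbilinear f"
  shows "f (- x) y = - f x y" "f x (- y) = - f x y"
  using clinearD(4)[OF cbilinear_linear(2)[OF assms]] clinearD(4)[OF cbilinear_linear(1)[OF assms]]
  by auto

lemma clinear_comp: "clinear f \<Longrightarrow> clinear g \<Longrightarrow> clinear (\<lambda>x. f (g x))"
  by (rule clinearI) (simp_all add: clinearD)

section \<open>Eigenvectors from annihilating polynomials, and Schur's lemma in finite
  dimension\<close>

section \<open>Eigenvalues and Schur's lemma\<close>

definition poly_act :: "('s::complex_vector \<Rightarrow> 's) \<Rightarrow> complex poly \<Rightarrow> 's \<Rightarrow> 's"
  where "poly_act T p v = (\<Sum>i\<le>degree p. coeff p i *\<^sub>C (T ^^ i) v)"

text \<open>Padding with zero coefficients puts polynomials of different degrees over one summation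
  range.\<close>

lemma poly_act_bound:
  assumes "degree p \<le> n"
  shows "poly_act T p v = (\<Sum>i\<le>n. coeff p i *\<^sub>C (T ^^ i) v)"
  unfolding poly_act_def
  by (rule sum.mono_neutral_left) (use assms in \<open>auto simp: coeff_eq_0\<close>)

text \<open>Multiplication by \<open>X - c\<close> shifts the coefficients and subtracts
  \<open>c\<close> times \<open>q\<close>, and the shift amounts to one more application of
  \<open>T\<close>. When the left-hand side vanishes, \<open>poly_act T q v\<close> solves the
  eigenvector equation for \<open>c\<close>.\<close>

lemma poly_act_linear_factor:
  assumes "clinear T"
  shows "poly_act T ([:- c, 1:] * q) v = T (poly_act T q v) - c *\<^sub>C poly_act T q v"
proof -
  let ?n = "degree q"
  have eq: "[:- c, 1:] * q = pCons 0 q - smult c q" by simp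
  have "degree ([:- c, 1:] * q) \<le> Suc ?n"
    using degree_mult_le[of "[:- c, 1:]" q] by simp
  then have "poly_act T ([:- c, 1:] * q) v =
      (\<Sum>i\<le>Suc ?n. coeff (pCons 0 q) i *\<^sub>C (T ^^ i) v) - (\<Sum>i\<le>Suc ?n. coeff (smult c q) i *\<^sub>C (T ^^ i) v)"
    unfolding eq by (simp only: poly_act_bound coeff_diff cvs.scale_left_diff_distrib sum_subtractf)
  \<comment> \<open>The coefficient of \<open>pCons 0 q\<close> at index 0 vanishes, so the sum can
    be reindexed from 1, which leaves one \<open>T\<close> to pull out.\<close>
  moreover have "(\<Sum>i\<le>Suc ?n. coeff (pCons 0 q) i *\<^sub>C (T ^^ i) v) = T (poly_act T q v)"
    by (simp only: sum.atMost_Suc_shift) (simp add: poly_act_def clinear_sum[OF assms] clinearD[OF assms])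
  moreover have "(\<Sum>i\<le>Suc ?n. coeff (smult c q) i *\<^sub>C (T ^^ i) v) = c *\<^sub>C poly_act T q v"
    using poly_act_bound[of q "Suc ?n" T v] by (simp add: scaleC_sum_right scaleC_scaleC scaleC_add_right)
  ultimately show ?thesis by simp
qed

text \<open>A space spanned by \<open>card S\<close> vectors contains no \<open>card S + 1\<close>
  independent ones. The iterates of \<open>T\<close> on \<open>v\<close> up to exponent
  \<open>card S\<close> therefore satisfy a linear relation, whose coefficients are those of the
  polynomial.\<close>

lemma annihilating_poly:
  fixes T :: "'s::complex_vector \<Rightarrow> 's"
  assumes "cfin_dim (UNIV :: 's set)"
  obtains p where "p \<noteq> 0" "poly_act T p v = 0"
proof -
  obtain S :: "'s set" where S: "finite S" "UNIV \<subseteq> cspan S" using assms by (auto simp: cfin_dim_def)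
  let ?n = "card S" and ?f = "\<lambda>i. (T ^^ i) v"
  show ?thesis
  proof (cases "inj_on ?f {..?n}")
    case True
    have "cdependent (?f ` {..?n})"
    proof (rule ccontr)
      assume "\<not> cdependent (?f ` {..?n})"
      then have "card (?f ` {..?n}) \<le> card S"
        using cvs.independent_span_bound[OF S(1), of "?f ` {..?n}"] S(2) by auto
      then show False using card_image[OF True] by simp
    qed
    then obtain u x where u: "(\<Sum>w\<in>?f ` {..?n}. u w *\<^sub>C w) = 0" "x \<in> ?f ` {..?n}" "u x \<noteq> 0"
      using cvs.dependent_finite[of "?f ` {..?n}"] by auto
    define p where "p = (\<Sum>i\<le>?n. monom (u (?f i)) i)"
    have cp: "coeff p i = (if i \<le> ?n then u (?f i) else 0)" for i
      by (simp add: p_def coeff_sum coeff_monom if_distrib sum.delta cong: if_cong)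
    have "degree p \<le> ?n" by (rule degree_le) (simp add: cp)
    then have "poly_act T p v = (\<Sum>i\<le>?n. u (?f i) *\<^sub>C ?f i)"
      by (simp add: poly_act_bound cp)
    also have "\<dots> = 0" using u(1) by (simp add: sum.reindex[OF True])
    finally have "poly_act T p v = 0" .
    moreover have "p \<noteq> 0" 
    proof -
      from u(2) obtain i where "i \<le> ?n" "x = ?f i" by blast
      then have "coeff p i \<noteq> 0" using u(3) cp by simp
      then show ?thesis by auto
    qed
    ultimately show ?thesis by (rule that[rotated])
  next
    \<comment> \<open>Dependence is a property of sets, and a repeated iterate makes the set too
      small for the counting argument. The repetition itself is then the relation.\<close>
    case False
    then obtain i j where ij: "i \<noteq> j" "?f i = ?f j" by (auto simp: inj_on_def)
    define p :: "complex poly" where "p = monom 1 i - monom 1 j"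
    have "degree p \<le> max i j" unfolding p_def
      by (rule degree_diff_le) (auto intro: order_trans[OF degree_monom_le])
    then have "poly_act T p v = (\<Sum>k\<le>max i j. (if k = i then ?f k else 0) - (if k = j then ?f k else 0))"
      by (simp add: poly_act_bound, intro sum.cong)
        (auto simp: p_def scaleC_one cvs.scale_left_diff_distrib)
    also have "\<dots> = 0" using ij(2) by (simp add: sum_subtractf)
    finally have "poly_act T p v = 0" .
    moreover have "p \<noteq> 0" using ij(1) by (auto simp: p_def poly_eq_iff)
    ultimately show ?thesis by (rule that[rotated])
  qed
qed

text \<open>Take an annihilating polynomial of \<open>v\<close> of least degree and split off a root
  \<open>c\<close>. By minimality the cofactor does not annihilate \<open>v\<close>, so it produces
  an eigenvector for \<open>c\<close>.\<close>

lemma eigenvector_exists: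
  fixes T :: "'s::complex_vector \<Rightarrow> 's"
  assumes "clinear T" "cfin_dim (UNIV :: 's set)" "(v :: 's) \<noteq> 0"
  obtains c w where "w \<noteq> 0" "T w = c *\<^sub>C w"
proof -
  define P where "P p \<longleftrightarrow> p \<noteq> 0 \<and> poly_act T p v = 0" for p
  obtain p0 where "P p0" using annihilating_poly[OF assms(2)] unfolding P_def by metis
  then obtain p where p: "P p" and min: "\<And>q. P q \<Longrightarrow> degree p \<le> degree q"
    using ex_has_least_nat[of P p0 degree] by blast
  \<comment> \<open>A nonzero constant cannot annihilate \<open>v \<noteq> 0\<close>, and a root
    exists only in positive degree.\<close>
  have "degree p \<noteq> 0"
  proof
    assume "degree p = 0"
    then obtain a where "p = [:a:]" by (rule degree_eq_zeroE)
    then show False using p assms(3) by (auto simp: P_def poly_act_def)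
  qed
  then obtain c where "poly p c = 0"
    using fundamental_theorem_of_algebra[of p] by (auto simp: constant_degree)
  then obtain q where q: "p = [:- c, 1:] * q" using poly_eq_0_iff_dvd by (metis dvd_def)
  have "q \<noteq> 0" using p q by (auto simp: P_def)
  then have "degree q < degree p" unfolding q by (subst degree_mult_eq) auto
  then have "poly_act T q v \<noteq> 0" using min[of q] \<open>q \<noteq> 0\<close> by (auto simp: P_def)
  moreover have "T (poly_act T q v) = c *\<^sub>C poly_act T q v"
    using p poly_act_linear_factor[OF assms(1), of c q v] by (simp add: P_def q)
  ultimately show ?thesis by (rule that)
qed

text \<open>An eigenspace of \<open>T\<close> is stable under every operator commuting with
  \<open>T\<close>; being nonzero, it exhausts the simple module.\<close>

lemma schur_acting_scalar:
  fixes T :: "'s::complex_vector \<Rightarrow> 's"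
  assumes "simple_submodule S UNIV" "cfin_dim (UNIV :: 's set)" "clinear T"
    and comm: "\<And>t s. t \<in> S \<Longrightarrow> T (t s) = t (T s)" and lin: "\<And>t. t \<in> S \<Longrightarrow> clinear t"
  shows "T s = acting_scalar T *\<^sub>C s"
proof -
  obtain v :: 's where v: "v \<noteq> 0" using assms(1) by (auto simp: simple_submodule_def)
  obtain c w where w: "w \<noteq> 0" "T w = c *\<^sub>C w"
    by (rule eigenvector_exists[OF assms(3,2) v])
  let ?N = "{s. T s = c *\<^sub>C s}"
  have "submodule S ?N"
    unfolding submodule_def
  proof (intro conjI ballI)
    show "csubspace ?N"
      by (rule cvs.subspaceI) (auto simp: clinearD[OF assms(3)] scaleC_add_right scaleC_scaleC mult.commute)
    show "t ` ?N \<subseteq> ?N" if "t \<in> S" for t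
      using that by (auto simp: comm clinearD[OF lin])
  qed
  then have "?N = UNIV" using assms(1) w unfolding simple_submodule_def by blast
  then have c: "\<forall>s. T s = c *\<^sub>C s" by blast
  \<comment> \<open>\<open>acting_scalar\<close> is a definite description, so the eigenvalue must
    also be unique; the nonzero vector \<open>v\<close> ensures this.\<close>
  then have "acting_scalar T = c" unfolding acting_scalar_def
  proof (rule the_equality)
    fix d assume "\<forall>s. T s = d *\<^sub>C s"
    then have "d *\<^sub>C v = c *\<^sub>C v" using c by metis
    then show "d = c" using v by (simp add: cvs.scale_cancel_right)
  qed
  then show ?thesis using c by simp
qed

section \<open>Dual families of a nondegenerate symmetric form and its canonical tensor\<close>

section \<open>Dual bases\<close>

text \<open>The common setting for the complexified forms on \<open>g\<close>, \<open>k\<close> and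
  \<open>p\<close>.\<close>

locale nondegenerate_bilinear =
  fixes B :: "'v::complex_vector \<Rightarrow> 'v \<Rightarrow> complex"
  assumes add_right: "B x (y + z) = B x y + B x z"
    and scale_right: "B x (c *\<^sub>C y) = c * B x y"
    and sym: "B x y = B y x"
    and nondegenerate: "(\<And>y. B x y = 0) \<Longrightarrow> x = 0"
begin

lemma bilinear: "cbilinear B"
  by (rule cbilinearI) (metis sym add_right scale_right scaleC_complex_def)+

lemma scale_left: "B (c *\<^sub>C x) y = c * B x y"
  by (metis sym scale_right)

lemmas sum_left = cbilinear_sum(1)[OF bilinear]
lemmas sum_right = cbilinear_sum(2)[OF bilinear]
lemmas diff_left = clinearD(5)[OF cbilinear_linear(2)[OF bilinear]]

lemma eqI: "(\<And>y. B x y = B z y) \<Longrightarrow> x = z"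
  using nondegenerate[of "x - z"] by (simp add: diff_left)

text \<open>Equivalently, the sum of all \<open>e i \<otimes> f i\<close> is the canonical tensor of \<open>B\<close>. The families
  need not be bases.\<close>

definition dual_bases :: "'i set \<Rightarrow> ('i \<Rightarrow> 'v) \<Rightarrow> ('i \<Rightarrow> 'v) \<Rightarrow> bool"
  where "dual_bases I e f \<longleftrightarrow> (\<forall>v. (\<Sum>i\<in>I. B v (f i) *\<^sub>C e i) = v)"

text \<open>Paired with \<open>y\<close>, the swapped expansion of \<open>v\<close> gives
  \<open>v\<close> paired with the original expansion of \<open>y\<close>; nondegeneracy then
  identifies it with \<open>v\<close>.\<close>

lemma dual_bases_swap:
  assumes "dual_bases I e f"
  shows "dual_bases I f e"
  unfolding dual_bases_def
proof (intro allI eqI)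
  fix v y
  have "B (\<Sum>i\<in>I. B v (e i) *\<^sub>C f i) y = B v (\<Sum>i\<in>I. B y (f i) *\<^sub>C e i)"
    by (simp add: sum_left sum_right scale_left scale_right sym[of y] mult.commute)
  then show "B (\<Sum>i\<in>I. B v (e i) *\<^sub>C f i) y = B v y"
    using assms by (simp add: dual_bases_def)
qed

lemma dual_bases_expand:
  assumes "dual_bases I e f" "clinear g"
  shows "(\<Sum>i\<in>I. B v (f i) *\<^sub>C g (e i)) = g v" "(\<Sum>i\<in>I. B v (e i) *\<^sub>C g (f i)) = g v"
proof -
  have "(\<Sum>i\<in>I. B v (f i) *\<^sub>C g (e i)) = g (\<Sum>i\<in>I. B v (f i) *\<^sub>C e i)" if "dual_bases I e f" for e f
    by (simp add: clinear_sum[OF assms(2)] clinearD[OF assms(2)])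
  with assms(1) dual_bases_swap[OF assms(1)]
  show "(\<Sum>i\<in>I. B v (f i) *\<^sub>C g (e i)) = g v" "(\<Sum>i\<in>I. B v (e i) *\<^sub>C g (f i)) = g v"
    by (simp_all add: dual_bases_def)
qed

text \<open>A bilinear \<open>F\<close> sees only the canonical tensor: expand each
  \<open>f i\<close> along the second family, then collect over \<open>I\<close>. This removes the
  dependence on bases wherever conjugated or swapped families appear.\<close>

lemma dual_bases_canonical:
  assumes "dual_bases I e f" "dual_bases J e' f'" "cbilinear F"
  shows "(\<Sum>i\<in>I. F (e i) (f i)) = (\<Sum>j\<in>J. F (e' j) (f' j))"
proof -
  have "(\<Sum>i\<in>I. F (e i) (f i)) = (\<Sum>i\<in>I. \<Sum>j\<in>J. B (f i) (e' j) *\<^sub>C F (e i) (f' j))"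
    by (simp add: dual_bases_expand(2)[OF assms(2) cbilinear_linear(1)[OF assms(3)]])
  also have "\<dots> = (\<Sum>j\<in>J. \<Sum>i\<in>I. B (e' j) (f i) *\<^sub>C F (e i) (f' j))"
    by (subst sum.swap) (simp add: sym)
  also have "\<dots> = (\<Sum>j\<in>J. F (e' j) (f' j))"
    by (simp add: dual_bases_expand(1)[OF assms(1) cbilinear_linear(2)[OF assms(3)]])
  finally show ?thesis .
qed

text \<open>\<open>dual_elt\<close> is a definite description, so existence and uniqueness are both
  at stake. Uniqueness is nondegeneracy tested on the spanning set \<open>b\<close>; existence holds
  because an injective endomorphism of a finite-dimensional space is surjective.\<close>

lemma dual_elt_apply:
  assumes "cbasis b" "u \<in> b"
  shows "B u (dual_elt B b w) = (if u = w then 1 else 0)"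
proof -
  have fin: "finite b" and ind: "\<not> cdependent b" and span: "cspan b = UNIV"
    using assms(1) by (auto simp: cbasis_def)
  interpret fd: finite_dimensional_vector_space "scaleC :: complex \<Rightarrow> 'v \<Rightarrow> 'v" b
    by unfold_locales (use fin ind span in \<open>auto simp: cspan_def cdependent_def\<close>)
  \<comment> \<open>\<open>L\<close> stores the values \<open>B u v\<close> for
    \<open>u \<in> b\<close> as coordinates, so its surjectivity lets these values be prescribed at
    will.\<close>
  define L where "L v = (\<Sum>u\<in>b. B u v *\<^sub>C u)" for v
  have L: "clinear L"
    by (rule clinearI) (simp_all add: L_def add_right scale_right scaleC_add_left sum.distrib
        scaleC_sum_right scaleC_scaleC)
  have unique: "B u v = B u v'" if "L v = L v'" "u \<in> b" for u v v'
  proof -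
    have "(\<Sum>u\<in>b. (B u v - B u v') *\<^sub>C u) = 0"
      using that(1) by (simp add: L_def cvs.scale_left_diff_distrib sum_subtractf)
    then have "B u v - B u v' = 0"
      by (rule cvs.independentD[OF ind fin order_refl _ that(2)])
    then show ?thesis by simp
  qed
  have zero: "v = v'" if "\<And>u. u \<in> b \<Longrightarrow> B u v = B u v'" for v v'
  proof (rule eqI)
    fix y
    have "y \<in> cspan b" using span by simp
    then have "B y v = B y v'"
      by (induction rule: cvs.span_induct_alt)
        (use that in \<open>auto simp: cbilinearD[OF bilinear] scale_left clinearD(3)[OF cbilinear_linear(2)[OF bilinear]]\<close>)
    then show "B v y = B v' y" by (simp add: sym)
  qed
  have "inj L" using unique zero by (metis injI)
  then have "surj L" using fd.linear_inj_imp_surj[OF L] by blast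
  then obtain v where v: "L v = (\<Sum>u\<in>b. (if u = w then 1 else 0) *\<^sub>C u)" by (metis surjD)
  have vw: "B u v = (if u = w then 1 else 0)" if "u \<in> b" for u
  proof -
    have "(\<Sum>u\<in>b. (B u v - (if u = w then 1 else 0)) *\<^sub>C u) = 0"
      using v by (simp add: L_def cvs.scale_left_diff_distrib sum_subtractf)
    then have "B u v - (if u = w then 1 else 0) = 0"
      by (rule cvs.independentD[OF ind fin order_refl _ that])
    then show ?thesis by simp
  qed
  have "\<forall>u\<in>b. B u (dual_elt B b w) = (if u = w then 1 else 0)"
    unfolding dual_elt_def
    by (rule theI[where a = v]) (use vw zero in auto)
  then show ?thesis using assms(2) by blast
qed

text \<open>The expansion is linear in \<open>v\<close>, and on a basis vector only its own term
  survives.\<close>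

lemma dual_bases_dual_elt:
  assumes "cbasis b"
  shows "dual_bases b (\<lambda>w. w) (dual_elt B b)"
  unfolding dual_bases_def
proof
  fix v
  have fin: "finite b" and span: "v \<in> cspan b" using assms by (auto simp: cbasis_def)
  show "(\<Sum>w\<in>b. B v (dual_elt B b w) *\<^sub>C w) = v"
    using span
  proof (induction rule: cvs.span_induct_alt)
    case base
    then show ?case using scale_left[of 0] by simp
  next
    case (step c x y)
    have "(\<Sum>w\<in>b. B x (dual_elt B b w) *\<^sub>C w) = (\<Sum>w\<in>b. if w = x then w else 0)"
      using step(1) by (intro sum.cong) (auto simp: dual_elt_apply[OF assms] scaleC_one)
    also have "\<dots> = x" using step(1) fin by simp
    finally show ?case using step(2)
      by (simp add: cbilinearD[OF bilinear] scale_left scaleC_add_left sum.distrib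
          scaleC_complex_def flip: scaleC_scaleC scaleC_sum_right)
  qed
qed

text \<open>Coordinate functionals are represented by dual vectors through \<open>B\<close>; this
  links \<open>dual_basis_elt\<close> to \<open>dual_elt\<close>.\<close>

lemma representation_dual_elt:
  assumes "cbasis b" "z \<in> b"
  shows "crepresentation b v z = B v (dual_elt B b z)"
proof -
  have fin: "finite b" and ind: "\<not> cdependent b" and span: "cspan b = UNIV"
    using assms(1) by (auto simp: cbasis_def)
  have lin: "clinear (\<lambda>v. crepresentation b v z)"
    using ind span
    by (intro clinearI) (simp_all add: cvs.representation_add cvs.representation_scale scaleC_complex_def)
  have "crepresentation b v z = (\<Sum>w\<in>b. B v (dual_elt B b w) *\<^sub>C crepresentation b w z)"
    using dual_bases_expand(1)[OF dual_bases_dual_elt[OF assms(1)] lin] by simp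
  also have "\<dots> = (\<Sum>w\<in>b. if w = z then B v (dual_elt B b w) else 0)"
    by (rule sum.cong) (auto simp: cvs.representation_basis[OF ind] scaleC_complex_def)
  finally show ?thesis using fin assms(2) by simp
qed

end

section \<open>Induction on tensors and tensor products of operators\<close>

section \<open>Tensor products\<close>

lemma tens_bilinear: "cbilinear (\<otimes>\<^sub>C)"
proof (rule cbilinearI)
  fix x y z u v and c :: complex
  show "(x + y) \<otimes>\<^sub>C (z :: 'b) = (x :: 'a) \<otimes>\<^sub>C z + y \<otimes>\<^sub>C z"
    by transfer (simp only: tensor_eq_def, rule cvs.span_base, force simp: tensor_rels_def algebra_simps)
  show "(c *\<^sub>C x) \<otimes>\<^sub>C (z :: 'b) = c *\<^sub>C ((x :: 'a) \<otimes>\<^sub>C z)"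
    by transfer (simp only: tensor_eq_def, rule cvs.span_base, force simp: tensor_rels_def algebra_simps)
  show "(x :: 'a) \<otimes>\<^sub>C (u + v :: 'b) = x \<otimes>\<^sub>C u + x \<otimes>\<^sub>C v"
    by transfer (simp only: tensor_eq_def, rule cvs.span_base, force simp: tensor_rels_def algebra_simps)
  show "(x :: 'a) \<otimes>\<^sub>C (c *\<^sub>C u :: 'b) = c *\<^sub>C (x \<otimes>\<^sub>C u)"
    by transfer (simp only: tensor_eq_def, rule cvs.span_base, force simp: tensor_rels_def algebra_simps)
qed

lemmas tens_simps = cbilinearD[OF tens_bilinear] cbilinear_minus[OF tens_bilinear]
  cbilinear_sum[OF tens_bilinear]

text \<open>Scalars are absorbed into the first factor, so closure under sums covers all linear
  combinations of pure tensors.\<close>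

lemma tensor_induct [case_names tens add]:
  assumes "\<And>a b. P (a \<otimes>\<^sub>C b)" "\<And>x y. P x \<Longrightarrow> P y \<Longrightarrow> P (x + y)"
  shows "P t"
proof -
  have "P (abs_tensor f)" for f
  proof (induction f rule: pm_induct)
    case (single k c)
    have "abs_tensor (Poly_Mapping.single k c) = (c *\<^sub>C fst k) \<otimes>\<^sub>C snd k"
      by (simp add: tens_simps, simp add: tens.abs_eq scaleC_tensor.abs_eq scaleC_single)
    then show ?case using assms(1) by simp
  next
    case (add f g)
    then show ?case using assms(2) by (simp flip: plus_tensor.abs_eq)
  qed
  moreover obtain f where "t = abs_tensor f" using Quotient3_abs_rep[OF Quotient3_tensor] by metis
  ultimately show ?thesis by simp
qed

lemma tensor_lift_linear:
  assumes "cbilinear \<beta>"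
  shows "clinear (tensor_lift \<beta>)"
proof (rule clinearI)
  let ?F = "\<lambda>(a, b) c. c *\<^sub>C \<beta> a b"
  have add: "pm_ext ?F (f + g) = pm_ext ?F f + pm_ext ?F g" for f g
    by (rule pm_ext_add) (auto simp: scaleC_add_left)
  have scale: "pm_ext ?F (c *\<^sub>C f) = c *\<^sub>C pm_ext ?F f" for c f
  proof (induction f rule: pm_induct)
    case (single k d) then show ?case
      by (cases k) (simp add: scaleC_single pm_ext_single scaleC_scaleC)
  qed (simp add: add scaleC_add_right)
  fix x y :: "('a, 'b) tensor" and c
  obtain f g where fg: "x = abs_tensor f" "y = abs_tensor g"
    using Quotient3_abs_rep[OF Quotient3_tensor] by metis
  show "tensor_lift \<beta> (x + y) = tensor_lift \<beta> x + tensor_lift \<beta> y"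
    by (simp add: fg plus_tensor.abs_eq tensor_lift_abs[OF assms] add)
  show "tensor_lift \<beta> (c *\<^sub>C x) = c *\<^sub>C tensor_lift \<beta> x"
    by (simp add: fg scaleC_tensor.abs_eq tensor_lift_abs[OF assms] scale)
qed

lemma clinear_tensor_eqI:
  assumes "clinear f" "clinear g" "\<And>a b. f (a \<otimes>\<^sub>C b) = g (a \<otimes>\<^sub>C b)"
  shows "f t = g t"
  by (induction t rule: tensor_induct) (simp_all add: assms(3) clinearD(1)[OF assms(1)] clinearD(1)[OF assms(2)])

definition tensor_map :: "('a::complex_vector \<Rightarrow> 'c::complex_vector) \<Rightarrow> ('b::complex_vector \<Rightarrow> 'd::complex_vector)
    \<Rightarrow> ('a, 'b) tensor \<Rightarrow> ('c, 'd) tensor"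
  where "tensor_map f g = tensor_lift (\<lambda>a b. f a \<otimes>\<^sub>C g b)"

context
  fixes f :: "'a::complex_vector \<Rightarrow> 'c::complex_vector" and g :: "'b::complex_vector \<Rightarrow> 'd::complex_vector"
  assumes f: "clinear f" and g: "clinear g"
begin

lemma tensor_map_bilinear: "cbilinear (\<lambda>a b. f a \<otimes>\<^sub>C g b)"
  by (rule cbilinearI) (simp_all add: clinearD[OF f] clinearD[OF g] tens_simps)

lemma tensor_map_linear: "clinear (tensor_map f g)"
  unfolding tensor_map_def by (rule tensor_lift_linear[OF tensor_map_bilinear])

lemma tensor_map_tens: "tensor_map f g (a \<otimes>\<^sub>C b) = f a \<otimes>\<^sub>C g b"
  unfolding tensor_map_def by (rule tensor_lift_tens[OF tensor_map_bilinear])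

end

text \<open>At a fixed vector \<open>t\<close> the operators depend bilinearly on their labels. In
  this shape \<open>tensor_lift\<close> can define the action of the tensor product algebra, and
  \<open>dual_bases_canonical\<close> can be applied to sums of operators.\<close>

lemma tensor_map_family_bilinear:
  assumes "cbilinear F" "cbilinear G"
  shows "cbilinear (\<lambda>u w. tensor_map (F u) (G w) t)"
proof -
  note lin = cbilinear_linear(1)[OF assms(1)] cbilinear_linear(1)[OF assms(2)]
  note D = cbilinearD[OF assms(1)] cbilinearD[OF assms(2)]
  show ?thesis
  proof (induction t rule: tensor_induct)
    case (tens a b)
    show ?case unfolding tensor_map_tens[OF lin]
      by (rule cbilinearI) (simp_all add: D tens_simps)
  next
    case (add x y)
    show ?case unfolding clinearD(1)[OF tensor_map_linear[OF lin]]
      by (rule cbilinearI)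
        (simp_all add: cbilinearD[OF add(1)] cbilinearD[OF add(2)] scaleC_add_right algebra_simps)
  qed
qed

section \<open>Actions of \<open>U(g)\<close>, of the Weyl algebra and of their tensor
  product\<close>

section \<open>Actions of the enveloping algebra and of the Weyl algebra\<close>

context
  fixes \<rho> :: "'v::complex_lie_algebra \<Rightarrow> 'm \<Rightarrow> 'm::complex_vector"
  assumes rep: "lie_rep \<rho>"
begin

lemma lie_rep_bilinear: "cbilinear \<rho>"
  and lie_rep_lie: "\<rho> (lie x y) m = \<rho> x (\<rho> y m) - \<rho> y (\<rho> x m)"
  using rep by (auto simp: lie_rep_def)

lemmas lie_rep_linear = cbilinear_linear(1)[OF lie_rep_bilinear]

lemma uea_act_simps:
  "uea_act \<rho> (u + v) m = uea_act \<rho> u m + uea_act \<rho> v m"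
  "uea_act \<rho> (c *\<^sub>C u) m = c *\<^sub>C uea_act \<rho> u m"
  "uea_act \<rho> (u * v) m = uea_act \<rho> u (uea_act \<rho> v m)"
  "uea_act \<rho> (uea_in x) m = \<rho> x m"
  "uea_act \<rho> 1 m = m"
  "uea_act \<rho> 0 m = 0"
proof -
  obtain f g where fg: "u = abs_uea f" "v = abs_uea g"
    using Quotient3_abs_rep[OF Quotient3_uea] by metis
  note lin = lie_rep_linear
  show "uea_act \<rho> (u + v) m = uea_act \<rho> u m + uea_act \<rho> v m"
    "uea_act \<rho> (c *\<^sub>C u) m = c *\<^sub>C uea_act \<rho> u m"
    "uea_act \<rho> (u * v) m = uea_act \<rho> u (uea_act \<rho> v m)"
    unfolding fg by (simp_all add: uea_act_abs[OF rep] free_act_simps free_act_mult[of \<rho>, OF lin]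
        flip: abs_uea_hom)
  show "uea_act \<rho> (uea_in x) m = \<rho> x m" "uea_act \<rho> 1 m = m" "uea_act \<rho> 0 m = 0"
    by (simp_all add: uea_act_abs[OF rep] free_act_simps flip: abs_uea_hom)
qed

lemma uea_act_bilinear: "cbilinear (uea_act \<rho>)"
proof (rule cbilinearI)
  fix u x y c
  have "clinear (uea_act \<rho> u)"
    unfolding uea_act_def by (rule free_act_clinear[OF lie_rep_linear])
  then show "uea_act \<rho> u (x + y) = uea_act \<rho> u x + uea_act \<rho> u y"
    "uea_act \<rho> u (c *\<^sub>C x) = c *\<^sub>C uea_act \<rho> u x" by (simp_all add: clinearD)
qed (simp_all add: uea_act_simps)

lemma uea_act_sum: "uea_act \<rho> (\<Sum>i\<in>I. u i) m = (\<Sum>i\<in>I. uea_act \<rho> (u i) m)"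
  by (rule cbilinear_sum(1)[OF uea_act_bilinear])

end

lemma uea_hom_sum_mult:
  fixes \<phi> :: "'v::complex_lie_algebra \<Rightarrow> 'a::unital_complex_algebra"
  assumes "clinear \<phi>" "\<And>x y. \<phi> (lie x y) = \<phi> x * \<phi> y - \<phi> y * \<phi> x"
  shows "uea_hom \<phi> (\<Sum>i\<in>I. uea_in (e i) * uea_in (f i)) = (\<Sum>i\<in>I. \<phi> (e i) * \<phi> (f i))"
proof -
  have rep: "lie_rep (\<lambda>x a. \<phi> x * a)"
    unfolding lie_rep_def cbilinear_def
    by (auto intro!: clinearI simp: assms clinearD[OF assms(1)] distrib_left distrib_right
        left_diff_distrib mult.assoc mult_scaleC_left mult_scaleC_right)
  show "uea_hom \<phi> (\<Sum>i\<in>I. uea_in (e i) * uea_in (f i)) = (\<Sum>i\<in>I. \<phi> (e i) * \<phi> (f i))"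
    by (simp add: uea_hom_def uea_act_simps[OF rep] uea_act_sum[OF rep])
qed

lemma uea_in_linear: "clinear (uea_in :: 'a::complex_lie_algebra \<Rightarrow> _)"
  and uea_in_lie: "uea_in (lie x y) = uea_in x * uea_in y - uea_in y * uea_in (x :: 'a)"
proof -
  have rel: "abs_uea r = 0" if "r \<in> uea_rels" for r :: "'a falg"
    unfolding zero_uea_def using that by (simp add: uea.abs_eq_iff ideal_rel_def gen_ideal_base)
  show "clinear (uea_in :: 'a \<Rightarrow> _)"
  proof (rule clinearI)
    fix x y :: 'a and c
    have "abs_uea (fgen (x + y) - fgen x - fgen y) = 0" "abs_uea (fgen (c *\<^sub>C x) - c *\<^sub>C fgen x) = 0"
      by (intro rel; force simp: uea_rels_def lin_rels_def)+
    then show "uea_in (x + y) = uea_in x + uea_in y" "uea_in (c *\<^sub>C x) = c *\<^sub>C uea_in x"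
      by (simp_all add: abs_uea_hom algebra_simps)
  qed
  have "abs_uea (fgen x * fgen y - fgen y * fgen x - fgen (lie x y)) = 0"
    by (intro rel) (auto simp: uea_rels_def)
  then show "uea_in (lie x y) = uea_in x * uea_in y - uea_in y * uea_in x"
    by (simp add: abs_uea_hom)
qed

lemma uea_induct [case_names one add scale mult]:
  assumes "P 1" "\<And>u v. P u \<Longrightarrow> P v \<Longrightarrow> P (u + v)" "\<And>c u. P u \<Longrightarrow> P (c *\<^sub>C u)"
    "\<And>x u. P u \<Longrightarrow> P (uea_in x * u)"
  shows "P u"
proof -
  have word: "P (abs_uea (prod_list (map fgen w)))" for w
    by (induction w) (use assms in \<open>auto simp: abs_uea_hom\<close>)
  have "P (abs_uea f)" for f
    by (induction f rule: pm_induct) (use assms word in \<open>auto simp: single_fword abs_uea_hom\<close>)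
  moreover obtain f where "u = abs_uea f" using Quotient3_abs_rep[OF Quotient3_uea] by metis
  ultimately show ?thesis by simp
qed

lemma weyl_gen_act_linear: "clinear (weyl_gen_act x)"
  using weyl_gen_act_bilinear by (rule cbilinear_linear)

lemma weyl_act_simps:
  "weyl_act (a + b) P = weyl_act a P + weyl_act b P"
  "weyl_act (c *\<^sub>C a) P = c *\<^sub>C weyl_act a P"
  "weyl_act (a * b) P = weyl_act a (weyl_act b P)"
  "weyl_act (weyl_vec v) P = sym_in v * P"
  "weyl_act (weyl_dual \<alpha>) P = sym_deriv \<alpha> P"
  "weyl_act 1 P = P"
proof -
  obtain f g where fg: "a = abs_weyl f" "b = abs_weyl g"
    using Quotient3_abs_rep[OF Quotient3_weyl] by metis
  show "weyl_act (a + b) P = weyl_act a P + weyl_act b P"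
    "weyl_act (c *\<^sub>C a) P = c *\<^sub>C weyl_act a P"
    "weyl_act (a * b) P = weyl_act a (weyl_act b P)"
    unfolding fg by (simp_all add: weyl_act_abs free_act_simps
        free_act_mult[of weyl_gen_act, OF weyl_gen_act_linear] flip: abs_weyl_hom)
  show "weyl_act (weyl_vec v) P = sym_in v * P" "weyl_act (weyl_dual \<alpha>) P = sym_deriv \<alpha> P"
    "weyl_act 1 P = P"
    by (simp_all add: weyl_act_abs free_act_simps weyl_gen_act_apply
        clinearD(3)[OF sym_in_linear] clinearD(3)[OF sym_deriv_linear_dual] flip: abs_weyl_hom)
qed

lemma weyl_act_bilinear: "cbilinear weyl_act"
proof (rule cbilinearI)
  fix u :: "'a weyl" and x y c
  have "clinear (weyl_act u)"
    unfolding weyl_act_def by (rule free_act_clinear[OF weyl_gen_act_linear])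
  then show "weyl_act u (x + y) = weyl_act u x + weyl_act u y"
    "weyl_act u (c *\<^sub>C x) = c *\<^sub>C weyl_act u x" by (simp_all add: clinearD)
qed (simp_all add: weyl_act_simps)

lemma weyl_act_sum: "weyl_act (\<Sum>i\<in>I. u i) P = (\<Sum>i\<in>I. weyl_act (u i) P)"
  by (rule cbilinear_sum(1)[OF weyl_act_bilinear])

lemma weyl_in_linear: "clinear (weyl_in :: 'a::complex_vector \<times> 'a dual \<Rightarrow> _)"
  and weyl_in_commute: "weyl_in a * weyl_in b = weyl_in b * weyl_in (a :: 'a \<times> 'a dual) + symplectic a b *\<^sub>C 1"
proof -
  have rel: "abs_weyl r = 0" if "r \<in> weyl_rels" for r :: "('a \<times> 'a dual) falg"
    unfolding zero_weyl_def using that by (simp add: weyl.abs_eq_iff ideal_rel_def gen_ideal_base)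
  show "clinear (weyl_in :: 'a \<times> 'a dual \<Rightarrow> _)"
  proof (rule clinearI)
    fix x y :: "'a \<times> 'a dual" and c
    have "abs_weyl (fgen (x + y) - fgen x - fgen y) = 0" "abs_weyl (fgen (c *\<^sub>C x) - c *\<^sub>C fgen x) = 0"
      by (rule rel, unfold weyl_rels_def lin_rels_def, blast)+
    then show "weyl_in (x + y) = weyl_in x + weyl_in y" "weyl_in (c *\<^sub>C x) = c *\<^sub>C weyl_in x"
      by (simp_all add: abs_weyl_hom algebra_simps)
  qed
  have "abs_weyl (fgen a * fgen b - fgen b * fgen a - symplectic a b *\<^sub>C 1) = 0"
    by (rule rel, unfold weyl_rels_def, blast)
  then show "weyl_in a * weyl_in b = weyl_in b * weyl_in a + symplectic a b *\<^sub>C 1"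
    by (simp add: abs_weyl_hom algebra_simps)
qed

lemma weyl_vec_linear: "clinear (weyl_vec :: 'v::complex_vector \<Rightarrow> _)"
proof -
  have "weyl_vec (x + y) = weyl_vec x + weyl_vec y" "weyl_vec (c *\<^sub>C x) = c *\<^sub>C weyl_vec x" for x y :: 'v and c
    by (simp_all add: scaleC_prod_def flip: clinearD(1,2)[OF weyl_in_linear])
  then show ?thesis by (rule clinearI)
qed

context
  fixes \<pi> :: "'g::z2_quadratic_lie_algebra cx \<Rightarrow> 'm \<Rightarrow> 'm::complex_vector"
  assumes rep: "lie_rep \<pi>"
begin

lemma tensor_act_linear: "clinear (\<lambda>t. tensor_act \<pi> t x)"
  and tensor_act_tens: "tensor_act \<pi> (u \<otimes>\<^sub>C w) x = tensor_map (uea_act \<pi> u) (weyl_act w) x"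
proof -
  have bil: "cbilinear (\<lambda>u w. tensor_map (uea_act \<pi> u) (weyl_act w) x)"
    by (rule tensor_map_family_bilinear[OF uea_act_bilinear[OF rep] weyl_act_bilinear])
  show "clinear (\<lambda>t. tensor_act \<pi> t x)"
    unfolding tensor_act_def using tensor_lift_linear[OF bil] by (simp add: tensor_map_def)
  show "tensor_act \<pi> (u \<otimes>\<^sub>C w) x = tensor_map (uea_act \<pi> u) (weyl_act w) x"
    unfolding tensor_act_def using tensor_lift_tens[OF bil] by (simp add: tensor_map_def)
qed

end

section \<open>Sesquilinear forms, their tensor products, and adjoint operators\<close>

section \<open>Forms on tensor products\<close>

text \<open>Conjugate-linearity in the first argument becomes linearity after conjugation, which
  makes facts on \<open>clinear\<close> available on both sides.\<close>

definition sesquilinear :: "('a::complex_vector \<Rightarrow> 'a \<Rightarrow> complex) \<Rightarrow> bool"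
  where "sesquilinear h \<longleftrightarrow> (\<forall>x. clinear (h x)) \<and> (\<forall>y. clinear (\<lambda>x. cnj (h x y)))"

lemma sesquilinearD:
  assumes "sesquilinear h"
  shows "h x (y + z) = h x y + h x z" "h x (c *\<^sub>C y) = c * h x y"
    "h (x + y) z = h x z + h y z" "h (c *\<^sub>C x) y = cnj c * h x y"
proof -
  have 1: "clinear (h x)" and 2: "clinear (\<lambda>x. cnj (h x y))" for x y
    using assms by (auto simp: sesquilinear_def)
  show "h x (y + z) = h x y + h x z" "h x (c *\<^sub>C y) = c * h x y"
    using clinearD(1,2)[OF 1] by (auto simp: scaleC_complex_def)
  show "h (x + y) z = h x z + h y z" "h (c *\<^sub>C x) y = cnj c * h x y"
    using clinearD(1,2)[OF 2] by (metis complex_cnj_add complex_cnj_cnj, metis complex_cnj_mult complex_cnj_cnj scaleC_complex_def)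
qed

lemma sesquilinearI:
  assumes "\<And>x y z. h x (y + z) = h x y + h x z" "\<And>c x y. h x (c *\<^sub>C y) = c * h x y"
    "\<And>x y z. h (x + y) z = h x z + h y z" "\<And>c x y. h (c *\<^sub>C x) y = cnj c * h x y"
  shows "sesquilinear h"
  unfolding sesquilinear_def
  by (intro conjI allI clinearI) (simp_all add: assms scaleC_complex_def)

lemma sesquilinear_sum:
  assumes "sesquilinear h"
  shows "h x (\<Sum>i\<in>I. g i) = (\<Sum>i\<in>I. h x (g i))" "h (\<Sum>i\<in>I. g i) y = (\<Sum>i\<in>I. h (g i) y)"
proof -
  have 1: "clinear (h x)" and 2: "clinear (\<lambda>x. cnj (h x y))" for x y
    using assms by (auto simp: sesquilinear_def)
  show "h x (\<Sum>i\<in>I. g i) = (\<Sum>i\<in>I. h x (g i))" by (rule clinear_sum[OF 1])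
  have "cnj (h (\<Sum>i\<in>I. g i) y) = cnj (\<Sum>i\<in>I. h (g i) y)"
    using clinear_sum[OF 2] by simp
  then show "h (\<Sum>i\<in>I. g i) y = (\<Sum>i\<in>I. h (g i) y)" by (simp only: complex_cnj_cancel_iff)
qed

lemma sesquilinear_minus:
  assumes "sesquilinear h"
  shows "h x (- y) = - h x y" "h (- x) y = - h x y"
  using sesquilinearD(2)[OF assms, of x "- 1" y] sesquilinearD(4)[OF assms, of "- 1" x y]
  by (simp_all add: scaleC_one)

lemma hermitian_form_sesquilinear:
  assumes "hermitian_form h"
  shows "sesquilinear h"
  unfolding sesquilinear_def
proof (intro conjI allI)
  have h: "clinear (h x)" and c: "cnj (h y x) = h x y" for x y
    using assms unfolding hermitian_form_def by metis+
  show "clinear (h x)" for x by (rule h)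
  show "clinear (\<lambda>x. cnj (h x y))" for y by (simp add: c h)
qed

text \<open>A pure tensor fixed on the left leaves a linear function of the right argument. The two
  conjugations in \<open>tensor_form\<close> then adapt the linear extension by
  \<open>tensor_lift\<close> to a conjugate-linear dependence on the left.\<close>

definition tensor_form_slice :: "('a::complex_vector \<Rightarrow> 'a \<Rightarrow> complex) \<Rightarrow> ('b::complex_vector \<Rightarrow> 'b \<Rightarrow> complex)
    \<Rightarrow> 'a \<Rightarrow> 'b \<Rightarrow> ('a, 'b) tensor \<Rightarrow> complex"
  where "tensor_form_slice h g a b = tensor_lift (\<lambda>a' b'. h a a' * g b b')"

lemma tensor_form_slice:
  "tensor_form h g x y = cnj (tensor_lift (\<lambda>a b. cnj (tensor_form_slice h g a b y)) x)"
  by (simp add: tensor_form_def tensor_form_slice_def)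

context
  fixes h :: "'a::complex_vector \<Rightarrow> 'a \<Rightarrow> complex" and g :: "'b::complex_vector \<Rightarrow> 'b \<Rightarrow> complex"
  assumes h: "sesquilinear h" and g: "sesquilinear g"
begin

lemma tensor_form_slice_simps:
  "tensor_form_slice h g a b (c \<otimes>\<^sub>C d) = h a c * g b d"
  "tensor_form_slice h g a b (x + y) = tensor_form_slice h g a b x + tensor_form_slice h g a b y"
  "tensor_form_slice h g a b (k *\<^sub>C x) = k * tensor_form_slice h g a b x"
proof -
  have bil: "cbilinear (\<lambda>a' b'. h a a' * g b b')"
    by (rule cbilinearI) (simp_all add: sesquilinearD[OF h] sesquilinearD[OF g] scaleC_complex_def algebra_simps)
  show "tensor_form_slice h g a b (c \<otimes>\<^sub>C d) = h a c * g b d"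
    "tensor_form_slice h g a b (x + y) = tensor_form_slice h g a b x + tensor_form_slice h g a b y"
    "tensor_form_slice h g a b (k *\<^sub>C x) = k * tensor_form_slice h g a b x"
    unfolding tensor_form_slice_def
    by (simp_all only: tensor_lift_tens[OF bil] clinearD(1,2)[OF tensor_lift_linear[OF bil]] scaleC_complex_def)
qed

lemma tensor_form_slice_bilinear: "cbilinear (\<lambda>a b. cnj (tensor_form_slice h g a b y))"
proof (induction y rule: tensor_induct)
  case (tens a b)
  show ?case
    by (rule cbilinearI) (simp_all add: tensor_form_slice_simps sesquilinearD[OF h] sesquilinearD[OF g]
        scaleC_complex_def algebra_simps)
next
  case (add x y)
  show ?case
    by (rule cbilinearI) (simp_all add: tensor_form_slice_simps cbilinearD[OF add(1)] cbilinearD[OF add(2)]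
        scaleC_complex_def algebra_simps)
qed

lemma tensor_form_left_tens: "tensor_form h g (a \<otimes>\<^sub>C b) y = tensor_form_slice h g a b y"
  unfolding tensor_form_slice by (simp only: tensor_lift_tens[OF tensor_form_slice_bilinear] complex_cnj_cnj)

lemma tensor_form_sesquilinear: "sesquilinear (tensor_form h g)"
proof (rule sesquilinearI)
  fix x y z :: "('a, 'b) tensor" and c
  show add: "tensor_form h g (x + y) z = tensor_form h g x z + tensor_form h g y z" for x y z
    unfolding tensor_form_slice clinearD(1)[OF tensor_lift_linear[OF tensor_form_slice_bilinear]] by simp
  show "tensor_form h g (c *\<^sub>C x) y = cnj c * tensor_form h g x y"
    unfolding tensor_form_slice clinearD(2)[OF tensor_lift_linear[OF tensor_form_slice_bilinear]]
    by (simp add: scaleC_complex_def)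
  show "tensor_form h g x (y + z) = tensor_form h g x y + tensor_form h g x z"
    "tensor_form h g x (c *\<^sub>C y) = c * tensor_form h g x y"
    by (induction x rule: tensor_induct)
      (simp_all add: tensor_form_left_tens tensor_form_slice_simps add algebra_simps)
qed

lemma tensor_form_tens: "tensor_form h g (a \<otimes>\<^sub>C b) (c \<otimes>\<^sub>C d) = h a c * g b d"
  by (simp add: tensor_form_left_tens tensor_form_slice_simps)

text \<open>By additivity it suffices to compare pure tensors, where the form factors.\<close>

lemma tensor_form_adjoint:
  assumes lin: "clinear S" "clinear S'" "clinear R" "clinear R'"
    and adj: "\<And>x y. h (S x) y = h x (S' y)" "\<And>x y. g (R x) y = g x (R' y)"
  shows "tensor_form h g (tensor_map S R x) y = tensor_form h g x (tensor_map S' R' y)"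
proof -
  note D = sesquilinearD(1,3)[OF tensor_form_sesquilinear]
  note L = clinearD(1)[OF tensor_map_linear[OF lin(1,3)]] clinearD(1)[OF tensor_map_linear[OF lin(2,4)]]
  note M = tensor_map_tens[OF lin(1,3)] tensor_map_tens[OF lin(2,4)]
  show ?thesis
  proof (induction x rule: tensor_induct)
    case (tens a b)
    show ?case by (induction y rule: tensor_induct) (simp_all add: D L M tensor_form_tens adj)
  qed (simp add: D L)
qed

end

section \<open>Centrality of the Casimir element of an invariant form\<close>

section \<open>Casimir elements\<close>

lemma clie_bilinear: "cbilinear (lie :: 'a::complex_lie_algebra \<Rightarrow> _)"
  by (rule cbilinearI) (rule clie_add_left clie_scaleC_left clie_add_right clie_scaleC_right)+

lemma clie_anticommute: "lie x y = - lie y (x :: 'a::complex_lie_algebra)"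
proof -
  have "0 = lie (x + y) (x + y)" by (simp add: clie_self)
  also have "\<dots> = lie x y + lie y x"
    by (simp only: clie_add_left clie_add_right clie_self[of x] clie_self[of y]) simp
  finally show ?thesis by (simp add: eq_neg_iff_add_eq_0)
qed

lemma clie_lie: "lie (lie x y) z = lie x (lie y z) - lie y (lie x (z :: 'a::complex_lie_algebra))"
proof -
  have "lie z (lie x y) = - lie (lie x y) z" "lie y (lie z x) = - lie y (lie x z)"
    using clie_anticommute[of z "lie x y"] clie_anticommute[of z x]
    by (simp_all add: cbilinear_minus[OF clie_bilinear])
  then show ?thesis using clie_jacobi[of x y z] by (simp add: algebra_simps)
qed

lemma uea_mult_bilinear: "cbilinear (\<lambda>u v. uea_in u * uea_in v)"
  by (rule cbilinearI) (simp_all add: clinearD[OF uea_in_linear] distrib_left distrib_right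
      mult_scaleC_left mult_scaleC_right)

locale invariant_form = nondegenerate_bilinear B
  for B :: "'v::complex_lie_algebra \<Rightarrow> 'v \<Rightarrow> complex" +
  assumes invariant: "B (lie x y) z = B x (lie y z)"
begin

text \<open>Invariance makes \<open>lie x\<close> skew for \<open>B\<close>, so the two families of
  terms from the Leibniz rule cancel.\<close>

lemma casimir_commute_gen:
  assumes "cbasis b"
  shows "casimir B b * uea_in x = uea_in x * casimir B b"
proof -
  let ?d = "dual_elt B b"
  have fr: "dual_bases b (\<lambda>w. w) ?d" by (rule dual_bases_dual_elt[OF assms])
  note bil = uea_mult_bilinear
  have "(\<Sum>w\<in>b. uea_in w * uea_in (lie x (?d w))) =
      (\<Sum>w\<in>b. \<Sum>u\<in>b. B (lie x (?d w)) u *\<^sub>C (uea_in w * uea_in (?d u)))"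
    by (simp add: dual_bases_expand(2)[OF fr cbilinear_linear(1)[OF bil]])
  \<comment> \<open>Skewness moves \<open>lie x\<close> from the dual vectors to the basis vectors,
    and the sum over \<open>w\<close> then collapses.\<close>
  also have "\<dots> = (\<Sum>u\<in>b. \<Sum>w\<in>b. B (- lie x u) (?d w) *\<^sub>C (uea_in w * uea_in (?d u)))"
  proof (subst sum.swap, intro sum.cong refl)
    fix u w
    have "B (lie x (?d w)) u = - B (lie (?d w) x) u"
      by (subst clie_anticommute) (simp add: cbilinear_minus[OF bilinear])
    also have "\<dots> = B (- lie x u) (?d w)"
      by (simp add: invariant sym[of "?d w"] cbilinear_minus[OF bilinear])
    finally show "B (lie x (?d w)) u *\<^sub>C (uea_in w * uea_in (?d u)) =
      B (- lie x u) (?d w) *\<^sub>C (uea_in w * uea_in (?d u))" by simp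
  qed
  also have "\<dots> = - (\<Sum>u\<in>b. uea_in (lie x u) * uea_in (?d u))"
    by (simp only: dual_bases_expand(1)[OF fr cbilinear_linear(2)[OF bil]])
      (simp add: cbilinear_minus[OF bil] sum_negf)
  finally have "(\<Sum>w\<in>b. uea_in (lie x w) * uea_in (?d w) + uea_in w * uea_in (lie x (?d w))) = 0"
    by (simp add: sum.distrib)
  \<comment> \<open>By the Leibniz rule each summand is the commutator of \<open>x\<close> with one
    term of the Casimir element.\<close>
  then have "(\<Sum>w\<in>b. uea_in x * (uea_in w * uea_in (?d w)) - uea_in w * uea_in (?d w) * uea_in x) = 0"
    by (simp add: uea_in_lie left_diff_distrib right_diff_distrib mult.assoc)
  then show ?thesis
    by (simp add: casimir_def sum_subtractf sum_distrib_left sum_distrib_right)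
qed

lemma casimir_commute:
  assumes "cbasis b"
  shows "casimir B b * u = u * casimir B b"
proof (induction u rule: uea_induct)
  case (mult x u)
  have "casimir B b * (uea_in x * u) = uea_in x * (casimir B b * u)"
    by (simp add: casimir_commute_gen[OF assms] flip: mult.assoc)
  then show ?case by (simp add: mult mult.assoc)
qed (simp_all add: distrib_left distrib_right mult_scaleC_left mult_scaleC_right)

lemma casimir_in_center: "cbasis b \<Longrightarrow> casimir B b \<in> center"
  by (simp add: center_def casimir_commute)

end

section \<open>Nondegeneracy and invariance of the complexified forms on \<open>g\<close>,
  \<open>k\<close> and \<open>p\<close>\<close>

section \<open>The forms on the graded pieces\<close>

context
  fixes \<beta> :: "'a::real_vector \<Rightarrow> 'a \<Rightarrow> real"
  assumes add: "\<And>x y z. \<beta> (x + y) z = \<beta> x z + \<beta> y z"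
    and scale: "\<And>r x y. \<beta> (r *\<^sub>R x) y = r * \<beta> x y"
    and sym: "\<And>x y. \<beta> x y = \<beta> y x"
begin

lemma real_form_simps:
  "\<beta> (x + y) z = \<beta> x z + \<beta> y z" "\<beta> (r *\<^sub>R x) z = r * \<beta> x z"
  "\<beta> (x - y) z = \<beta> x z - \<beta> y z" "\<beta> (- x) z = - \<beta> x z" "\<beta> 0 z = 0"
  "\<beta> z (x + y) = \<beta> z x + \<beta> z y" "\<beta> z (r *\<^sub>R x) = r * \<beta> z x"
  "\<beta> z (x - y) = \<beta> z x - \<beta> z y" "\<beta> z (- x) = - \<beta> z x" "\<beta> z 0 = 0"
proof -
  show *: "\<beta> (x + y) z = \<beta> x z + \<beta> y z" "\<beta> (r *\<^sub>R x) z = r * \<beta> x z"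
    "\<beta> (x - y) z = \<beta> x z - \<beta> y z" "\<beta> (- x) z = - \<beta> x z" "\<beta> 0 z = 0" for x y z r
    using add[of x y z] scale[of r x z] add[of x "- y" z] scale[of "- 1" y z] scale[of "- 1" x z]
      scale[of 0 x z] by simp_all
  show "\<beta> z (x + y) = \<beta> z x + \<beta> z y" "\<beta> z (r *\<^sub>R x) = r * \<beta> z x"
    "\<beta> z (x - y) = \<beta> z x - \<beta> z y" "\<beta> z (- x) = - \<beta> z x" "\<beta> z 0 = 0"
    by (simp_all add: sym[of z] *)
qed

lemma cx_form_conj: "cx_form \<beta> (cx_conj u) (cx_conj v) = cnj (cx_form \<beta> u v)"
  by (simp add: cx_form_def cx_conj_def real_form_simps complex_eq_iff)

lemma nondegenerate_bilinear_cx_form: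
  assumes nondeg: "\<And>x. (\<And>y. \<beta> x y = 0) \<Longrightarrow> x = 0"
  shows "nondegenerate_bilinear (cx_form \<beta>)"
proof
  fix x y z :: "'a cx" and c
  show "cx_form \<beta> x (y + z) = cx_form \<beta> x y + cx_form \<beta> x z"
    "cx_form \<beta> x (c *\<^sub>C y) = c * cx_form \<beta> x y"
    by (simp_all add: cx_form_def cx_defs real_form_simps complex_eq_iff algebra_simps)
  show "cx_form \<beta> x y = cx_form \<beta> y x"
    by (simp add: cx_form_def sym[of "re_part x"] sym[of "im_part x"])
  assume zero: "\<And>y. cx_form \<beta> x y = 0"
  \<comment> \<open>Pairing with a real vector \<open>y\<close> tests \<open>re_part x\<close> and
    \<open>im_part x\<close> separately.\<close>
  have "\<beta> (re_part x) y = 0" "\<beta> (im_part x) y = 0" for y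
    using zero[of "Cx y 0"] by (simp_all add: cx_form_def real_form_simps complex_eq_iff)
  then show "x = 0" using nondeg by (cases x) (simp add: zero_cx_def)
qed

end

lemmas qform_simps = real_form_simps[OF qform_add_left qform_scaleR_left qform_sym]

lemma qform_k_rules:
  fixes x y z :: "'g::z2_quadratic_lie_algebra kpart"
  shows "qform_k (x + y) z = qform_k x z + qform_k y z" "qform_k (r *\<^sub>R x) y = r * qform_k x y"
    "qform_k x y = qform_k y x"
  by (transfer; simp add: qform_simps; fail | transfer; rule qform_sym)+

lemma qform_p_rules:
  fixes x y z :: "'g::z2_quadratic_lie_algebra ppart"
  shows "qform_p (x + y) z = qform_p x z + qform_p y z" "qform_p (r *\<^sub>R x) y = r * qform_p x y"
    "qform_p x y = qform_p y x"
  by (transfer; simp add: qform_simps; fail | transfer; rule qform_sym)+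

text \<open>As \<open>k0\<close> and \<open>p0\<close> are orthogonal and together span, a vector of
  \<open>k0\<close> orthogonal to \<open>k0\<close> is orthogonal to everything.\<close>

lemma qform_k_nondegenerate:
  fixes x :: "'g::z2_quadratic_lie_algebra kpart"
  assumes "\<And>y. qform_k x y = 0"
  shows "x = 0"
proof -
  have "qform (kpart_val x) v = 0" for v
  proof -
    obtain y z where v: "y \<in> k0" "z \<in> p0" "v = y + z" using k0_plus_p0[of v] by blast
    have "qform (kpart_val x) y = 0"
      using assms[of "Abs_kpart y"] v(1) by (simp add: qform_k.rep_eq Abs_kpart_inverse)
    moreover have "qform (kpart_val x) z = 0" using kpart_val v(2) by (rule qform_k0_p0)
    ultimately show ?thesis by (simp add: v(3) qform_simps)
  qed
  then have "kpart_val x = 0" by (rule qform_nondegenerate)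
  then show ?thesis by (simp add: zero_kpart.rep_eq flip: kpart_val_inject)
qed

text \<open>By positivity, a nonzero vector of \<open>p0\<close> does not even annihilate
  itself.\<close>

lemma qform_p_nondegenerate:
  fixes x :: "'g::z2_quadratic_lie_algebra ppart"
  assumes "\<And>y. qform_p x y = 0"
  shows "x = 0"
proof (rule ccontr)
  assume "x \<noteq> 0"
  then have "ppart_val x \<noteq> 0" by (simp add: zero_ppart.rep_eq flip: ppart_val_inject)
  then show False using qform_p0_pos[OF ppart_val, of x] assms[of x] by (simp add: qform_p.rep_eq)
qed

lemma qform_k_invariant: "qform_k (lie x y) z = qform_k x (lie y z)"
  by transfer (rule qform_invariant)

lemma invariant_form_cx_form:
  fixes \<beta> :: "'a::real_lie_algebra \<Rightarrow> 'a \<Rightarrow> real"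
  assumes "\<And>x y z. \<beta> (x + y) z = \<beta> x z + \<beta> y z" "\<And>r x y. \<beta> (r *\<^sub>R x) y = r * \<beta> x y"
    "\<And>x y. \<beta> x y = \<beta> y x" "\<And>x. (\<And>y. \<beta> x y = 0) \<Longrightarrow> x = 0"
    and inv: "\<And>x y z. \<beta> (lie x y) z = \<beta> x (lie y z)"
  shows "invariant_form (cx_form \<beta>)"
proof -
  interpret nondegenerate_bilinear "cx_form \<beta>"
    by (rule nondegenerate_bilinear_cx_form) (rule assms)+
  note simps = real_form_simps[OF assms(1-3)]
  show ?thesis
    by unfold_locales
      (simp add: cx_form_def lie_cx_def cx_bilin_def simps inv complex_eq_iff)
qed

interpretation Bg: invariant_form "cx_form qform :: 'g::z2_quadratic_lie_algebra cx \<Rightarrow> _"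
  by (rule invariant_form_cx_form)
    (rule qform_add_left qform_scaleR_left qform_sym qform_invariant | erule qform_nondegenerate)+

interpretation Bk: invariant_form "cx_form qform_k :: 'g::z2_quadratic_lie_algebra kpart cx \<Rightarrow> _"
  by (rule invariant_form_cx_form)
    (rule qform_k_rules qform_k_invariant | erule qform_k_nondegenerate)+

interpretation Bp: nondegenerate_bilinear "cx_form qform_p :: 'g::z2_quadratic_lie_algebra ppart cx \<Rightarrow> _"
  by (rule nondegenerate_bilinear_cx_form) (rule qform_p_rules | erule qform_p_nondegenerate)+

section \<open>Embeddings of \<open>k\<close> and \<open>p\<close> into \<open>g\<close>,
  compatibility with the grading, and complex conjugation\<close>

lemma k_incl_linear: "clinear (k_incl :: 'g::z2_quadratic_lie_algebra kpart cx \<Rightarrow> _)"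
  and p_incl_linear: "clinear (p_incl :: 'g ppart cx \<Rightarrow> _)"
  by (rule clinearI; simp add: cx_defs cx.map_sel plus_kpart.rep_eq minus_kpart.rep_eq scaleR_kpart.rep_eq
      plus_ppart.rep_eq minus_ppart.rep_eq scaleR_ppart.rep_eq)+

lemma form_incl:
  fixes a b :: "'g::z2_quadratic_lie_algebra kpart cx" and u v :: "'g ppart cx"
  shows "cx_form qform (k_incl a) (k_incl b) = cx_form qform_k a b"
    "cx_form qform (p_incl u) (p_incl v) = cx_form qform_p u v"
    "cx_form qform (k_incl a) (p_incl u) = 0"
  by (simp_all add: cx_form_def cx.map_sel qform_k.rep_eq qform_p.rep_eq
      qform_k0_p0[OF kpart_val ppart_val] complex_eq_iff)

text \<open>The third identity records that brackets of \<open>p\<close> with itself lie in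
  \<open>k\<close>, in the form of orthogonality to \<open>p\<close>.\<close>

lemma lie_incl:
  fixes a b :: "'g::z2_quadratic_lie_algebra kpart cx" and u v w :: "'g ppart cx"
  shows "lie (k_incl a) (k_incl b) = k_incl (lie a b)"
    "lie (k_incl a) (p_incl u) = p_incl (cx_bilin kp_lie a u)"
    "cx_form qform (lie (p_incl u) (p_incl v)) (p_incl w) = 0"
  by (simp_all add: lie_cx_def cx_bilin_def cx_form_def cx.map_sel lie_kpart.rep_eq minus_kpart.rep_eq
      plus_kpart.rep_eq kp_lie.rep_eq minus_ppart.rep_eq plus_ppart.rep_eq qform_simps complex_eq_iff
      qform_k0_p0[OF lie_p0_p0[OF ppart_val ppart_val] ppart_val])

lemma p_incl_inj: "p_incl u = p_incl v \<Longrightarrow> u = v"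
  by (cases u; cases v) (simp add: ppart_val_inject)

lemma cx_decompose:
  fixes x :: "'g::z2_quadratic_lie_algebra cx"
  obtains a u where "x = k_incl a + p_incl u"
proof -
  have "\<exists>y z. v = kpart_val y + ppart_val z" for v :: 'g
    using k0_plus_p0[of v] Abs_kpart_inverse Abs_ppart_inverse by metis
  then obtain y z y' z' where "re_part x = kpart_val y + ppart_val z" "im_part x = kpart_val y' + ppart_val z'"
    by metis
  then have "x = k_incl (Cx y y') + p_incl (Cx z z')" by (cases x) (simp add: plus_cx_def)
  then show ?thesis by (rule that)
qed

text \<open>Inside \<open>g\<close> the action of \<open>k\<close> on \<open>p\<close> is the
  bracket, and injectivity of \<open>p_incl\<close> brings the identities back.\<close>

lemma cx_bilin_kp_lie_bilinear: "cbilinear (cx_bilin (kp_lie :: 'g::z2_quadratic_lie_algebra kpart \<Rightarrow> _))"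
proof (rule cbilinearI)
  note S = clinearD(1,2)[OF k_incl_linear] clinearD(1,2)[OF p_incl_linear]
  fix x y :: "'g kpart cx" and u v :: "'g ppart cx" and c
  show "cx_bilin kp_lie (x + y) u = cx_bilin kp_lie x u + cx_bilin kp_lie y u"
    "cx_bilin kp_lie (c *\<^sub>C x) u = c *\<^sub>C cx_bilin kp_lie x u"
    "cx_bilin kp_lie x (u + v) = cx_bilin kp_lie x u + cx_bilin kp_lie x v"
    "cx_bilin kp_lie x (c *\<^sub>C u) = c *\<^sub>C cx_bilin kp_lie x u"
    by (rule p_incl_inj; simp add: S clie_add_left clie_add_right clie_scaleC_left clie_scaleC_right
        flip: lie_incl(2))+
qed

lemma cx_bilin_kp_lie_lie:
  "cx_bilin kp_lie (lie x y) u = cx_bilin kp_lie x (cx_bilin kp_lie y u) - cx_bilin kp_lie y (cx_bilin kp_lie x u)"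
  by (rule p_incl_inj) (simp add: clinearD(5)[OF p_incl_linear] clie_lie flip: lie_incl(1,2))

lemma cx_conj_conj [simp]: "cx_conj (cx_conj x) = x"
  by (simp add: cx_conj_def)

lemma cx_conj_sum: "cx_conj (\<Sum>i\<in>I. f i) = (\<Sum>i\<in>I. cx_conj (f i))"
proof -
  have "cx_conj 0 = (0 :: 'a cx)" by (simp add: cx_conj_def zero_cx_def)
  then show ?thesis
    by (induction I rule: infinite_finite_induct) (simp_all add: cx_conj_simps)
qed

lemma incl_conj: "k_incl (cx_conj a) = cx_conj (k_incl a)" "p_incl (cx_conj u) = cx_conj (p_incl u)"
  by (simp_all add: cx_conj_def cx.map_sel uminus_kpart.rep_eq uminus_ppart.rep_eq)

text \<open>Expanding the conjugate of \<open>v\<close> and conjugating back expands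
  \<open>v\<close>, because conjugation is an involution that conjugates the values of
  \<open>B\<close>. Taking adjoints produces such conjugated families.\<close>

lemma dual_bases_conj:
  assumes "nondegenerate_bilinear B" "\<And>u v. B (cx_conj u) (cx_conj v) = cnj (B u v)"
    and "nondegenerate_bilinear.dual_bases B I e f"
  shows "nondegenerate_bilinear.dual_bases B I (\<lambda>i. cx_conj (e i)) (\<lambda>i. cx_conj (f i))"
proof -
  interpret nondegenerate_bilinear B by fact
  show ?thesis unfolding dual_bases_def
  proof
    fix v
    have "B v (cx_conj (f i)) = cnj (B (cx_conj v) (f i))" for i
      using assms(2)[of "cx_conj v" "f i"] by simp
    then have "(\<Sum>i\<in>I. B v (cx_conj (f i)) *\<^sub>C cx_conj (e i)) = cx_conj (\<Sum>i\<in>I. B (cx_conj v) (f i) *\<^sub>C e i)"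
      by (simp add: cx_conj_sum cx_conj_simps)
    then show "(\<Sum>i\<in>I. B v (cx_conj (f i)) *\<^sub>C cx_conj (e i)) = v"
      using assms(3) by (simp add: dual_bases_def)
  qed
qed

lemmas Bk_dual_bases_conj = dual_bases_conj[OF Bk.nondegenerate_bilinear_axioms cx_form_conj[OF qform_k_rules]]
lemmas Bp_dual_bases_conj = dual_bases_conj[OF Bp.nondegenerate_bilinear_axioms cx_form_conj[OF qform_p_rules]]

text \<open>By orthogonality, dual families on \<open>k\<close> and \<open>p\<close> together expand
  every vector of \<open>g\<close>. As \<open>bg\<close> is arbitrary, its elements are first
  expanded along this adapted family, and the sum over \<open>bg\<close> is then collected.\<close>

lemma casimir_g_decompose:
  fixes bg :: "'g::z2_quadratic_lie_algebra cx set"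
  assumes "cbasis bg" and k: "Bk.dual_bases I e f" and p: "Bp.dual_bases J z w"
  shows "casimir_g bg = (\<Sum>i\<in>I. uea_in (k_incl (e i)) * uea_in (k_incl (f i)))
    + (\<Sum>j\<in>J. uea_in (p_incl (z j)) * uea_in (p_incl (w j)))"
proof -
  let ?d = "dual_elt (cx_form qform) bg"
  note fr = Bg.dual_bases_dual_elt[OF assms(1)]
  note bil = uea_mult_bilinear
  let ?S = "\<lambda>v. (\<Sum>i\<in>I. cx_form qform v (k_incl (f i)) *\<^sub>C k_incl (e i))
    + (\<Sum>j\<in>J. cx_form qform v (p_incl (w j)) *\<^sub>C p_incl (z j))"
  have S: "?S v = v" for v
  proof -
    obtain a u where v: "v = k_incl a + p_incl u" by (rule cx_decompose)
    have "cx_form qform v (k_incl b) = cx_form qform_k a b"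
      "cx_form qform v (p_incl q) = cx_form qform_p u q" for b q
      using form_incl(3)[of b u] by (simp_all add: v cbilinearD[OF Bg.bilinear] form_incl Bg.sym[of "p_incl u"])
    then show ?thesis
      by (simp add: v Bk.dual_bases_expand(1)[OF k k_incl_linear] Bp.dual_bases_expand(1)[OF p p_incl_linear])
  qed
  have "casimir_g bg = (\<Sum>b\<in>bg. uea_in (?S b) * uea_in (?d b))"
    unfolding S by (simp add: casimir_def)
  also have "\<dots> = (\<Sum>b\<in>bg. \<Sum>i\<in>I. cx_form qform (k_incl (f i)) b *\<^sub>C (uea_in (k_incl (e i)) * uea_in (?d b)))
    + (\<Sum>b\<in>bg. \<Sum>j\<in>J. cx_form qform (p_incl (w j)) b *\<^sub>C (uea_in (p_incl (z j)) * uea_in (?d b)))"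
    by (simp add: cbilinearD(1,2)[OF bil] cbilinear_sum(1)[OF bil] sum.distrib Bg.sym[of "k_incl _"] Bg.sym[of "p_incl _"])
  also have "\<dots> = (\<Sum>i\<in>I. \<Sum>b\<in>bg. cx_form qform (k_incl (f i)) b *\<^sub>C (uea_in (k_incl (e i)) * uea_in (?d b)))
    + (\<Sum>j\<in>J. \<Sum>b\<in>bg. cx_form qform (p_incl (w j)) b *\<^sub>C (uea_in (p_incl (z j)) * uea_in (?d b)))"
    by (intro arg_cong2[where f = "(+)"] sum.swap)
  also have "\<dots> = (\<Sum>i\<in>I. uea_in (k_incl (e i)) * uea_in (k_incl (f i)))
    + (\<Sum>j\<in>J. uea_in (p_incl (z j)) * uea_in (p_incl (w j)))"
    by (simp add: Bg.dual_bases_expand(2)[OF fr cbilinear_linear(1)[OF bil]])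
  finally show ?thesis .
qed

text \<open>By invariance the coefficients are minus the pairings of the bracket of \<open>u\<close>
  and \<open>v\<close> with the members of \<open>f\<close>. Since this bracket lies in
  \<open>k\<close>, the sum is its expansion there. A general linear \<open>g\<close> lets the
  identity be used under a representation.\<close>

lemma p_bracket_expand:
  fixes g :: "'g::z2_quadratic_lie_algebra cx \<Rightarrow> 'b::complex_vector"
  assumes k: "Bk.dual_bases I e f" and g: "clinear g"
  shows "(\<Sum>i\<in>I. cx_form qform_p u (cx_bilin kp_lie (f i) v) *\<^sub>C g (k_incl (e i))) = - g (lie (p_incl u) (p_incl v))"
proof -
  obtain a q where d: "lie (p_incl u) (p_incl v) = k_incl a + p_incl q" by (rule cx_decompose)
  \<comment> \<open>The bracket and its \<open>k\<close>-component are both orthogonal to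
    \<open>p\<close>, hence so is \<open>q\<close>, which must then vanish.\<close>
  have "cx_form qform_p q y = 0" for y
    using lie_incl(3)[of u v y] by (simp add: d cbilinearD[OF Bg.bilinear] form_incl)
  then have q: "q = 0" by (rule Bp.nondegenerate)
  then have d: "lie (p_incl u) (p_incl v) = k_incl a" using d by (simp add: clinearD(3)[OF p_incl_linear])
  have "cx_form qform_p u (cx_bilin kp_lie c v) = - cx_form qform_k a c" for c
  proof -
    have "cx_form qform_p u (cx_bilin kp_lie c v) = cx_form qform (p_incl u) (- lie (p_incl v) (k_incl c))"
      by (subst clie_anticommute[symmetric]) (simp add: lie_incl form_incl)
    also have "\<dots> = - cx_form qform (lie (p_incl u) (p_incl v)) (k_incl c)"
      by (simp add: cbilinear_minus[OF Bg.bilinear] Bg.invariant)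
    finally show ?thesis by (simp add: d form_incl)
  qed
  then show ?thesis
    by (simp add: d sum_negf Bk.dual_bases_expand(1)[OF k clinear_comp[OF g k_incl_linear]])
qed

section \<open>Constant-coefficient operators on \<open>S(p)\<close> and adjoints for the polynomial
  form\<close>

section \<open>The form on polynomials\<close>

lemma sym_induct [case_names one add scale mult]:
  assumes "P 1" "\<And>u v. P u \<Longrightarrow> P v \<Longrightarrow> P (u + v)" "\<And>c u. P u \<Longrightarrow> P (c *\<^sub>C u)"
    "\<And>x u. P u \<Longrightarrow> P (sym_in x * u)"
  shows "P u"
proof -
  have word: "P (prod_list (map sym_in w))" for w
    by (induction w) (use assms in auto)
  have "P (abs_sym f)" for f
    by (induction f rule: pm_induct) (use assms word in \<open>auto simp: abs_sym_single abs_sym_hom\<close>)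
  moreover obtain f where "u = abs_sym f" using Quotient3_abs_rep[OF Quotient3_sym] by metis
  ultimately show ?thesis by simp
qed

lemma sym_deriv_one: "sym_deriv \<alpha> 1 = 0"
  using sym_deriv_mult[of \<alpha> 1 1] by simp

lemmas sym_deriv_simps = clinearD[OF sym_deriv_linear] sym_deriv_one sym_deriv_mult sym_deriv_in mult_scaleC_left

lemma p_flat_app: "dual_app (p_flat v) u = cx_form qform_p v u"
  by (simp add: p_flat.rep_eq)

lemma p_flat_linear: "clinear p_flat"
  by (rule clinearI)
    (simp_all add: p_flat_app plus_dual.rep_eq scaleC_dual.rep_eq cbilinearD[OF Bp.bilinear] scaleC_complex_def
      fun_eq_iff flip: dual_app_inject)

lemma sym_conj_simps:
  "sym_conj (P + Q) = sym_conj P + sym_conj Q" "sym_conj (c *\<^sub>C P) = cnj c *\<^sub>C sym_conj P"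
  "sym_conj (P * Q) = sym_conj P * sym_conj Q" "sym_conj (sym_in v) = sym_in (cx_conj v)"
  "sym_conj 1 = 1"
proof -
  obtain f g where fg: "P = abs_sym f" "Q = abs_sym g"
    using Quotient3_abs_rep[OF Quotient3_sym] by metis
  show "sym_conj (P + Q) = sym_conj P + sym_conj Q" "sym_conj (c *\<^sub>C P) = cnj c *\<^sub>C sym_conj P"
    "sym_conj (P * Q) = sym_conj P * sym_conj Q"
    unfolding fg by (simp_all add: sym_conj.abs_eq free_conj_simps free_conj_scaleC free_conj_mult
        flip: abs_sym_hom)
  show "sym_conj (sym_in v) = sym_in (cx_conj v)" "sym_conj 1 = 1"
    by (simp_all add: sym_in.abs_eq one_sym.abs_eq sym_conj.abs_eq free_conj_simps single_fword)
      (simp add: free_conj_simps flip: single_one zero_fword_def)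
qed

text \<open>Conjugation is multiplicative, so the product rule reduces the claim to generators,
  where it is the conjugation rule for the form.\<close>

lemma sym_conj_deriv: "sym_conj (sym_deriv (p_flat v) P) = sym_deriv (p_flat (cx_conj v)) (sym_conj P)"
  by (induction P rule: sym_induct)
    (simp_all add: sym_conj_simps sym_deriv_simps p_flat_app scaleC_zero_left
      cx_form_conj[OF qform_p_rules] clinearD(3)[OF sym_deriv_linear] sym_conj_simps(2)[of 0, simplified])

lemma const_diff_op_simps:
  "const_diff_op (P + Q) R = const_diff_op P R + const_diff_op Q R"
  "const_diff_op (c *\<^sub>C P) R = c *\<^sub>C const_diff_op P R"
  "const_diff_op (sym_in v * P) R = sym_deriv (p_flat v) (const_diff_op P R)"
  "const_diff_op 1 R = R" "const_diff_op 0 R = 0"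
  "const_diff_op P (R + S) = const_diff_op P R + const_diff_op P S"
  "const_diff_op P (c *\<^sub>C R) = c *\<^sub>C const_diff_op P R"
proof -
  obtain f g where fg: "P = abs_sym f" "Q = abs_sym g"
    using Quotient3_abs_rep[OF Quotient3_sym] by metis
  show "const_diff_op (P + Q) R = const_diff_op P R + const_diff_op Q R"
    "const_diff_op (c *\<^sub>C P) R = c *\<^sub>C const_diff_op P R"
    "const_diff_op (sym_in v * P) R = sym_deriv (p_flat v) (const_diff_op P R)"
    unfolding fg by (simp_all add: const_diff_op_abs free_act_simps
        free_act_mult[of "\<lambda>v. sym_deriv (p_flat v)", OF sym_deriv_linear] flip: abs_sym_hom)
  show "const_diff_op 1 R = R" "const_diff_op 0 R = 0"
    by (simp_all add: const_diff_op_abs free_act_simps flip: abs_sym_hom)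
  have "clinear (const_diff_op P)"
    unfolding const_diff_op_def by (rule free_act_clinear[OF sym_deriv_linear])
  then show "const_diff_op P (R + S) = const_diff_op P R + const_diff_op P S"
    "const_diff_op P (c *\<^sub>C R) = c *\<^sub>C const_diff_op P R" by (simp_all add: clinearD)
qed

lemma const_diff_op_deriv: "const_diff_op Q (sym_deriv \<alpha> R) = sym_deriv \<alpha> (const_diff_op Q R)"
  by (induction Q rule: sym_induct)
    (simp_all add: const_diff_op_simps clinearD[OF sym_deriv_linear] sym_deriv_commute)

text \<open>Moving a multiplication past a constant-coefficient operator differentiates the symbol
  \<open>Q\<close>. In the induction, symmetry of the form matches the contraction of
  \<open>v\<close> with \<open>u\<close> on both sides.\<close>

lemma const_diff_op_mult:
  "const_diff_op Q (sym_in u * R) = sym_in u * const_diff_op Q R + const_diff_op (sym_deriv (p_flat u) Q) R"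
proof (induction Q rule: sym_induct)
  case (mult v Q)
  have "cx_form qform_p v u = cx_form qform_p u v" by (rule Bp.sym)
  then show ?case
    by (simp add: const_diff_op_simps mult sym_deriv_simps p_flat_app)
qed (simp_all add: const_diff_op_simps sym_deriv_simps distrib_left mult_scaleC_right scaleC_add_right)

text \<open>The last identity makes the first term of \<open>const_diff_op_mult\<close> vanish at
  the origin.\<close>

lemma sym_eval0_simps:
  "sym_eval0 (P + Q) = sym_eval0 P + sym_eval0 Q" "sym_eval0 (c *\<^sub>C P) = c * sym_eval0 P"
  "sym_eval0 (sym_in v * P) = 0"
proof -
  show *: "sym_eval0 (P + Q) = sym_eval0 P + sym_eval0 Q" "sym_eval0 (c *\<^sub>C P) = c * sym_eval0 P" for P Q :: "'a sym" and c
    by (transfer; simp add: free_lin_simps free_lin_scaleC scaleC_complex_def)+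
  obtain f where f: "P = abs_sym f" using Quotient3_abs_rep[OF Quotient3_sym] by metis
  have "free_lin (\<lambda>w. if w = [] then 1 else 0 :: complex) (fgen v * f) = 0"
    by (induction f rule: pm_induct) (simp_all add: distrib_left free_lin_simps fgen_def mult_single)
  then show "sym_eval0 (sym_in v * P) = 0"
    by (simp add: f sym_in.abs_eq times_sym.abs_eq sym_eval0.abs_eq)
qed

lemma poly_form_sesquilinear: "sesquilinear poly_form"
  by (rule sesquilinearI) (simp_all add: poly_form_def sym_conj_simps const_diff_op_simps sym_eval0_simps)

text \<open>For multiplication, \<open>const_diff_op_mult\<close> leaves at the origin only the term
  with the differentiated symbol. For differentiation, constant-coefficient operators commute, so
  the derivative joins the symbol \<open>Q\<close> as a factor.\<close>

lemma poly_form_adjoint: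
  "poly_form (sym_in v * P) Q = poly_form P (sym_deriv (p_flat (cx_conj v)) Q)"
  "poly_form (sym_deriv (p_flat v) P) Q = poly_form P (sym_in (cx_conj v) * Q)"
  by (simp_all add: poly_form_def sym_conj_simps sym_conj_deriv const_diff_op_mult const_diff_op_deriv
      const_diff_op_simps sym_eval0_simps)

lemma star_invariant_apply:
  assumes "star_invariant \<pi> h" "lie_rep \<pi>"
  shows "h (\<pi> x m) m' = h m (\<pi> (- cx_conj x) m')"
proof -
  have "uea_star (uea_in x) = uea_in (- cx_conj x)"
    by (simp add: uea_in.abs_eq uea_star.abs_eq free_star_simps)
  then show ?thesis
    using assms(1) uea_act_simps(4)[OF assms(2)] unfolding star_invariant_def by metis
qed

section \<open>Normal ordering in the Weyl algebra and the bracket relation for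
  \<open>nu\<close>\<close>

section \<open>The homomorphism into the Weyl algebra\<close>

lemma mult_left_linear: "clinear (\<lambda>P. sym_in v * P)"
  by (rule clinearI) (simp_all add: distrib_left mult_scaleC_right)

lemma mult_bilinear: "cbilinear (\<lambda>v P. sym_in v * P)"
  by (rule cbilinearI) (simp_all add: clinearD[OF sym_in_linear] distrib_left distrib_right
      mult_scaleC_right mult_scaleC_left)

lemma deriv_bilinear: "cbilinear (\<lambda>v P. sym_deriv (p_flat v) P)"
  unfolding cbilinear_def
  using clinear_comp[OF sym_deriv_linear_dual p_flat_linear] sym_deriv_linear by blast

text \<open>The functional dual to \<open>z\<close> is pairing with the \<open>B\<close>-dual vector
  of \<open>z\<close>. Thus \<open>Dminus\<close> is a sum over the same dual families as
  \<open>Dplus\<close>, and basis independence applies to both.\<close>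

lemma dual_basis_elt_p_flat:
  assumes "cbasis bp" "z \<in> bp"
  shows "dual_basis_elt bp z = p_flat (dual_elt (cx_form qform_p) bp z)"
  using Bp.representation_dual_elt[OF assms]
  by (simp add: dual_basis_elt_app[OF assms(1)] p_flat_app Bp.sym fun_eq_iff flip: dual_app_inject)

text \<open>Normal ordering: moving \<open>weyl_dual \<alpha>\<close> to the right past
  \<open>weyl_vec b\<close> costs a contraction.\<close>

lemma weyl_product:
  "weyl_vec a * weyl_dual \<alpha> * (weyl_vec b * weyl_dual \<beta>) =
     weyl_vec a * weyl_vec b * (weyl_dual \<alpha> * weyl_dual \<beta>) + dual_app \<alpha> b *\<^sub>C (weyl_vec a * weyl_dual \<beta>)"
  "weyl_vec a * weyl_vec b = weyl_vec b * weyl_vec a" "weyl_dual \<alpha> * weyl_dual \<beta> = weyl_dual \<beta> * weyl_dual \<alpha>"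
proof -
  have 0: "dual_app 0 v = 0" for v :: 'a by (simp add: zero_dual.rep_eq)
  note D = clinearD(3)[OF dual_app_linear]
  have "weyl_dual \<alpha> * weyl_vec b = weyl_vec b * weyl_dual \<alpha> + dual_app \<alpha> b *\<^sub>C 1"
    using weyl_in_commute[of "(0, \<alpha>)" "(b, 0)"] by (simp add: 0)
  then have "weyl_vec a * (weyl_dual \<alpha> * weyl_vec b) * weyl_dual \<beta> =
      weyl_vec a * (weyl_vec b * weyl_dual \<alpha> + dual_app \<alpha> b *\<^sub>C 1) * weyl_dual \<beta>" by simp
  then show "weyl_vec a * weyl_dual \<alpha> * (weyl_vec b * weyl_dual \<beta>) =
     weyl_vec a * weyl_vec b * (weyl_dual \<alpha> * weyl_dual \<beta>) + dual_app \<alpha> b *\<^sub>C (weyl_vec a * weyl_dual \<beta>)"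
    by (simp add: distrib_left distrib_right mult.assoc mult_scaleC_left mult_scaleC_right)
  show "weyl_vec a * weyl_vec b = weyl_vec b * weyl_vec a" "weyl_dual \<alpha> * weyl_dual \<beta> = weyl_dual \<beta> * weyl_dual \<alpha>"
    using weyl_in_commute[of "(a, 0)" "(b, 0)"] weyl_in_commute[of "(0, \<alpha>)" "(0, \<beta>)"] by (simp_all add: 0 D)
qed

context
  fixes bp :: "'g::z2_quadratic_lie_algebra ppart cx set"
  assumes bp: "cbasis bp"
begin

abbreviation (input) pdual where "pdual \<equiv> dual_elt (cx_form qform_p) bp"

lemma pdual: "Bp.dual_bases bp (\<lambda>z. z) pdual"
  by (rule Bp.dual_bases_dual_elt[OF bp])

lemma nu_alt: "nu bp y = (\<Sum>z\<in>bp. weyl_vec (cx_bilin kp_lie y z) * weyl_dual (p_flat (pdual z)))"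
  unfolding nu_def by (intro sum.cong refl) (simp add: dual_basis_elt_p_flat[OF bp])

lemma nu_linear: "clinear (nu bp)"
  by (rule clinearI)
    (simp_all add: nu_alt cbilinearD[OF cx_bilin_kp_lie_bilinear] clinearD[OF weyl_vec_linear] distrib_right
      sum.distrib mult_scaleC_left scaleC_sum_right)

text \<open>After normal ordering, the contractions sum over a dual family to the composite of the
  two actions on \<open>p\<close>; the uncontracted terms form the double sum.\<close>

lemma nu_mult:
  "nu bp x * nu bp y =
    (\<Sum>z\<in>bp. \<Sum>u\<in>bp. weyl_vec (cx_bilin kp_lie x z) * weyl_vec (cx_bilin kp_lie y u) *
        (weyl_dual (p_flat (pdual z)) * weyl_dual (p_flat (pdual u))))
    + (\<Sum>u\<in>bp. weyl_vec (cx_bilin kp_lie x (cx_bilin kp_lie y u)) * weyl_dual (p_flat (pdual u)))"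
proof -
  have "(\<Sum>z\<in>bp. cx_form qform_p v (pdual z) *\<^sub>C (weyl_vec (cx_bilin kp_lie x z) * w)) =
    weyl_vec (cx_bilin kp_lie x v) * w" for v w
    by (rule Bp.dual_bases_expand(1)[OF pdual])
      (simp add: clinearI clinearD[OF weyl_vec_linear] cbilinearD[OF cx_bilin_kp_lie_bilinear] distrib_right mult_scaleC_left)
  then have "(\<Sum>u\<in>bp. \<Sum>z\<in>bp. cx_form qform_p (pdual z) (cx_bilin kp_lie y u) *\<^sub>C
      (weyl_vec (cx_bilin kp_lie x z) * weyl_dual (p_flat (pdual u)))) =
    (\<Sum>u\<in>bp. weyl_vec (cx_bilin kp_lie x (cx_bilin kp_lie y u)) * weyl_dual (p_flat (pdual u)))"
    by (simp add: Bp.sym[of "pdual _"])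
  then show ?thesis
    by (subst (asm) sum.swap)
      (simp add: nu_alt sum_product weyl_product(1) p_flat_app sum.distrib)
qed

text \<open>The uncontracted double sum is symmetric in \<open>x\<close> and \<open>y\<close>,
  because vectors commute with vectors and functionals with functionals. It cancels in the
  commutator, and the contractions leave the representation property of \<open>k\<close> on
  \<open>p\<close>.\<close>

lemma nu_lie: "nu bp (lie x y) = nu bp x * nu bp y - nu bp y * nu bp x"
proof -
  let ?F = "\<lambda>x y. \<Sum>z\<in>bp. \<Sum>u\<in>bp. weyl_vec (cx_bilin kp_lie x z) * weyl_vec (cx_bilin kp_lie y u) *
        (weyl_dual (p_flat (pdual z)) * weyl_dual (p_flat (pdual u)))"
  have "?F x y = ?F y x"
    by (subst sum.swap) (intro sum.cong refl arg_cong2[where f = "(*)"] weyl_product(2,3))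
  then show ?thesis
    by (simp add: nu_mult) (simp add: nu_alt cx_bilin_kp_lie_lie clinearD[OF weyl_vec_linear] left_diff_distrib
        sum_subtractf)
qed

lemma weyl_act_nu:
  "weyl_act (nu bp y) P = (\<Sum>z\<in>bp. sym_in (cx_bilin kp_lie y z) * sym_deriv (p_flat (pdual z)) P)"
  by (simp add: nu_alt weyl_act_sum weyl_act_simps)

end

section \<open>Transport of the Casimir scalar from a simple module to its isotypic
  component\<close>

section \<open>The isotypic component\<close>

text \<open>Centrality and Schur's lemma make the Casimir element a scalar on
  \<open>\<sigma>\<close>. Intertwiners carry this scalar to every copy of \<open>\<sigma>\<close>,
  and the copies span the component.\<close>

lemma casimir_acts_on_isotypic:
  fixes \<sigma> :: "'v::complex_lie_algebra \<Rightarrow> 's \<Rightarrow> 's::complex_vector" and \<tau> :: "'v \<Rightarrow> 'n \<Rightarrow> 'n::complex_vector"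
  assumes "invariant_form B" "cbasis b" "lie_rep \<sigma>" "simple_submodule (range \<sigma>) UNIV"
    "cfin_dim (UNIV :: 's set)" "\<And>y. clinear (\<tau> y)" and x: "x \<in> isotypic_component \<sigma> \<tau>"
  shows "(\<Sum>w\<in>b. \<tau> w (\<tau> (dual_elt B b w) x)) = acting_scalar (uea_act \<sigma> (casimir B b)) *\<^sub>C x"
proof -
  interpret invariant_form B by fact
  let ?T = "uea_act \<sigma> (casimir B b)" and ?c = "acting_scalar (uea_act \<sigma> (casimir B b))"
  have T: "?T s = ?c *\<^sub>C s" for s
  proof (rule schur_acting_scalar[OF assms(4,5)])
    show "clinear ?T" by (rule cbilinear_linear(1)[OF uea_act_bilinear[OF assms(3)]])
    show "clinear t" if "t \<in> range \<sigma>" for t using that lie_rep_linear[OF assms(3)] by blast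
    show "?T (t s) = t (?T s)" if "t \<in> range \<sigma>" for t s
    proof -
      obtain y where t: "t = \<sigma> y" using \<open>t \<in> range \<sigma>\<close> by blast
      have "uea_act \<sigma> (casimir B b * uea_in y) s = uea_act \<sigma> (uea_in y * casimir B b) s"
        by (simp add: casimir_commute[OF assms(2)])
      then show ?thesis by (simp add: t uea_act_simps[OF assms(3)])
    qed
  qed
  show ?thesis
    using x unfolding isotypic_component_def
  proof (induction rule: cvs.span_induct_alt)
    case base
    then show ?case by (simp add: clinearD(3)[OF assms(6)])
  next
    case (step c y z)
    then obtain f s where f: "clinear f" "\<And>x s. f (\<sigma> x s) = \<tau> x (f s)" and y: "y = f s" by auto
    have "(\<Sum>w\<in>b. \<tau> w (\<tau> (dual_elt B b w) y)) = f (?T s)"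
      by (simp add: y f(2) casimir_def uea_act_sum[OF assms(3)] uea_act_simps[OF assms(3)] clinear_sum[OF f(1)])
    also have "\<dots> = ?c *\<^sub>C y" by (simp add: T clinearD[OF f(1)] y)
    finally show ?case using step(2)
      by (simp add: clinearD[OF assms(6)] sum.distrib scaleC_add_right scaleC_scaleC mult.commute
          flip: scaleC_sum_right)
  qed
qed

section \<open>The commutator of the two Dirac operators and the diagonal Casimir element\<close>

section \<open>The Dirac operators\<close>

lemma weyl_act_gen: "weyl_act (weyl_vec v) = (\<lambda>P. sym_in v * P)" "weyl_act (weyl_dual \<alpha>) = sym_deriv \<alpha>"
  "weyl_act 1 = (\<lambda>P. P)"
  by (simp_all add: fun_eq_iff weyl_act_simps)

lemma id_linear: "clinear (\<lambda>x :: 'x::complex_vector. x)"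
  by (rule clinearI) simp_all

context
  fixes \<pi> :: "'g::z2_quadratic_lie_algebra cx \<Rightarrow> 'm \<Rightarrow> 'm::complex_vector"
  assumes rep: "lie_rep \<pi>"
begin

lemma pi_simps:
  "\<pi> x (m + n) = \<pi> x m + \<pi> x n" "\<pi> x (c *\<^sub>C m) = c *\<^sub>C \<pi> x m" "\<pi> (x + y) m = \<pi> x m + \<pi> y m"
  "\<pi> (c *\<^sub>C x) m = c *\<^sub>C \<pi> x m" "\<pi> (- x) m = - \<pi> x m"
  using cbilinearD[OF lie_rep_bilinear[OF rep]] cbilinear_minus[OF lie_rep_bilinear[OF rep]] by auto

lemma pi_k_bilinear: "cbilinear (\<lambda>u. \<pi> (k_incl u))"
  and pi_p_bilinear: "cbilinear (\<lambda>u. \<pi> (p_incl u))"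
  by (rule cbilinearI; simp add: clinearD[OF k_incl_linear] clinearD[OF p_incl_linear] pi_simps)+

lemma uea_act_uea_in: "uea_act \<pi> (uea_in x) = \<pi> x" "uea_act \<pi> 1 = (\<lambda>m. m)"
  by (simp_all add: fun_eq_iff uea_act_simps[OF rep])

lemma tensor_act_linear_right: "clinear (tensor_act \<pi> T)"
proof (induction T rule: tensor_induct)
  case (tens u w)
  have "tensor_act \<pi> (u \<otimes>\<^sub>C w) = tensor_map (uea_act \<pi> u) (weyl_act w)"
    by (simp add: fun_eq_iff tensor_act_tens[OF rep])
  then show ?case
    by (simp add: tensor_map_linear cbilinear_linear(1)[OF uea_act_bilinear[OF rep]]
        cbilinear_linear(1)[OF weyl_act_bilinear])
next
  case (add x y)
  then show ?case
    by (intro clinearI) (simp_all add: clinearD(1)[OF tensor_act_linear[OF rep]] clinearD[OF add(1)]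
        clinearD[OF add(2)] scaleC_add_right algebra_simps)
qed

lemma tensor_act_Dplus:
  "tensor_act \<pi> (Dplus bp) t = (\<Sum>z\<in>bp. tensor_map (\<pi> (p_incl z)) (\<lambda>P. sym_in (pdual bp z) * P) t)"
  by (simp add: Dplus_def clinear_sum[OF tensor_act_linear[OF rep]] tensor_act_tens[OF rep]
      uea_act_uea_in weyl_act_gen)

lemma tensor_act_pure:
  "tensor_act \<pi> (u \<otimes>\<^sub>C w) (m \<otimes>\<^sub>C P) = uea_act \<pi> u m \<otimes>\<^sub>C weyl_act w P"
  by (simp add: tensor_act_tens[OF rep] tensor_map_tens cbilinear_linear(1)[OF uea_act_bilinear[OF rep]]
      cbilinear_linear(1)[OF weyl_act_bilinear])

context
  fixes bk :: "'g kpart cx set" and bp :: "'g ppart cx set"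
  assumes bk: "cbasis bk" and bp: "cbasis bp"
begin

abbreviation (input) kdual where "kdual \<equiv> dual_elt (cx_form qform_k) bk"

lemma kdual: "Bk.dual_bases bk (\<lambda>w. w) kdual"
  by (rule Bk.dual_bases_dual_elt[OF bk])

lemma tensor_act_Dminus:
  "tensor_act \<pi> (Dminus bp) t = (\<Sum>z\<in>bp. tensor_map (\<pi> (p_incl z)) (sym_deriv (p_flat (pdual bp z))) t)"
  by (simp add: Dminus_def clinear_sum[OF tensor_act_linear[OF rep]] tensor_act_tens[OF rep]
      uea_act_uea_in weyl_act_gen dual_basis_elt_p_flat[OF bp])

lemma Dplus_pure:
  "tensor_act \<pi> (Dplus bp) (m \<otimes>\<^sub>C P) = (\<Sum>z\<in>bp. \<pi> (p_incl z) m \<otimes>\<^sub>C (sym_in (pdual bp z) * P))"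
  by (simp add: tensor_act_Dplus tensor_map_tens lie_rep_linear[OF rep] mult_left_linear)

lemma Dminus_pure:
  "tensor_act \<pi> (Dminus bp) (m \<otimes>\<^sub>C P) = (\<Sum>z\<in>bp. \<pi> (p_incl z) m \<otimes>\<^sub>C sym_deriv (p_flat (pdual bp z)) P)"
  by (simp add: tensor_act_Dminus tensor_map_tens lie_rep_linear[OF rep] sym_deriv_linear)

lemma Delta_pure:
  "tensor_act \<pi> (Delta bp y) (m \<otimes>\<^sub>C P) = \<pi> (k_incl y) m \<otimes>\<^sub>C P + m \<otimes>\<^sub>C weyl_act (nu bp y) P"
  by (simp add: Delta_def clinearD(1)[OF tensor_act_linear[OF rep]] tensor_act_pure uea_act_uea_in weyl_act_gen)

text \<open>The two composites differ in the order of the factors acting on \<open>m\<close>, which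
  gives brackets of elements of \<open>p\<close>. In addition, the product rule produces
  contractions, which give the \<open>p\<close>-part of the Casimir element of
  \<open>g\<close>.\<close>

lemma Dirac_commutator_pure:
  "tensor_act \<pi> (Dplus bp) (tensor_act \<pi> (Dminus bp) (m \<otimes>\<^sub>C P))
     - tensor_act \<pi> (Dminus bp) (tensor_act \<pi> (Dplus bp) (m \<otimes>\<^sub>C P))
   = - (\<Sum>w\<in>bk. \<pi> (k_incl w) m \<otimes>\<^sub>C weyl_act (nu bp (kdual w)) P)
     - (\<Sum>u\<in>bp. \<pi> (p_incl u) (\<pi> (p_incl (pdual bp u)) m)) \<otimes>\<^sub>C P"
proof -
  let ?d = "pdual bp"
  let ?Q = "\<lambda>u. sym_deriv (p_flat (?d u)) P"
  let ?c = "\<lambda>z u. \<pi> (p_incl z) (\<pi> (p_incl u) m)"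
  have "(\<Sum>z\<in>bp. \<Sum>u\<in>bp. \<pi> (lie (p_incl z) (p_incl u)) m \<otimes>\<^sub>C (sym_in (?d z) * ?Q u))
    = - (\<Sum>z\<in>bp. \<Sum>u\<in>bp. \<Sum>w\<in>bk. cx_form qform_p z (cx_bilin kp_lie (kdual w) u) *\<^sub>C
          (\<pi> (k_incl w) m \<otimes>\<^sub>C (sym_in (?d z) * ?Q u)))"
  proof -
    have "\<pi> (lie (p_incl z) (p_incl u)) m =
        - (\<Sum>w\<in>bk. cx_form qform_p z (cx_bilin kp_lie (kdual w) u) *\<^sub>C \<pi> (k_incl w) m)" for z u
      using p_bracket_expand[OF kdual cbilinear_linear(2)[OF lie_rep_bilinear[OF rep]], of z u m] by simp
    then show ?thesis by (simp add: tens_simps sum_negf)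
  qed
  \<comment> \<open>The sum over \<open>z\<close> is brought innermost, where it will collapse to
    multiplication by \<open>cx_bilin kp_lie (kdual w) u\<close>; the sum over \<open>u\<close> is
    then \<open>nu\<close>.\<close>
  also have "\<dots> = - (\<Sum>w\<in>bk. \<Sum>u\<in>bp. \<Sum>z\<in>bp. cx_form qform_p (cx_bilin kp_lie (kdual w) u) z *\<^sub>C
          (\<pi> (k_incl w) m \<otimes>\<^sub>C (sym_in (?d z) * ?Q u)))" (is "- ?A = - ?B")
  proof -
    have "?A = (\<Sum>u\<in>bp. \<Sum>z\<in>bp. \<Sum>w\<in>bk. cx_form qform_p z (cx_bilin kp_lie (kdual w) u) *\<^sub>C
          (\<pi> (k_incl w) m \<otimes>\<^sub>C (sym_in (?d z) * ?Q u)))"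
      by (rule sum.swap)
    also have "\<dots> = (\<Sum>u\<in>bp. \<Sum>w\<in>bk. \<Sum>z\<in>bp. cx_form qform_p z (cx_bilin kp_lie (kdual w) u) *\<^sub>C
          (\<pi> (k_incl w) m \<otimes>\<^sub>C (sym_in (?d z) * ?Q u)))"
      by (intro sum.cong refl sum.swap)
    also have "\<dots> = (\<Sum>w\<in>bk. \<Sum>u\<in>bp. \<Sum>z\<in>bp. cx_form qform_p z (cx_bilin kp_lie (kdual w) u) *\<^sub>C
          (\<pi> (k_incl w) m \<otimes>\<^sub>C (sym_in (?d z) * ?Q u)))"
      by (rule sum.swap)
    finally show ?thesis by (simp add: Bp.sym)
  qed
  also have "\<dots> = - (\<Sum>w\<in>bk. \<pi> (k_incl w) m \<otimes>\<^sub>C weyl_act (nu bp (kdual w)) P)"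
  proof -
    have "clinear (\<lambda>v. \<pi> (k_incl w) m \<otimes>\<^sub>C (sym_in v * ?Q u))" for w u
      by (rule clinear_comp[OF cbilinear_linear(1)[OF tens_bilinear] cbilinear_linear(2)[OF mult_bilinear]])
    from Bp.dual_bases_expand(2)[OF pdual[OF bp] this]
    show ?thesis by (simp add: weyl_act_nu[OF bp] tens_simps)
  qed
  finally have bracket: "(\<Sum>z\<in>bp. \<Sum>u\<in>bp. \<pi> (lie (p_incl z) (p_incl u)) m \<otimes>\<^sub>C (sym_in (?d z) * ?Q u))
    = - (\<Sum>w\<in>bk. \<pi> (k_incl w) m \<otimes>\<^sub>C weyl_act (nu bp (kdual w)) P)" .
  \<comment> \<open>The matrix of contractions is the Gram matrix of the dual basis, so summing
    against it replaces the second basis vector by \<open>?d u\<close>.\<close>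
  have "clinear (\<lambda>v. \<pi> (p_incl u) (\<pi> (p_incl v) m) \<otimes>\<^sub>C P)" for u
    by (rule clinearI) (simp_all add: clinearD[OF p_incl_linear] pi_simps tens_simps)
  from Bp.dual_bases_expand(1)[OF pdual[OF bp] this]
  have square: "(\<Sum>u\<in>bp. \<Sum>z\<in>bp. cx_form qform_p (?d u) (?d z) *\<^sub>C (?c u z \<otimes>\<^sub>C P))
    = (\<Sum>u\<in>bp. ?c u (?d u)) \<otimes>\<^sub>C P" by (simp add: tens_simps)
  have plus: "tensor_act \<pi> (Dplus bp) (tensor_act \<pi> (Dminus bp) (m \<otimes>\<^sub>C P))
    = (\<Sum>z\<in>bp. \<Sum>u\<in>bp. ?c z u \<otimes>\<^sub>C (sym_in (?d z) * ?Q u))"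
    by (subst sum.swap) (simp add: Dminus_pure clinear_sum[OF tensor_act_linear_right] Dplus_pure)
  \<comment> \<open>The second double sum comes from differentiating the factor \<open>?d z\<close>
    along \<open>?d u\<close>.\<close>
  have minus: "tensor_act \<pi> (Dminus bp) (tensor_act \<pi> (Dplus bp) (m \<otimes>\<^sub>C P))
    = (\<Sum>z\<in>bp. \<Sum>u\<in>bp. ?c u z \<otimes>\<^sub>C (sym_in (?d z) * ?Q u))
      + (\<Sum>u\<in>bp. \<Sum>z\<in>bp. cx_form qform_p (?d u) (?d z) *\<^sub>C (?c u z \<otimes>\<^sub>C P))"
    by (subst (2) sum.swap)
      (simp add: Dplus_pure clinear_sum[OF tensor_act_linear_right] Dminus_pure sym_deriv_simps p_flat_app
        tens_simps sum.distrib add.commute)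
  have "(\<Sum>z\<in>bp. \<Sum>u\<in>bp. ?c z u \<otimes>\<^sub>C (sym_in (?d z) * ?Q u))
      - (\<Sum>z\<in>bp. \<Sum>u\<in>bp. ?c u z \<otimes>\<^sub>C (sym_in (?d z) * ?Q u))
    = (\<Sum>z\<in>bp. \<Sum>u\<in>bp. \<pi> (lie (p_incl z) (p_incl u)) m \<otimes>\<^sub>C (sym_in (?d z) * ?Q u))"
    by (simp add: lie_rep_lie[OF rep] clinearD(5)[OF cbilinear_linear(2)[OF tens_bilinear]] flip: sum_subtractf)
  then show ?thesis by (simp add: plus minus square bracket diff_diff_eq[symmetric])
qed

text \<open>The two cross terms agree because the canonical tensor of \<open>k\<close> is symmetric;
  hence the factor 2.\<close>

lemma Delta_casimir_pure:
  "(\<Sum>w\<in>bk. tensor_act \<pi> (Delta bp w) (tensor_act \<pi> (Delta bp (kdual w)) (m \<otimes>\<^sub>C P)))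
   = (\<Sum>w\<in>bk. \<pi> (k_incl w) (\<pi> (k_incl (kdual w)) m)) \<otimes>\<^sub>C P
     + m \<otimes>\<^sub>C (\<Sum>w\<in>bk. weyl_act (nu bp w) (weyl_act (nu bp (kdual w)) P))
     + 2 *\<^sub>C (\<Sum>w\<in>bk. \<pi> (k_incl w) m \<otimes>\<^sub>C weyl_act (nu bp (kdual w)) P)"
proof -
  have bil: "cbilinear (\<lambda>u v. \<pi> (k_incl u) m \<otimes>\<^sub>C weyl_act (nu bp v) P)"
    by (rule cbilinearI) (simp_all add: cbilinearD[OF pi_k_bilinear] clinearD[OF nu_linear[OF bp]]
        weyl_act_simps tens_simps)
  have "(\<Sum>w\<in>bk. \<pi> (k_incl (kdual w)) m \<otimes>\<^sub>C weyl_act (nu bp w) P)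
    = (\<Sum>w\<in>bk. \<pi> (k_incl w) m \<otimes>\<^sub>C weyl_act (nu bp (kdual w)) P)"
    by (rule Bk.dual_bases_canonical[OF Bk.dual_bases_swap[OF kdual] kdual bil])
  moreover have "2 *\<^sub>C t = t + t" for t :: "('m, 'g ppart cx sym) tensor"
    using scaleC_add_left[of 1 1 t] by (simp add: scaleC_one)
  ultimately show ?thesis
    by (simp add: Delta_pure clinearD(1)[OF tensor_act_linear_right] sum.distrib tens_simps algebra_simps)
qed

lemma casimir_actions:
  "uea_act \<pi> (uea_k_incl (casimir_k bk)) m = (\<Sum>w\<in>bk. \<pi> (k_incl w) (\<pi> (k_incl (kdual w)) m))"
  "weyl_act (uea_hom (nu bp) (casimir_k bk)) P = (\<Sum>w\<in>bk. weyl_act (nu bp w) (weyl_act (nu bp (kdual w)) P))"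
  "cbasis bg \<Longrightarrow> uea_act \<pi> (casimir_g bg) m = (\<Sum>w\<in>bk. \<pi> (k_incl w) (\<pi> (k_incl (kdual w)) m))
    + (\<Sum>u\<in>bp. \<pi> (p_incl u) (\<pi> (p_incl (pdual bp u)) m))"
proof -
  have "clinear (\<lambda>x :: 'g kpart cx. uea_in (k_incl x))"
    by (rule clinear_comp[OF uea_in_linear k_incl_linear])
  then have "uea_k_incl (casimir_k bk) = (\<Sum>w\<in>bk. uea_in (k_incl w) * uea_in (k_incl (kdual w)))"
    unfolding casimir_def by (intro uea_hom_sum_mult) (simp_all add: uea_in_lie flip: lie_incl(1))
  then show "uea_act \<pi> (uea_k_incl (casimir_k bk)) m = (\<Sum>w\<in>bk. \<pi> (k_incl w) (\<pi> (k_incl (kdual w)) m))"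
    by (simp add: uea_act_sum[OF rep] uea_act_simps[OF rep])
  show "weyl_act (uea_hom (nu bp) (casimir_k bk)) P = (\<Sum>w\<in>bk. weyl_act (nu bp w) (weyl_act (nu bp (kdual w)) P))"
    unfolding casimir_def by (simp add: uea_hom_sum_mult nu_linear[OF bp] nu_lie[OF bp] weyl_act_sum weyl_act_simps)
  show "uea_act \<pi> (casimir_g bg) m = (\<Sum>w\<in>bk. \<pi> (k_incl w) (\<pi> (k_incl (kdual w)) m))
    + (\<Sum>u\<in>bp. \<pi> (p_incl u) (\<pi> (p_incl (pdual bp u)) m))" if "cbasis bg"
    by (simp add: casimir_g_decompose[OF that kdual pdual[OF bp]] uea_act_simps[OF rep] uea_act_sum[OF rep])
qed

lemma Dirac_commutator:
  assumes "cbasis bg"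
  shows "tensor_act \<pi> (Dplus bp) (tensor_act \<pi> (Dminus bp) t) - tensor_act \<pi> (Dminus bp) (tensor_act \<pi> (Dplus bp) t)
    = - tensor_act \<pi> (casimir_g bg \<otimes>\<^sub>C 1) t + (3/2) *\<^sub>C tensor_act \<pi> (uea_k_incl (casimir_k bk) \<otimes>\<^sub>C 1) t
      + (1/2) *\<^sub>C tensor_act \<pi> (1 \<otimes>\<^sub>C uea_hom (nu bp) (casimir_k bk)) t
      - (1/2) *\<^sub>C (\<Sum>w\<in>bk. tensor_act \<pi> (Delta bp w) (tensor_act \<pi> (Delta bp (kdual w)) t))"
proof (rule clinear_tensor_eqI[where t = t])
  note L = clinearD[OF tensor_act_linear_right]
  show "clinear (\<lambda>t. tensor_act \<pi> (Dplus bp) (tensor_act \<pi> (Dminus bp) t)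
      - tensor_act \<pi> (Dminus bp) (tensor_act \<pi> (Dplus bp) t))"
    by (rule clinearI) (simp_all add: L scaleC_diff_right)
  show "clinear (\<lambda>t. - tensor_act \<pi> (casimir_g bg \<otimes>\<^sub>C 1) t
      + (3/2) *\<^sub>C tensor_act \<pi> (uea_k_incl (casimir_k bk) \<otimes>\<^sub>C 1) t
      + (1/2) *\<^sub>C tensor_act \<pi> (1 \<otimes>\<^sub>C uea_hom (nu bp) (casimir_k bk)) t
      - (1/2) *\<^sub>C (\<Sum>w\<in>bk. tensor_act \<pi> (Delta bp w) (tensor_act \<pi> (Delta bp (kdual w)) t)))"
    by (rule clinearI) (simp_all add: L sum.distrib scaleC_add_right scaleC_diff_right scaleC_scaleC
        scaleC_sum_right mult.commute)
  fix m and P :: "'g ppart cx sym"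
  define a b where "a = (\<Sum>w\<in>bk. \<pi> (k_incl w) (\<pi> (k_incl (kdual w)) m)) \<otimes>\<^sub>C P"
    and "b = (\<Sum>u\<in>bp. \<pi> (p_incl u) (\<pi> (p_incl (pdual bp u)) m)) \<otimes>\<^sub>C P"
  define n x where "n = m \<otimes>\<^sub>C (\<Sum>w\<in>bk. weyl_act (nu bp w) (weyl_act (nu bp (kdual w)) P))"
    and "x = (\<Sum>w\<in>bk. \<pi> (k_incl w) m \<otimes>\<^sub>C weyl_act (nu bp (kdual w)) P)"
  have "(3/2) *\<^sub>C a = a + (1/2) *\<^sub>C a"
    using scaleC_add_left[of 1 "1/2" a] by (simp add: scaleC_one)
  \<comment> \<open>Here \<open>a + b\<close> is the Casimir element of \<open>g\<close> and
    \<open>a + n + 2 x\<close> the diagonal one. Eliminating \<open>b\<close> costs one copy of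
    \<open>a\<close>, eliminating \<open>x\<close> half a copy each of \<open>a\<close> and
    \<open>n\<close>; this is the origin of 3/2 and 1/2.\<close>
  then have "- x - b = - (a + b) + (3/2) *\<^sub>C a + (1/2) *\<^sub>C n - (1/2) *\<^sub>C (a + n + 2 *\<^sub>C x)"
    by (simp add: scaleC_add_right scaleC_scaleC scaleC_one)
  then show "tensor_act \<pi> (Dplus bp) (tensor_act \<pi> (Dminus bp) (m \<otimes>\<^sub>C P))
      - tensor_act \<pi> (Dminus bp) (tensor_act \<pi> (Dplus bp) (m \<otimes>\<^sub>C P))
    = - tensor_act \<pi> (casimir_g bg \<otimes>\<^sub>C 1) (m \<otimes>\<^sub>C P)
      + (3/2) *\<^sub>C tensor_act \<pi> (uea_k_incl (casimir_k bk) \<otimes>\<^sub>C 1) (m \<otimes>\<^sub>C P)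
      + (1/2) *\<^sub>C tensor_act \<pi> (1 \<otimes>\<^sub>C uea_hom (nu bp) (casimir_k bk)) (m \<otimes>\<^sub>C P)
      - (1/2) *\<^sub>C (\<Sum>w\<in>bk. tensor_act \<pi> (Delta bp w) (tensor_act \<pi> (Delta bp (kdual w)) (m \<otimes>\<^sub>C P)))"
    unfolding Dirac_commutator_pure Delta_casimir_pure tensor_act_pure casimir_actions(1,2)
      casimir_actions(3)[OF assms] uea_act_uea_in(2) weyl_act_gen(3) tens_simps(1) a_def b_def n_def x_def .
qed

section \<open>Adjoints with respect to the hermitian form on the tensor product\<close>

context
  fixes herm :: "'m \<Rightarrow> 'm \<Rightarrow> complex"
  assumes herm: "hermitian_form herm" "star_invariant \<pi> herm"
begin

abbreviation (input) form where "form \<equiv> tensor_form herm poly_form"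

lemmas herm_sesquilinear = hermitian_form_sesquilinear[OF herm(1)]
lemmas form_sesquilinear = tensor_form_sesquilinear[OF herm_sesquilinear poly_form_sesquilinear]
lemmas form_adjoint = tensor_form_adjoint[OF herm_sesquilinear poly_form_sesquilinear]

text \<open>Each summand has an adjoint with conjugated vectors and the sign of the star operation
  on \<open>g\<close>. The conjugated families are again dual, so their sum is the original
  one.\<close>

lemma Dplus_adjoint: "form (tensor_act \<pi> (Dplus bp) s) t = - form s (tensor_act \<pi> (Dminus bp) t)"
proof -
  let ?F = "\<lambda>u w. tensor_map (\<pi> (p_incl u)) (sym_deriv (p_flat w)) t"
  have bil: "cbilinear ?F" by (rule tensor_map_family_bilinear[OF pi_p_bilinear deriv_bilinear])
  have "form (tensor_map (\<pi> (p_incl z)) (\<lambda>P. sym_in w * P) s) t = form s (?F (- cx_conj z) (cx_conj w))" for z w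
    by (rule form_adjoint) (simp_all add: lie_rep_linear[OF rep] mult_left_linear sym_deriv_linear
        star_invariant_apply[OF herm(2) rep] poly_form_adjoint incl_conj clinearD(4)[OF p_incl_linear])
  then have "form (tensor_act \<pi> (Dplus bp) s) t
      = - form s (\<Sum>z\<in>bp. ?F (cx_conj z) (cx_conj (pdual bp z)))"
    by (simp add: tensor_act_Dplus sesquilinear_sum[OF form_sesquilinear] cbilinear_minus[OF bil]
        sesquilinear_minus[OF form_sesquilinear] sum_negf)
  also have "(\<Sum>z\<in>bp. ?F (cx_conj z) (cx_conj (pdual bp z))) = (\<Sum>z\<in>bp. ?F z (pdual bp z))"
    by (rule Bp.dual_bases_canonical[OF Bp_dual_bases_conj[OF pdual[OF bp]] pdual[OF bp] bil])
  finally show ?thesis by (simp add: tensor_act_Dminus)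
qed

text \<open>The argument for \<open>Dplus_adjoint\<close> with multiplication and differentiation
  exchanged; it does not pass through hermitian symmetry of \<open>poly_form\<close>.\<close>

lemma Dminus_adjoint: "form (tensor_act \<pi> (Dminus bp) s) t = - form s (tensor_act \<pi> (Dplus bp) t)"
proof -
  let ?F = "\<lambda>u w. tensor_map (\<pi> (p_incl u)) (\<lambda>P. sym_in w * P) t"
  have bil: "cbilinear ?F" by (rule tensor_map_family_bilinear[OF pi_p_bilinear mult_bilinear])
  have "form (tensor_map (\<pi> (p_incl z)) (sym_deriv (p_flat w)) s) t = form s (?F (- cx_conj z) (cx_conj w))" for z w
    by (rule form_adjoint) (simp_all add: lie_rep_linear[OF rep] mult_left_linear sym_deriv_linear
        star_invariant_apply[OF herm(2) rep] poly_form_adjoint incl_conj clinearD(4)[OF p_incl_linear])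
  then have "form (tensor_act \<pi> (Dminus bp) s) t
      = - form s (\<Sum>z\<in>bp. ?F (cx_conj z) (cx_conj (pdual bp z)))"
    by (simp add: tensor_act_Dminus sesquilinear_sum[OF form_sesquilinear] cbilinear_minus[OF bil]
        sesquilinear_minus[OF form_sesquilinear] sum_negf)
  also have "(\<Sum>z\<in>bp. ?F (cx_conj z) (cx_conj (pdual bp z))) = (\<Sum>z\<in>bp. ?F z (pdual bp z))"
    by (rule Bp.dual_bases_canonical[OF Bp_dual_bases_conj[OF pdual[OF bp]] pdual[OF bp] bil])
  finally show ?thesis by (simp add: tensor_act_Dplus)
qed

text \<open>In each product of two elements of \<open>k\<close> the two signs cancel, the order
  reverses and the vectors are conjugated. The swapped and conjugated families are still dual, so
  the sum is unchanged.\<close>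

lemma casimir_k_self_adjoint:
  "form (tensor_act \<pi> (uea_k_incl (casimir_k bk) \<otimes>\<^sub>C 1) s) t
    = form s (tensor_act \<pi> (uea_k_incl (casimir_k bk) \<otimes>\<^sub>C 1) t)"
proof -
  let ?C = "uea_act \<pi> (uea_k_incl (casimir_k bk))"
  have lin: "clinear ?C" by (rule cbilinear_linear(1)[OF uea_act_bilinear[OF rep]])
  have "herm (?C m) m' = herm m (?C m')" for m m'
  proof -
    have bil: "cbilinear (\<lambda>u v. \<pi> (k_incl u) (\<pi> (k_incl v) m'))"
      by (rule cbilinearI) (simp_all add: clinearD[OF k_incl_linear] pi_simps)
    have step: "herm (\<pi> (k_incl u) n) n' = - herm n (\<pi> (k_incl (cx_conj u)) n')" for u n n'
      by (simp add: star_invariant_apply[OF herm(2) rep] incl_conj pi_simps sesquilinear_minus[OF herm_sesquilinear])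
    have "herm (?C m) m' = herm m (\<Sum>w\<in>bk. \<pi> (k_incl (cx_conj (kdual w))) (\<pi> (k_incl (cx_conj w)) m'))"
      by (simp add: casimir_actions(1) sesquilinear_sum[OF herm_sesquilinear] step)
    also have "(\<Sum>w\<in>bk. \<pi> (k_incl (cx_conj (kdual w))) (\<pi> (k_incl (cx_conj w)) m')) = ?C m'"
      unfolding casimir_actions(1)
      by (rule Bk.dual_bases_canonical[OF Bk_dual_bases_conj[OF Bk.dual_bases_swap[OF kdual]] kdual bil])
    finally show ?thesis .
  qed
  then show ?thesis unfolding tensor_act_tens[OF rep] weyl_act_gen
    by (intro form_adjoint lin id_linear) simp_all
qed

end

end

end

section \<open>Assembly of the norm identity on the isotypic component\<close>

theorem proposition3p12:
  fixes K :: "'k monoid" and T :: "'k topology" and A :: "('k set \<times> ('k \<Rightarrow> 'e::real_normed_vector)) set"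
    and expK :: "'g::z2_quadratic_lie_algebra kpart \<Rightarrow> 'k" and Ad :: "'k \<Rightarrow> 'g cx \<Rightarrow> 'g cx"
    and \<pi> :: "'g cx \<Rightarrow> 'm \<Rightarrow> 'm::complex_vector" and \<rho> :: "'k \<Rightarrow> 'm \<Rightarrow> 'm"
    and herm :: "'m \<Rightarrow> 'm \<Rightarrow> complex" and chi :: "'g cx uea \<Rightarrow> complex"
    and \<sigma> :: "'g kpart cx \<Rightarrow> 's \<Rightarrow> 's::complex_vector"
    and bg :: "'g cx set" and bk :: "'g kpart cx set" and bp :: "'g ppart cx set"
    and x :: "('m, 'g ppart cx sym) tensor"
  assumes "gK_module K T A expK Ad \<pi> \<rho>" and "admissible K \<rho>"
    and "hermitian_form herm" and "nondegenerate_form herm" and "star_invariant \<pi> herm"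
    and "infinitesimal_character \<pi> chi"
    and "lie_rep \<sigma>" and "simple_submodule (range \<sigma>) UNIV" and "cfin_dim (UNIV :: 's set)"
    and "cbasis bg" and "cbasis bk" and "cbasis bp"
    and "x \<in> isotypic_component \<sigma> (\<lambda>y. tensor_act \<pi> (Delta bp y))"
  shows "tensor_form herm poly_form (tensor_act \<pi> (Dplus bp) x) (tensor_act \<pi> (Dplus bp) x)
       - tensor_form herm poly_form (tensor_act \<pi> (Dminus bp) x) (tensor_act \<pi> (Dminus bp) x)
     = (- chi (casimir_g bg) - 1/2 * acting_scalar (uea_act \<sigma> (casimir_k bk)))
         * tensor_form herm poly_form x x
       + 3/2 * tensor_form herm poly_form (tensor_act \<pi> (uea_k_incl (casimir_k bk) \<otimes>\<^sub>C 1) x) x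
       + 1/2 * tensor_form herm poly_form x (tensor_act \<pi> (1 \<otimes>\<^sub>C uea_hom (nu bp) (casimir_k bk)) x)"
proof -
  have rep: "lie_rep \<pi>" using assms(1) by (rule gK_module.lie_rep)
  let ?form = "tensor_form herm poly_form"
  note S = tensor_form_sesquilinear[OF hermitian_form_sesquilinear[OF assms(3)] poly_form_sesquilinear]
  note adj = Dplus_adjoint[OF rep assms(11,12,3,5)] Dminus_adjoint[OF rep assms(11,12,3,5)]
  have "uea_act \<pi> (casimir_g bg) m = chi (casimir_g bg) *\<^sub>C m" for m
    using assms(6) Bg.casimir_in_center[OF assms(10)] by (simp add: infinitesimal_character_def)
  then have g: "tensor_act \<pi> (casimir_g bg \<otimes>\<^sub>C 1) t = chi (casimir_g bg) *\<^sub>C t" for t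
    by (induction t rule: tensor_induct)
      (simp_all add: clinearD[OF tensor_act_linear_right[OF rep]] tensor_act_pure[OF rep] weyl_act_simps
        tens_simps scaleC_add_right)
  have k: "(\<Sum>w\<in>bk. tensor_act \<pi> (Delta bp w) (tensor_act \<pi> (Delta bp (dual_elt (cx_form qform_k) bk w)) x))
      = acting_scalar (uea_act \<sigma> (casimir_k bk)) *\<^sub>C x"
    by (rule casimir_acts_on_isotypic[OF Bk.invariant_form_axioms assms(11,7,8,9)
        tensor_act_linear_right[OF rep] assms(13)])
  \<comment> \<open>Moving each left operator across the form turns the two squares into minus
    \<open>D- D+\<close> and minus \<open>D+ D-\<close>, so their difference is the commutator. The
    unary minus lets the sesquilinearity rules apply directly.\<close>
  have "?form (tensor_act \<pi> (Dplus bp) x) (tensor_act \<pi> (Dplus bp) x)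
      - ?form (tensor_act \<pi> (Dminus bp) x) (tensor_act \<pi> (Dminus bp) x)
    = ?form x (tensor_act \<pi> (Dplus bp) (tensor_act \<pi> (Dminus bp) x)
      + - tensor_act \<pi> (Dminus bp) (tensor_act \<pi> (Dplus bp) x))"
    by (simp only: adj sesquilinearD[OF S] sesquilinear_minus[OF S]) simp
  also have "\<dots> = ?form x (- (chi (casimir_g bg) *\<^sub>C x) + (3/2) *\<^sub>C tensor_act \<pi> (uea_k_incl (casimir_k bk) \<otimes>\<^sub>C 1) x
      + (1/2) *\<^sub>C tensor_act \<pi> (1 \<otimes>\<^sub>C uea_hom (nu bp) (casimir_k bk)) x
      + - ((1/2) *\<^sub>C (acting_scalar (uea_act \<sigma> (casimir_k bk)) *\<^sub>C x)))"
    using Dirac_commutator[OF rep assms(11,12,10), of x] by (simp add: g k)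
  \<comment> \<open>The claim has the Casimir element of \<open>k\<close> in the left argument, the
    commutator formula in the right one; self-adjointness reconciles them.\<close>
  finally show ?thesis
    unfolding casimir_k_self_adjoint[OF rep assms(11,12,3,5)]
    by (simp only: sesquilinearD[OF S] sesquilinear_minus[OF S]) (simp add: algebra_simps)
qed

end
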